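(* Let $f:N\to N$ be an Axiom A diffeomorphism of a smooth compact Riemannian manifold $N$, let $X$ be a closed $f$-invariant component of the non-wandering set of $f$ (as given by the Spectral Decomposition Theorem) such that $T:=f\restriction X$ is topologically transitive. Let $\mathcal{M}_e$ be the set of ergodic $T$-invariant Borel probability measures on $X$, with the weak topology. Then the set $$\{\mu\in\mathcal{M}_e\mid \underline{R}(x,y)=0 \text{ for } (\mu\times\mu)\text{-a.e. }(x,y)\in X\times X\}$$ is residual in $\mathcal{M}_e$.
   Context: A diffeomorphism is Axiom A if its non-wandering set is hyperbolic and its periodic points are dense in the non-wandering set. A subset of a topological space is residual if it contains the intersection of a countable family of open dense subsets. With $d$ the distance on $X$ induced by the Riemannian metric, for $x,y\in X$ and $r>0$ let $\tau_r(x,y)=\inf\{n\in\mathbb{N}\mid T^nx\in\overline{B}(y,r)\}$, where $\mathbb{N}=\{1,2,\dots\}$, $\overline{B}(y,r)$ is the closed ball, $\inf\emptyset=\infty$ and $\log\infty=\infty$; and $\underline{R}(x,y)=\liminf_{r\to0}\frac{\log\tau_r(x,y)}{-\log r}$. *)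

theory Defs
  imports "HOL-Probability.Probability"
begin

section \<open>Smooth manifolds\<close>

text \<open>\<open>C_k_on k h S\<close> is meant for open sets \<open>S\<close>: all directional derivatives up to order \<open>k\<close>
  exist and are continuous on \<open>S\<close>.\<close>

primrec C_k_on :: "nat \<Rightarrow> ('b::euclidean_space \<Rightarrow> 'c::real_normed_vector) \<Rightarrow> 'b set \<Rightarrow> bool" where
  "C_k_on 0 h S \<longleftrightarrow> continuous_on S h"
| "C_k_on (Suc k) h S \<longleftrightarrow>
     (\<forall>z\<in>S. h differentiable (at z)) \<and> (\<forall>v. C_k_on k (\<lambda>z. frechet_derivative h (at z) v) S)"

definition smooth_on :: "('b::euclidean_space \<Rightarrow> 'c::real_normed_vector) \<Rightarrow> 'b set \<Rightarrow> bool" where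
  "smooth_on h S \<longleftrightarrow> (\<forall>k. C_k_on k h S)"

text \<open>A chart is a pair \<open>(U, \<phi>)\<close>; only the values of \<open>\<phi>\<close> on \<open>U\<close> matter.\<close>

type_synonym ('a, 'b) chart = "'a set \<times> ('a \<Rightarrow> 'b)"

definition chart_inv :: "('a, 'b) chart \<Rightarrow> 'b \<Rightarrow> 'a" where
  "chart_inv c = inv_into (fst c) (snd c)"

definition is_chart :: "('a::topological_space, 'b::euclidean_space) chart \<Rightarrow> bool" where
  "is_chart c \<longleftrightarrow> open (fst c) \<and> open (snd c ` fst c) \<and>
     homeomorphism (fst c) (snd c ` fst c) (snd c) (chart_inv c)"

definition smooth_atlas :: "('a::topological_space, 'b::euclidean_space) chart set \<Rightarrow> bool" where
  "smooth_atlas A \<longleftrightarrow>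
     (\<forall>c\<in>A. is_chart c) \<and> (\<Union>c\<in>A. fst c) = UNIV \<and>
     (\<forall>c\<in>A. \<forall>d\<in>A. smooth_on (snd d \<circ> chart_inv c) (snd c ` (fst c \<inter> fst d)))"

text \<open>The tangent space at \<open>p\<close> is the model space \<open>'b\<close>, identified with \<open>T\<^sub>pN\<close> by means of
  a chart around \<open>p\<close> that is chosen once and for all. Subspaces of \<open>T\<^sub>pN\<close> are therefore just
  subspaces of \<open>'b\<close>.\<close>

definition chart_at :: "('a, 'b) chart set \<Rightarrow> 'a \<Rightarrow> ('a, 'b) chart" where
  "chart_at A p = (SOME c. c \<in> A \<and> p \<in> fst c)"

text \<open>The tangent vector at \<open>p\<close> whose coordinates in the chart \<open>c\<close> are \<open>v\<close>.\<close>

definition tangent_of_coords ::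
    "('a, 'b::euclidean_space) chart set \<Rightarrow> ('a, 'b) chart \<Rightarrow> 'a \<Rightarrow> 'b \<Rightarrow> 'b" where
  "tangent_of_coords A c p = frechet_derivative (snd (chart_at A p) \<circ> chart_inv c) (at (snd c p))"

text \<open>The differential \<open>T\<^sub>pN \<rightarrow> T\<^bsub>f p\<^esub>N\<close> of \<open>f\<close> at \<open>p\<close>.\<close>

definition differential ::
    "('a, 'b::euclidean_space) chart set \<Rightarrow> ('a \<Rightarrow> 'a) \<Rightarrow> 'a \<Rightarrow> 'b \<Rightarrow> 'b" where
  "differential A f p =
     frechet_derivative (snd (chart_at A (f p)) \<circ> f \<circ> chart_inv (chart_at A p))
       (at (snd (chart_at A p) p))"

definition C1_map ::
    "('a::topological_space, 'b::euclidean_space) chart set \<Rightarrow> ('a \<Rightarrow> 'a) \<Rightarrow> bool" where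
  "C1_map A f \<longleftrightarrow> continuous_on UNIV f \<and>
     (\<forall>c\<in>A. \<forall>d\<in>A. C_k_on 1 (snd d \<circ> f \<circ> chart_inv c) (snd c ` (fst c \<inter> f -` fst d)))"

definition diffeomorphism ::
    "('a::topological_space, 'b::euclidean_space) chart set \<Rightarrow> ('a \<Rightarrow> 'a) \<Rightarrow> bool" where
  "diffeomorphism A f \<longleftrightarrow> bij f \<and> C1_map A f \<and> C1_map A (inv f)"

section \<open>Riemannian metrics and the induced distance\<close>

definition riemannian_metric ::
    "('a::topological_space, 'b::euclidean_space) chart set \<Rightarrow> ('a \<Rightarrow> 'b \<Rightarrow> 'b \<Rightarrow> real) \<Rightarrow> bool" where
  "riemannian_metric A g \<longleftrightarrow>
     (\<forall>p. bilinear (g p) \<and> (\<forall>v w. g p v w = g p w v) \<and> (\<forall>v. v \<noteq> 0 \<longrightarrow> g p v v > 0)) \<and>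
     (\<forall>c\<in>A. \<forall>v w.
        smooth_on (\<lambda>z. let p = chart_inv c z in
                     g p (tangent_of_coords A c p v) (tangent_of_coords A c p w))
          (snd c ` fst c))"

text \<open>The underlying space is the whole type \<open>'a\<close>; the manifold has no boundary but need not be
  connected.\<close>

definition compact_riemannian_manifold ::
    "('a::{t2_space, second_countable_topology}, 'b::euclidean_space) chart set \<Rightarrow>
      ('a \<Rightarrow> 'b \<Rightarrow> 'b \<Rightarrow> real) \<Rightarrow> bool" where
  "compact_riemannian_manifold A g \<longleftrightarrow>
     compact (UNIV :: 'a set) \<and> smooth_atlas A \<and> riemannian_metric A g"

definition riem_norm :: "('a \<Rightarrow> 'b \<Rightarrow> 'b \<Rightarrow> real) \<Rightarrow> 'a \<Rightarrow> 'b \<Rightarrow> real" where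
  "riem_norm g p v = sqrt (g p v v)"

definition C1_curve_on ::
    "('a::topological_space, 'b::euclidean_space) chart set \<Rightarrow> real \<Rightarrow> real \<Rightarrow> (real \<Rightarrow> 'a) \<Rightarrow> bool" where
  "C1_curve_on A a b \<gamma> \<longleftrightarrow> continuous_on {a..b} \<gamma> \<and>
     (\<forall>c\<in>A. \<exists>D. continuous_on ({a..b} \<inter> \<gamma> -` fst c) D \<and>
        (\<forall>t \<in> {a..b} \<inter> \<gamma> -` fst c.
           ((snd c \<circ> \<gamma>) has_vector_derivative D t) (at t within {a..b})))"

definition piecewise_C1_curve ::
    "('a::topological_space, 'b::euclidean_space) chart set \<Rightarrow> (real \<Rightarrow> 'a) \<Rightarrow> bool" where
  "piecewise_C1_curve A \<gamma> \<longleftrightarrow>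
     (\<exists>(m::nat) s. s 0 = 0 \<and> s m = 1 \<and>
        (\<forall>i<m. s i < s (Suc i) \<and> C1_curve_on A (s i) (s (Suc i)) \<gamma>))"

text \<open>At the finitely many break points the velocity need not exist; they do not contribute to the
  integral.\<close>

definition curve_length ::
    "('a, 'b::euclidean_space) chart set \<Rightarrow> ('a \<Rightarrow> 'b \<Rightarrow> 'b \<Rightarrow> real) \<Rightarrow> (real \<Rightarrow> 'a) \<Rightarrow> ennreal" where
  "curve_length A g \<gamma> =
     (\<integral>\<^sup>+ t\<in>{0..1}. ennreal (riem_norm g (\<gamma> t)
        (vector_derivative (snd (chart_at A (\<gamma> t)) \<circ> \<gamma>) (at t))) \<partial>lborel)"

text \<open>Points in different connected components have distance \<open>\<infinity>\<close>.\<close>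

definition riem_dist ::
    "('a::topological_space, 'b::euclidean_space) chart set \<Rightarrow> ('a \<Rightarrow> 'b \<Rightarrow> 'b \<Rightarrow> real) \<Rightarrow>
      'a \<Rightarrow> 'a \<Rightarrow> ennreal" where
  "riem_dist A g x y =
     (INF \<gamma>\<in>{\<gamma>. piecewise_C1_curve A \<gamma> \<and> \<gamma> 0 = x \<and> \<gamma> 1 = y}. curve_length A g \<gamma>)"

section \<open>Axiom A diffeomorphisms\<close>

definition nonwandering_set :: "('a::topological_space \<Rightarrow> 'a) \<Rightarrow> 'a set" where
  "nonwandering_set f = {x. \<forall>U. open U \<and> x \<in> U \<longrightarrow> (\<exists>n\<ge>1. (f ^^ n) ` U \<inter> U \<noteq> {})}"

definition periodic_points :: "('a \<Rightarrow> 'a) \<Rightarrow> 'a set" where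
  "periodic_points f = {x. \<exists>n\<ge>1. (f ^^ n) x = x}"

definition hyperbolic_set ::
    "('a::topological_space, 'b::euclidean_space) chart set \<Rightarrow> ('a \<Rightarrow> 'b \<Rightarrow> 'b \<Rightarrow> real) \<Rightarrow>
      ('a \<Rightarrow> 'a) \<Rightarrow> 'a set \<Rightarrow> bool" where
  "hyperbolic_set A g f \<Lambda> \<longleftrightarrow> closed \<Lambda> \<and> f ` \<Lambda> = \<Lambda> \<and>
     (\<exists>Es Eu :: 'a \<Rightarrow> 'b set. \<exists>C>0. \<exists>\<kappa>. 0 < \<kappa> \<and> \<kappa> < 1 \<and>
        (\<forall>x\<in>\<Lambda>.
           subspace (Es x) \<and> subspace (Eu x) \<and>
           Es x \<inter> Eu x = {0} \<and> (\<forall>v. \<exists>a\<in>Es x. \<exists>b\<in>Eu x. v = a + b) \<and>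
           differential A f x ` Es x = Es (f x) \<and>
           differential A f x ` Eu x = Eu (f x) \<and>
           (\<forall>v\<in>Es x. \<forall>n.
              riem_norm g ((f ^^ n) x) (differential A (f ^^ n) x v) \<le> C * \<kappa> ^ n * riem_norm g x v) \<and>
           (\<forall>v\<in>Eu x. \<forall>n.
              riem_norm g ((inv f ^^ n) x) (differential A (inv f ^^ n) x v)
                \<le> C * \<kappa> ^ n * riem_norm g x v)))"

definition axiom_A ::
    "('a::topological_space, 'b::euclidean_space) chart set \<Rightarrow> ('a \<Rightarrow> 'b \<Rightarrow> 'b \<Rightarrow> real) \<Rightarrow>
      ('a \<Rightarrow> 'a) \<Rightarrow> bool" where
  "axiom_A A g f \<longleftrightarrow> diffeomorphism A f \<and>
     hyperbolic_set A g f (nonwandering_set f) \<and>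
     nonwandering_set f \<subseteq> closure (periodic_points f)"

definition topologically_transitive_on :: "('a::topological_space \<Rightarrow> 'a) \<Rightarrow> 'a set \<Rightarrow> bool" where
  "topologically_transitive_on f X \<longleftrightarrow>
     (\<forall>U V. openin (top_of_set X) U \<and> openin (top_of_set X) V \<and> U \<noteq> {} \<and> V \<noteq> {} \<longrightarrow>
        (\<exists>n\<ge>1. (f ^^ n) ` U \<inter> V \<noteq> {}))"

text \<open>The decomposition of the non-wandering set into basic sets whose existence (and uniqueness)
  for Axiom A diffeomorphisms is the Spectral Decomposition Theorem.\<close>

definition spectral_decomposition :: "('a::topological_space \<Rightarrow> 'a) \<Rightarrow> 'a set set \<Rightarrow> bool" where
  "spectral_decomposition f P \<longleftrightarrow>
     finite P \<and> pairwise disjnt P \<and> \<Union>P = nonwandering_set f \<and>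
     (\<forall>Y\<in>P. Y \<noteq> {} \<and> closed Y \<and> f ` Y = Y \<and> topologically_transitive_on f Y)"

section \<open>Spaces of measures\<close>

definition borel_probs_on :: "'a::topological_space set \<Rightarrow> 'a measure set" where
  "borel_probs_on X = {\<mu>. sets \<mu> = sets (restrict_space borel X) \<and> prob_space \<mu>}"

text \<open>The coarsest topology making \<open>\<mu> \<mapsto> \<integral>\<phi> d\<mu>\<close> continuous for all bounded continuous
  \<open>\<phi>: X \<rightarrow> \<real>\<close>.\<close>

definition weak_topology :: "'a::topological_space set \<Rightarrow> 'a measure topology" where
  "weak_topology X = topology_generated_by
     {{\<mu> \<in> borel_probs_on X. (\<integral>x. \<phi> x \<partial>\<mu>) \<in> W} | (\<phi> :: 'a \<Rightarrow> real) W.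
        continuous_on X \<phi> \<and> bounded (\<phi> ` X) \<and> open W}"

text \<open>Here and below the system is the restriction of \<open>f\<close> to an invariant set \<open>X\<close>; measures on
  \<open>X\<close> have \<open>X\<close> as their space, so only the values of \<open>f\<close> on \<open>X\<close> matter.\<close>

definition ergodic_measures :: "('a::topological_space \<Rightarrow> 'a) \<Rightarrow> 'a set \<Rightarrow> 'a measure set" where
  "ergodic_measures f X = {\<mu> \<in> borel_probs_on X.
     f \<in> measurable \<mu> \<mu> \<and> distr \<mu> \<mu> f = \<mu> \<and>
     (\<forall>B\<in>sets \<mu>. f -` B \<inter> space \<mu> = B \<longrightarrow> measure \<mu> B = 0 \<or> measure \<mu> B = 1)}"

definition residual_in :: "'a topology \<Rightarrow> 'a set \<Rightarrow> bool" where
  "residual_in S R \<longleftrightarrow> R \<subseteq> topspace S \<and>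
     (\<exists>\<U>. countable \<U> \<and> (\<forall>U\<in>\<U>. openin S U \<and> S closure_of U = topspace S) \<and>
        topspace S \<inter> \<Inter>\<U> \<subseteq> R)"

section \<open>Hitting times\<close>

text \<open>The infimum in \<^typ>\<open>enat\<close> of the empty set is \<open>\<infinity>\<close>.\<close>

definition hitting_time :: "('a \<Rightarrow> 'a \<Rightarrow> ennreal) \<Rightarrow> ('a \<Rightarrow> 'a) \<Rightarrow> real \<Rightarrow> 'a \<Rightarrow> 'a \<Rightarrow> enat" where
  "hitting_time d f r x y = (INF n\<in>{n. n \<ge> 1 \<and> d y ((f ^^ n) x) \<le> ennreal r}. enat n)"

definition ln_enat :: "enat \<Rightarrow> ereal" where
  "ln_enat t = (case t of enat n \<Rightarrow> ereal (ln (real n)) | \<infinity> \<Rightarrow> \<infinity>)"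

definition lower_R :: "('a \<Rightarrow> 'a \<Rightarrow> ennreal) \<Rightarrow> ('a \<Rightarrow> 'a) \<Rightarrow> 'a \<Rightarrow> 'a \<Rightarrow> ereal" where
  "lower_R d f x y =
     Liminf (at_right 0) (\<lambda>r. ln_enat (hitting_time d f r x y) / ereal (- ln r))"

end

theory Submission
  imports Defs
begin

text \<open>Measures on periodic orbits are dense among the ergodic measures: a point generic for an
  ergodic measure is recurrent, so the Anosov closing lemma shadows its orbit segments by periodic
  orbits; these are non-wandering, and since the finitely many pieces of the spectral decomposition
  are closed and disjoint they lie in \<open>X\<close>. If \<open>x\<close> and \<open>y\<close> are near a periodic orbit of period
  \<open>n\<close>, then \<open>x\<close> is close to \<open>y\<close> after at most \<open>n\<close> steps, where ``close'' can be made arbitrarily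
  small compared to \<open>n\<close>. For each \<open>k\<close>, the measures giving mass more than \<open>1 - 2\<^sup>-\<^sup>k\<close> to such a
  neighbourhood (tested by a cutoff function) therefore form an open dense set, and by Borel-Cantelli
  almost all pairs \<open>(x, y)\<close> for a measure in all these sets have hitting exponent \<open>0\<close>.

  The closing lemma is a contraction argument in charts. It rests on an a priori estimate for
  \<open>v\<^sub>i\<^sub>+\<^sub>1 = D\<^sub>i v\<^sub>i + w\<^sub>i\<close>, \<open>v\<^sub>0 - v\<^sub>n = c\<close>. Closing up requires an angle bound between the
  stable space at \<open>x\<close> and the unstable space at \<open>f\<^sup>n x\<close>; it comes from comparing the derivatives of a
  fixed iterate \<open>f\<^sup>m\<close> at these two nearby points, so continuity of the splitting is not needed.\<close>

section \<open>Linear and nonlinear perturbations of hyperbolic sequences\<close>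

text \<open>The closing lemma must fix its neighbourhood of \<open>x\<close> before the return time
  \<open>n\<close> is known, so no constant may depend on \<open>n\<close>. Hyperbolicity comes with
  a factor \<open>C\<close> that may exceed 1; hence a single step need not contract, and a time
  \<open>m\<close> with \<open>C * \<kappa> ^ m \<le> 1 / 2\<close> is fixed instead. All vectors
  are measured by the Euclidean norm of the model space in finitely many charts with compact pieces,
  at the price of a larger \<open>C\<close>. The closing condition \<open>v 0 - v n = c\<close>
  makes sense only if times \<open>0\<close> and \<open>n\<close> use the same chart, and the angle
  comparison needs a common chart at times \<open>m\<close> and \<open>n + m\<close> as well. The
  phase space carries no metric: shadowing is expressed by an open neighbourhood \<open>W\<close> of
  the diagonal. One such \<open>W\<close> can at once encode uniform continuity of finitely many
  test functions and separation of \<open>X\<close> from the other basic sets. The Riemannian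
  distance enters only through upper bounds on small chart balls.\<close>

primrec cocycle :: "(nat \<Rightarrow> 'b \<Rightarrow> 'b) \<Rightarrow> nat \<Rightarrow> nat \<Rightarrow> 'b \<Rightarrow> 'b" where
  "cocycle D i 0 v = v"
| "cocycle D i (Suc k) v = D (i + k) (cocycle D i k v)"

lemma linear_cocycle:
  assumes "\<And>i. linear (D i)"
  shows "linear (cocycle D i k)"
proof (induction k)
  case 0
  have "cocycle D i 0 = id" by (auto simp: fun_eq_iff)
  then show ?case by (metis linear_id)
next
  case (Suc k)
  have "cocycle D i (Suc k) = D (i + k) \<circ> cocycle D i k" by (auto simp: fun_eq_iff)
  then show ?case using Suc assms by (metis linear_compose)
qed

text \<open>If \<open>s\<close> and \<open>u\<close> nearly cancelled, their images could not: one
  is halved and the other doubled, so \<open>u'\<close> dominates the image sum, which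
  \<open>B\<close> bounds. The extra \<open>norm u / 2\<close> leaves room for moving
  \<open>s\<close> and \<open>u\<close> by two slightly different linear maps.\<close>

lemma norm_le_of_hyperbolic_pair:
  fixes s u s' u' :: "'b::real_normed_vector"
  assumes "2 * norm u \<le> norm u'" "norm s' \<le> norm s / 2"
    and "norm (s' + u') \<le> B * norm (s + u) + norm u / 2"
  shows "norm s \<le> (B + 2) * norm (s + u)" "norm u \<le> (B + 2) * norm (s + u)"
proof -
  have 1: "norm u' \<le> norm (s' + u') + norm s'"
    by (metis add_diff_cancel_left' norm_triangle_ineq4)
  have 2: "norm s \<le> norm (s + u) + norm u"
    by (metis add_diff_cancel_right' norm_triangle_ineq4)
  have "norm u \<le> B * norm (s + u) + norm (s + u) / 2" using 1 2 assms by argo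
  moreover have "norm (s + u) \<ge> 0" by simp
  ultimately show "norm s \<le> (B + 2) * norm (s + u)" "norm u \<le> (B + 2) * norm (s + u)"
    using 2 unfolding distrib_right by linarith+
qed

definition angle_const :: "real \<Rightarrow> nat \<Rightarrow> real" where
  "angle_const L m = L ^ m + 2"

text \<open>The value is what the last steps of \<open>periodic_estimate\<close> produce. It and
  \<open>angle_const\<close> stand outside the locale because radii are chosen from them before any
  sequence is given.\<close>

definition shadowing_const :: "real \<Rightarrow> real \<Rightarrow> real \<Rightarrow> nat \<Rightarrow> real" where
  "shadowing_const C \<kappa> L m =
     4 * C * angle_const L m * (1 + 2 * (C * angle_const L m / (1 - \<kappa>))) + 2 * (C * angle_const L m / (1 - \<kappa>))"

lemma angle_const_pos: "L > 0 \<Longrightarrow> angle_const L m > 0"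
  by (simp add: angle_const_def add_pos_pos)

lemma shadowing_const_pos:
  assumes "C > 0" "\<kappa> < 1" "L > 0"
  shows "shadowing_const C \<kappa> L m > 0"
  unfolding shadowing_const_def using assms angle_const_pos[of L m]
  by (intro add_pos_pos mult_pos_pos divide_pos_pos) auto

text \<open>Unstable spaces are mapped onto each other, since unstable defects are pulled back;
  stable ones only have to be carried forward. The angle between \<open>S i\<close> and
  \<open>U i\<close> is not assumed to be bounded below: that is derived from \<open>L\<close> and
  \<open>m\<close>.\<close>

locale hyperbolic_sequence =
  fixes D :: "nat \<Rightarrow> 'b::euclidean_space \<Rightarrow> 'b" and S U :: "nat \<Rightarrow> 'b set"
    and C \<kappa> L :: real and m :: nat
  assumes lin: "\<And>i. linear (D i)"
    and S_sub: "\<And>i. subspace (S i)" and U_sub: "\<And>i. subspace (U i)"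
    and S_inv: "\<And>i. D i ` S i \<subseteq> S (Suc i)" and U_inv: "\<And>i. D i ` U i = U (Suc i)"
    and decomp: "\<And>i v. \<exists>s\<in>S i. \<exists>u\<in>U i. v = s + u"
    and contr: "\<And>i k s. s \<in> S i \<Longrightarrow> norm (cocycle D i k s) \<le> C * \<kappa> ^ k * norm s"
    and expan: "\<And>i k u. u \<in> U i \<Longrightarrow> norm u \<le> C * \<kappa> ^ k * norm (cocycle D i k u)"
    and C_pos: "C > 0" and \<kappa>: "0 < \<kappa>" "\<kappa> < 1" and L_pos: "L > 0"
    and bound: "\<And>i v. norm (D i v) \<le> L * norm v"
    and m: "C * \<kappa> ^ m \<le> 1 / 2"
begin

abbreviation Q where "Q \<equiv> angle_const L m"

lemmas Q_def = angle_const_def and Q_pos = angle_const_pos[OF L_pos, of m]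

lemma cocycle_U: "cocycle D i k ` U i = U (i + k)"
proof (induction k)
  case (Suc k)
  have "cocycle D i (Suc k) ` U i = D (i + k) ` (cocycle D i k ` U i)"
    by (auto simp: image_image)
  then show ?case using Suc U_inv by simp
qed auto

lemma cocycle_bound: "norm (cocycle D i k v) \<le> L ^ k * norm v"
proof (induction k)
  case (Suc k)
  have "norm (D (i + k) (cocycle D i k v)) \<le> L * norm (cocycle D i k v)" by (rule bound)
  also have "\<dots> \<le> L * (L ^ k * norm v)" using Suc L_pos by simp
  finally show ?case by simp
qed auto

lemma contr_m: "s \<in> S i \<Longrightarrow> norm (cocycle D i m s) \<le> norm s / 2"
  using contr[of s i m] mult_right_mono[OF m, of "norm s"] by simp

lemma expan_m: "u \<in> U i \<Longrightarrow> 2 * norm u \<le> norm (cocycle D i m u)"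
  using expan[of u i m] mult_right_mono[OF m, of "norm (cocycle D i m u)"] by simp

lemma angle:
  assumes "s \<in> S i" "u \<in> U i"
  shows "norm s \<le> Q * norm (s + u)" "norm u \<le> Q * norm (s + u)"
proof -
  have "norm (cocycle D i m s + cocycle D i m u) \<le> L ^ m * norm (s + u) + norm u / 2"
    using cocycle_bound[of i m "s + u"] linear_add[OF linear_cocycle, of D, OF lin]
    by (simp add: add_increasing2)
  from norm_le_of_hyperbolic_pair[OF expan_m contr_m this] assms
  show "norm s \<le> Q * norm (s + u)" "norm u \<le> Q * norm (s + u)" by (auto simp: Q_def)
qed

lemma geometric_bound: "(\<Sum>l<k. \<kappa> ^ l) \<le> 1 / (1 - \<kappa>)"
proof -
  have "(\<Sum>l<k. \<kappa> ^ l) \<le> (\<Sum>l. \<kappa> ^ l)"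
    using \<kappa> by (intro sum_le_suminf) (auto simp: summable_geometric)
  then show ?thesis using \<kappa> by (simp add: suminf_geometric)
qed

text \<open>Variation of constants: \<open>s k\<close> is the transported initial value plus the
  transported defects, whose norms form a geometric series.\<close>

lemma stable_estimate:
  assumes s: "\<And>i. i \<le> n \<Longrightarrow> s i \<in> S i"
    and W: "\<And>i. i < n \<Longrightarrow> norm (s (Suc i) - D i (s i)) \<le> W" and "k \<le> n" "W \<ge> 0"
  shows "norm (s k) \<le> C * \<kappa> ^ k * norm (s 0) + C * W / (1 - \<kappa>)"
proof -
  define w where "w i = s (Suc i) - D i (s i)" for i
  have wS: "w i \<in> S (Suc i)" if "i < n" for i
    unfolding w_def using that s[of i] s[of "Suc i"] S_inv[of i] S_sub
    by (auto intro!: subspace_diff)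
  have eq: "s j = cocycle D 0 j (s 0) + (\<Sum>l<j. cocycle D (Suc l) (j - Suc l) (w l))" if "j \<le> n" for j
    using that
  proof (induction j)
    case (Suc j)
    have "s (Suc j) = D j (s j) + w j" by (simp add: w_def)
    also have "D j (s j) = D j (cocycle D 0 j (s 0)) + (\<Sum>l<j. D j (cocycle D (Suc l) (j - Suc l) (w l)))"
      using Suc lin by (simp add: linear_add linear_sum)
    also have "(\<Sum>l<j. D j (cocycle D (Suc l) (j - Suc l) (w l)))
        = (\<Sum>l<j. cocycle D (Suc l) (Suc j - Suc l) (w l))"
    proof (rule sum.cong)
      fix l assume "l \<in> {..<j}"
      then have "Suc j - Suc l = Suc (j - Suc l)" "Suc l + (j - Suc l) = j" by auto
      then show "D j (cocycle D (Suc l) (j - Suc l) (w l)) = cocycle D (Suc l) (Suc j - Suc l) (w l)"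
        by simp
    qed simp
    finally show ?case by simp
  qed simp
  have "norm (s k) \<le> norm (cocycle D 0 k (s 0)) + (\<Sum>l<k. norm (cocycle D (Suc l) (k - Suc l) (w l)))"
    unfolding eq[OF \<open>k \<le> n\<close>] by (rule order_trans[OF norm_triangle_ineq add_left_mono[OF norm_sum]])
  also have "\<dots> \<le> C * \<kappa> ^ k * norm (s 0) + (\<Sum>l<k. C * W * \<kappa> ^ (k - Suc l))"
  proof (intro add_mono sum_mono)
    show "norm (cocycle D 0 k (s 0)) \<le> C * \<kappa> ^ k * norm (s 0)" using contr s by blast
    fix l assume l: "l \<in> {..<k}"
    then have "norm (cocycle D (Suc l) (k - Suc l) (w l)) \<le> C * \<kappa> ^ (k - Suc l) * norm (w l)"
      using contr wS \<open>k \<le> n\<close> by simp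
    also have "\<dots> \<le> C * \<kappa> ^ (k - Suc l) * W"
      using W[of l] l \<open>k \<le> n\<close> C_pos \<kappa> by (intro mult_left_mono) (auto simp: w_def)
    finally show "norm (cocycle D (Suc l) (k - Suc l) (w l)) \<le> C * W * \<kappa> ^ (k - Suc l)"
      by (simp add: mult_ac)
  qed
  also have "(\<Sum>l<k. C * W * \<kappa> ^ (k - Suc l)) = C * W * (\<Sum>l<k. \<kappa> ^ l)"
    unfolding sum_distrib_left[symmetric] by (subst sum.nat_diff_reindex) simp
  also have "\<dots> \<le> C * W * (1 / (1 - \<kappa>))"
    using geometric_bound C_pos \<open>W \<ge> 0\<close> by (intro mult_left_mono) auto
  finally show ?thesis by simp
qed

text \<open>Variation of constants backwards in time, so the value at the end \<open>n\<close> takes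
  the place of the initial value.\<close>

lemma unstable_estimate:
  assumes u: "\<And>i. i \<le> n \<Longrightarrow> u i \<in> U i"
    and W: "\<And>i. i < n \<Longrightarrow> norm (u (Suc i) - D i (u i)) \<le> W" and "k \<le> n" "W \<ge> 0"
  shows "norm (u k) \<le> C * \<kappa> ^ (n - k) * norm (u n) + C * W / (1 - \<kappa>)"
proof -
  define w where "w i = u (Suc i) - D i (u i)" for i
  have wU: "w i \<in> U (Suc i)" if "i < n" for i
    unfolding w_def using that u[of i] u[of "Suc i"] U_inv[of i] U_sub
    by (auto intro!: subspace_diff)
  \<comment> \<open>Each defect is pulled back to time \<open>k\<close> inside the unstable space.
    Adding the preimages to \<open>u k\<close> gives a vector whose exact orbit ends at
    \<open>u n\<close>, and \<open>expan\<close> controls both it and the preimages.\<close>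
  have "\<exists>y. y \<in> U k \<and> cocycle D k (Suc j) y = w (k + j)" if "j < n - k" for j
  proof -
    have "w (k + j) \<in> cocycle D k (Suc j) ` U k" using wU[of "k + j"] that by (simp only: cocycle_U) simp
    then show ?thesis by (metis imageE)
  qed
  then obtain y where y: "\<And>j. j < n - k \<Longrightarrow> y j \<in> U k \<and> cocycle D k (Suc j) (y j) = w (k + j)"
    by metis
  have eq: "cocycle D k j (u k + (\<Sum>i<j. y i)) = u (k + j)" if "j \<le> n - k" for j
    using that
  proof (induction j)
    case (Suc j)
    have "cocycle D k (Suc j) (u k + (\<Sum>i<Suc j. y i))
        = cocycle D k (Suc j) (u k + (\<Sum>i<j. y i)) + cocycle D k (Suc j) (y j)"
      unfolding sum.lessThan_Suc add.assoc[symmetric]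
      by (rule linear_add[OF linear_cocycle[OF lin]])
    also have "\<dots> = D (k + j) (u (k + j)) + w (k + j)" using y[of j] Suc by simp
    finally show ?case by (simp add: w_def)
  qed simp
  let ?y = "\<Sum>i<n - k. y i"
  have yU: "?y \<in> U k" using y U_sub by (intro subspace_sum) auto
  have "norm (u k) \<le> norm (u k + ?y) + norm ?y"
    by (metis add_diff_cancel_right' norm_triangle_ineq4)
  also have "\<dots> \<le> C * \<kappa> ^ (n - k) * norm (u n) + (\<Sum>i<n - k. C * W * \<kappa> ^ i)"
  proof (intro add_mono order_trans[OF norm_sum] sum_mono)
    show "norm (u k + ?y) \<le> C * \<kappa> ^ (n - k) * norm (u n)"
      using expan[of "u k + ?y" k "n - k"] eq[of "n - k"] subspace_add[OF U_sub u[OF \<open>k \<le> n\<close>] yU] \<open>k \<le> n\<close>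
      by simp
    fix j assume j: "j \<in> {..<n - k}"
    then have "norm (y j) \<le> C * \<kappa> ^ Suc j * norm (w (k + j))"
      using expan[of "y j" k "Suc j"] y[of j] by simp
    also have "\<dots> \<le> C * \<kappa> ^ j * W"
      using W[of "k + j"] j C_pos \<kappa> 
      by (intro mult_mono mult_left_mono power_decreasing) (auto simp: w_def)
    finally show "norm (y j) \<le> C * W * \<kappa> ^ j" by (simp add: mult_ac)
  qed
  also have "(\<Sum>i<n - k. C * W * \<kappa> ^ i) \<le> C * W * (1 / (1 - \<kappa>))"
    unfolding sum_distrib_left[symmetric]
    using geometric_bound C_pos \<open>W \<ge> 0\<close> by (intro mult_left_mono) auto
  finally show ?thesis by simp
qed



text \<open>Stable parts are controlled by \<open>s 0\<close> and unstable parts by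
  \<open>u n\<close>. Periodicity couples these two unknowns through \<open>s 0 - u n\<close>, and
  \<open>wrap\<close>, the angle bound between times \<open>0\<close> and \<open>n\<close>,
  separates them again.\<close>

lemma periodic_estimate:
  assumes v: "\<And>i. i < n \<Longrightarrow> norm (v (Suc i) - D i (v i)) \<le> \<omega>" and v0: "norm (v 0 - v n) \<le> \<omega>"
    and wrap: "\<And>s u. s \<in> S 0 \<Longrightarrow> u \<in> U n \<Longrightarrow>
      norm s \<le> Q * norm (s + u) \<and> norm u \<le> Q * norm (s + u)"
    and n: "4 * Q * C * \<kappa> ^ n \<le> 1" and k: "k \<le> n"
  shows "norm (v k) \<le> shadowing_const C \<kappa> L m * \<omega>"
proof -
  have \<omega>: "\<omega> \<ge> 0" using v0 norm_ge_zero order_trans by blast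
  have "\<exists>s u. s \<in> S i \<and> u \<in> U i \<and> v i = s + u" for i using decomp by blast
  then obtain s u where su: "\<And>i. s i \<in> S i" "\<And>i. u i \<in> U i" "\<And>i. v i = s i + u i"
    by metis
  define B where "B = C * Q / (1 - \<kappa>)"
  have B: "C * (Q * \<omega>) / (1 - \<kappa>) = B * \<omega>" "B > 0" using C_pos Q_pos \<kappa> by (auto simp: B_def)
  have defect: "norm (s (Suc i) - D i (s i)) \<le> Q * \<omega>" "norm (u (Suc i) - D i (u i)) \<le> Q * \<omega>"
    if "i < n" for i
  proof -
    have mem: "s (Suc i) - D i (s i) \<in> S (Suc i)" "u (Suc i) - D i (u i) \<in> U (Suc i)"
      using su(1)[of i] su(2)[of i] su(1)[of "Suc i"] su(2)[of "Suc i"] S_inv[of i] U_inv[of i]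
      by (auto intro!: subspace_diff[OF S_sub] subspace_diff[OF U_sub])
    have e: "s (Suc i) - D i (s i) + (u (Suc i) - D i (u i)) = v (Suc i) - D i (v i)"
      by (simp add: su(3) linear_add[OF lin])
    have le: "Q * norm (v (Suc i) - D i (v i)) \<le> Q * \<omega>" using v[OF that] Q_pos by simp
    show "norm (s (Suc i) - D i (s i)) \<le> Q * \<omega>" "norm (u (Suc i) - D i (u i)) \<le> Q * \<omega>"
      using angle[OF mem] le unfolding e by auto
  qed
  have Q\<omega>: "Q * \<omega> \<ge> 0" using Q_pos \<omega> by simp
  have s_le: "norm (s j) \<le> C * \<kappa> ^ j * norm (s 0) + B * \<omega>" if "j \<le> n" for j
    using stable_estimate[of n s, OF su(1) defect(1) that Q\<omega>] B by simp
  have u_le: "norm (u j) \<le> C * \<kappa> ^ (n - j) * norm (u n) + B * \<omega>" if "j \<le> n" for j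
    using unstable_estimate[of n u, OF su(2) defect(2) that Q\<omega>] B by simp
  define t where "t = norm (s 0) + norm (u n)"
  have "s 0 - u n = (v 0 - v n) + (s n - u 0)" by (simp add: su(3))
  then have "norm (s 0 - u n) \<le> norm (v 0 - v n) + (norm (s n) + norm (u 0))"
    by (metis norm_triangle_ineq norm_triangle_ineq4 add_left_mono order_trans)
  also have "\<dots> \<le> \<omega> + (C * \<kappa> ^ n * t + 2 * (B * \<omega>))"
    using v0 s_le[of n] u_le[of 0] by (simp add: t_def distrib_left)
  finally have a: "norm (s 0 - u n) \<le> \<omega> + (C * \<kappa> ^ n * t + 2 * (B * \<omega>))" .
  have "- u n \<in> U n" using su(2) U_sub by (simp add: subspace_neg)
  from wrap[OF su(1)[of 0] this] have "t \<le> 2 * (Q * norm (s 0 - u n))" by (simp add: t_def)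
  also have "\<dots> \<le> 2 * (Q * (\<omega> + (C * \<kappa> ^ n * t + 2 * (B * \<omega>))))"
    using a Q_pos by simp
  \<comment> \<open>By the lower bound on \<open>n\<close>, the part containing \<open>t\<close> is
    at most \<open>t / 2\<close> and is absorbed on the left.\<close>
  also have "\<dots> = 2 * Q * (\<omega> + 2 * (B * \<omega>)) + (4 * Q * C * \<kappa> ^ n) * t / 2"
    by (simp add: algebra_simps)
  also have "\<dots> \<le> 2 * Q * (\<omega> + 2 * (B * \<omega>)) + 1 * t / 2"
    using n by (intro add_left_mono divide_right_mono mult_right_mono) (auto simp: t_def)
  finally have t: "t \<le> 4 * Q * (\<omega> + 2 * (B * \<omega>))" by simp
  have pw: "C * \<kappa> ^ j \<le> C" for j using C_pos \<kappa> by (simp add: power_le_one)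
  have "norm (v k) \<le> norm (s k) + norm (u k)" by (simp add: su(3) norm_triangle_ineq)
  also have "\<dots> \<le> (C * \<kappa> ^ k * norm (s 0) + B * \<omega>) + (C * \<kappa> ^ (n - k) * norm (u n) + B * \<omega>)"
    by (intro add_mono s_le u_le k)
  also have "\<dots> \<le> (C * norm (s 0) + B * \<omega>) + (C * norm (u n) + B * \<omega>)"
    by (intro add_mono mult_right_mono pw order_refl) auto
  also have "\<dots> = C * t + 2 * (B * \<omega>)" by (simp add: t_def algebra_simps)
  also have "\<dots> \<le> C * (4 * Q * (\<omega> + 2 * (B * \<omega>))) + 2 * (B * \<omega>)"
    using t C_pos by simp
  also have "\<dots> = shadowing_const C \<kappa> L m * \<omega>"
    by (simp add: shadowing_const_def B_def[symmetric] algebra_simps)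
  finally show ?thesis .
qed

end

text \<open>The solution is determined by \<open>v\<^sub>0\<close>; the periodicity condition is an equation for \<open>v\<^sub>0\<close> in the
  finite-dimensional model space, solvable because the estimate makes its homogeneous part injective.\<close>

lemma periodic_linear_solution:
  fixes D :: "nat \<Rightarrow> 'b::euclidean_space \<Rightarrow> 'b"
  assumes lin: "\<And>i. linear (D i)"
    and est: "\<And>v \<omega>. (\<And>i. i < n \<Longrightarrow> norm (v (Suc i) - D i (v i)) \<le> \<omega>) \<Longrightarrow>
      norm (v 0 - v n) \<le> \<omega> \<Longrightarrow> (\<And>i. i \<le> n \<Longrightarrow> norm (v i) \<le> K * \<omega>)"
  shows "\<exists>v. (\<forall>i<n. v (Suc i) = D i (v i) + w i) \<and> v 0 - v n = c"
proof -
  define M where "M v = v - cocycle D 0 n v" for v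
  have linM: "linear M"
    unfolding M_def using linear_cocycle[of D, OF lin] by (intro linear_compose_sub linear_id[unfolded id_def])
  have "inj M"
    unfolding linear_injective_0[OF linM]
  proof (intro allI impI)
    fix t assume "M t = 0"
    then have "norm (cocycle D 0 0 t) \<le> K * 0"
      by (intro est[of "\<lambda>i. cocycle D 0 i t"]) (auto simp: M_def)
    then show "t = 0" by simp
  qed
  then have surj: "surj M" using linM linear_injective_imp_surjective by blast
  \<comment> \<open>A particular solution starting at \<open>0\<close>; adding the homogeneous orbit
    of \<open>t\<close> turns the closing condition into \<open>M t = c + y n\<close>.\<close>
  define y where "y = rec_nat 0 (\<lambda>i v. D i v + w i)"
  have y: "y 0 = 0" "\<And>i. y (Suc i) = D i (y i) + w i" by (auto simp: y_def)
  obtain t where t: "M t = c + y n" using surj by (metis surjD)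
  let ?v = "\<lambda>i. cocycle D 0 i t + y i"
  have "\<forall>i<n. ?v (Suc i) = D i (?v i) + w i" using y by (simp add: linear_add[OF lin])
  moreover have "?v 0 - ?v n = c" using t y by (simp add: M_def algebra_simps)
  ultimately show ?thesis by (intro exI[of _ ?v]) blast
qed

text \<open>Contraction in the supremum norm over the indices up to \<open>n\<close>. The smallness
  of \<open>\<epsilon>\<close> and \<open>c\<close> is measured against \<open>K\<close> alone, so
  it is uniform in \<open>n\<close> whenever \<open>K\<close> is.\<close>

lemma periodic_nonlinear_solution:
  fixes D R :: "nat \<Rightarrow> 'b::euclidean_space \<Rightarrow> 'b"
  assumes lin: "\<And>i. linear (D i)"
    and est: "\<And>v \<omega>. (\<And>i. i < n \<Longrightarrow> norm (v (Suc i) - D i (v i)) \<le> \<omega>) \<Longrightarrow>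
      norm (v 0 - v n) \<le> \<omega> \<Longrightarrow> (\<And>i. i \<le> n \<Longrightarrow> norm (v i) \<le> K * \<omega>)"
    and K: "K > 0" and \<rho>: "\<rho> > 0" and \<epsilon>: "K * \<epsilon> \<le> 1 / 2" "\<epsilon> \<ge> 0"
    and R0: "\<And>i. i < n \<Longrightarrow> R i 0 = 0"
    and R: "\<And>i a b. i < n \<Longrightarrow> norm a \<le> \<rho> \<Longrightarrow> norm b \<le> \<rho> \<Longrightarrow> norm (R i a - R i b) \<le> \<epsilon> * norm (a - b)"
    and c: "2 * K * norm c \<le> \<rho>"
  shows "\<exists>v. (\<forall>i<n. v (Suc i) = D i (v i) + R i (v i)) \<and> v 0 - v n = c \<and> (\<forall>i\<le>n. norm (v i) \<le> \<rho>)"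
proof -
  define Sol where "Sol v v' \<longleftrightarrow> (\<forall>i<n. v' (Suc i) = D i (v' i) + R i (v i)) \<and> v' 0 - v' n = c"
    for v v' :: "nat \<Rightarrow> 'b"
  \<comment> \<open>The nonlinear term is frozen at \<open>v\<close> and the linear periodic problem
    is solved for the next iterate. Values beyond index \<open>n\<close> are arbitrary; the
    estimates only see indices up to \<open>n\<close>.\<close>
  define \<Phi> where "\<Phi> v = (SOME v'. Sol v v')" for v
  have \<Phi>: "(\<forall>i<n. \<Phi> v (Suc i) = D i (\<Phi> v i) + R i (v i)) \<and> \<Phi> v 0 - \<Phi> v n = c" for v
  proof -
    have "\<exists>v'. Sol v v'"
      unfolding Sol_def by (rule periodic_linear_solution[of D n K "\<lambda>i. R i (v i)" c]) (use lin est in blast)+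
    then have "Sol v (\<Phi> v)" unfolding \<Phi>_def by (rule someI_ex)
    then show ?thesis by (rule Sol_def[THEN iffD1])
  qed
  define V where "V k = (\<Phi> ^^ k) (\<lambda>_. 0)" for k
  have V0: "V 0 = (\<lambda>_. 0)" by (simp add: V_def)
  have VS: "i < n \<Longrightarrow> V (Suc k) (Suc i) = D i (V (Suc k) i) + R i (V k i)" 
    and Vc: "V (Suc k) 0 - V (Suc k) n = c" for k i
    using \<Phi>[of "V k"] by (auto simp: V_def)
  \<comment> \<open>The bound \<open>\<rho> * (1 - (1/2)^k)\<close> is the sum of the preceding
    increments, so the iterates stay in the ball where \<open>R\<close> is Lipschitz. A difference
    of successive iterates has periodicity defect zero and step defect at most
    \<open>\<epsilon>\<close> times the previous difference;
    \<open>K * \<epsilon> \<le> 1 / 2\<close> then halves it.\<close>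
  have main: "(\<forall>i\<le>n. norm (V k i) \<le> \<rho> * (1 - (1/2)^k)) \<and>
     (\<forall>i\<le>n. norm (V (Suc k) i - V k i) \<le> \<rho> * (1/2)^Suc k)" for k
  proof (induction k)
    case 0
    have "norm (V (Suc 0) i) \<le> K * norm c" if "i \<le> n" for i
      by (rule est[OF _ _ that]) (simp_all add: VS[of _ 0] Vc V0 R0 del: One_nat_def)
    moreover have "K * norm c \<le> \<rho> / 2" using c by simp
    ultimately have "norm (V (Suc 0) i) \<le> \<rho> / 2" if "i \<le> n" for i using that order_trans by blast
    then show ?case by (simp add: V0)
  next
    case (Suc k)
    have A: "norm (V (Suc k) i) \<le> \<rho> * (1 - (1/2)^Suc k)" if "i \<le> n" for i
    proof -
      have "norm (V (Suc k) i) \<le> norm (V k i) + norm (V (Suc k) i - V k i)"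
        by (metis add.commute diff_add_cancel norm_triangle_ineq)
      also have "\<dots> \<le> \<rho> * (1 - (1/2)^k) + \<rho> * (1/2)^Suc k" using Suc that by (intro add_mono) auto
      also have "\<dots> = \<rho> * (1 - (1/2)^Suc k)" by (simp add: algebra_simps)
      finally show ?thesis .
    qed
    have le\<rho>: "norm (V k i) \<le> \<rho>" "norm (V (Suc k) i) \<le> \<rho>" if "i \<le> n" for i
    proof -
      have "\<rho> * (1 - (1/2)^j) \<le> \<rho>" for j using \<rho> by simp
      then show "norm (V k i) \<le> \<rho>" "norm (V (Suc k) i) \<le> \<rho>" using Suc A that order_trans by blast+
    qed
    have "norm (V (Suc (Suc k)) i - V (Suc k) i) \<le> K * (\<epsilon> * (\<rho> * (1/2)^Suc k))" if "i \<le> n" for i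
    proof (rule est[of "\<lambda>i. V (Suc (Suc k)) i - V (Suc k) i", OF _ _ that])
      show "norm (V (Suc (Suc k)) 0 - V (Suc k) 0 - (V (Suc (Suc k)) n - V (Suc k) n)) \<le> \<epsilon> * (\<rho> * (1/2)^Suc k)"
      proof -
        have "V (Suc (Suc k)) 0 - V (Suc k) 0 - (V (Suc (Suc k)) n - V (Suc k) n) = 0"
          using Vc[of "Suc k"] Vc[of k] by (simp add: algebra_simps) 
        then show ?thesis using \<epsilon> \<rho> by simp
      qed
      fix i assume i: "i < n"
      have "V (Suc (Suc k)) (Suc i) - V (Suc k) (Suc i) - D i (V (Suc (Suc k)) i - V (Suc k) i)
          = R i (V (Suc k) i) - R i (V k i)"
        using i by (simp add: VS linear_diff[OF lin])
      then have "norm (V (Suc (Suc k)) (Suc i) - V (Suc k) (Suc i) - D i (V (Suc (Suc k)) i - V (Suc k) i))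
          \<le> \<epsilon> * norm (V (Suc k) i - V k i)" using R[OF i] le\<rho> i by simp
      also have "\<dots> \<le> \<epsilon> * (\<rho> * (1/2)^Suc k)" using Suc i \<epsilon> by (intro mult_left_mono) auto
      finally show "norm (V (Suc (Suc k)) (Suc i) - V (Suc k) (Suc i) - D i (V (Suc (Suc k)) i - V (Suc k) i))
          \<le> \<epsilon> * (\<rho> * (1/2)^Suc k)" .
    qed
    moreover have "K * (\<epsilon> * (\<rho> * (1/2)^Suc k)) \<le> \<rho> * (1/2)^Suc (Suc k)"
      using mult_right_mono[OF \<epsilon>(1), of "\<rho> * (1/2)^Suc k"] \<rho> by (simp add: mult_ac)
    ultimately show ?case using A by (meson order_trans)
  qed
  have le\<rho>: "norm (V k i) \<le> \<rho>" if "i \<le> n" for i k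
  proof -
    have "\<rho> * (1 - (1/2)^k) \<le> \<rho>" using \<rho> by simp
    then show ?thesis using main that order_trans by blast
  qed
  have "\<exists>l. (\<lambda>k. V k i) \<longlonglongrightarrow> l" if "i \<le> n" for i
  proof -
    have "summable (\<lambda>k. norm (V (Suc k) i - V k i))"
    proof (rule summable_comparison_test)
      show "\<exists>N. \<forall>k\<ge>N. norm (norm (V (Suc k) i - V k i)) \<le> \<rho> * (1/2)^Suc k" using main that by auto
      show "summable (\<lambda>k. \<rho> * (1/2)^Suc k)"
        by (intro summable_mult) (auto simp: summable_Suc_iff summable_geometric)
    qed
    then have "summable (\<lambda>k. V (Suc k) i - V k i)" by (rule summable_norm_cancel)
    then have "(\<lambda>m. \<Sum>k<m. V (Suc k) i - V k i) \<longlonglongrightarrow> (\<Sum>k. V (Suc k) i - V k i)"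
      by (rule summable_LIMSEQ)
    moreover have "(\<Sum>k<m. V (Suc k) i - V k i) = V m i" for m
      by (induction m) (auto simp: V0)
    ultimately show ?thesis by auto
  qed
  then obtain v where v: "\<And>i. i \<le> n \<Longrightarrow> (\<lambda>k. V k i) \<longlonglongrightarrow> v i" by metis
  have v': "(\<lambda>k. V (Suc k) i) \<longlonglongrightarrow> v i" if "i \<le> n" for i
    using LIMSEQ_Suc[OF v[OF that]] .
  have v\<rho>: "norm (v i) \<le> \<rho>" if "i \<le> n" for i
    using v[OF that] le\<rho>[OF that] by (intro LIMSEQ_le_const2[OF tendsto_norm]) auto
  have "v (Suc i) = D i (v i) + R i (v i)" if i: "i < n" for i
  proof (rule LIMSEQ_unique)
    show "(\<lambda>k. V (Suc k) (Suc i)) \<longlonglongrightarrow> v (Suc i)" using v'[of "Suc i"] i by simp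
    have "(\<lambda>k. R i (V k i) - R i (v i)) \<longlonglongrightarrow> 0"
    proof (rule Lim_null_comparison)
      show "\<forall>\<^sub>F k in sequentially. norm (R i (V k i) - R i (v i)) \<le> \<epsilon> * norm (V k i - v i)"
        using R[OF i] le\<rho> v\<rho> i by simp
      show "(\<lambda>k. \<epsilon> * norm (V k i - v i)) \<longlonglongrightarrow> 0"
        using v[of i] i by (intro tendsto_mult_right_zero tendsto_norm_zero) (simp add: LIM_zero)
    qed
    then have "(\<lambda>k. R i (V k i)) \<longlonglongrightarrow> R i (v i)" by (simp add: LIM_zero_iff)
    moreover have "(\<lambda>k. D i (V (Suc k) i)) \<longlonglongrightarrow> D i (v i)"
      using v'[of i] i by (intro bounded_linear.tendsto[OF linear_conv_bounded_linear[THEN iffD1, OF lin]]) simp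
    ultimately show "(\<lambda>k. V (Suc k) (Suc i)) \<longlonglongrightarrow> D i (v i) + R i (v i)"
      by (simp add: VS[OF i] tendsto_add)
  qed
  moreover have "v 0 - v n = c"
  proof (rule LIMSEQ_unique)
    show "(\<lambda>k. V (Suc k) 0 - V (Suc k) n) \<longlonglongrightarrow> v 0 - v n"
      using v'[of 0] v'[of n] by (intro tendsto_diff) simp_all
    show "(\<lambda>k. V (Suc k) 0 - V (Suc k) n) \<longlonglongrightarrow> c" by (simp add: Vc)
  qed
  ultimately show ?thesis using v\<rho> by (intro exI[of _ v]) auto
qed

section \<open>Derivatives in charts\<close>

text \<open>For \<open>F = id\<close> this is the derivative of a change of charts, so one chain
  rule serves maps and coordinate changes alike.\<close>

definition coord_deriv ::
    "('a, 'b::euclidean_space) chart \<Rightarrow> ('a, 'b) chart \<Rightarrow> ('a \<Rightarrow> 'a) \<Rightarrow> 'a \<Rightarrow> 'b \<Rightarrow> 'b" where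
  "coord_deriv c d F p = frechet_derivative (snd d \<circ> F \<circ> chart_inv c) (at (snd c p))"

text \<open>The consequence of \<open>C1_map\<close> that compactness arguments use: the derivative
  is continuous in operator norm, as a function of the point. In this form it is also preserved by
  composition.\<close>

definition C1_on_charts ::
    "('a::topological_space, 'b::euclidean_space) chart set \<Rightarrow> ('a \<Rightarrow> 'a) \<Rightarrow> bool" where
  "C1_on_charts A F \<longleftrightarrow> continuous_on UNIV F \<and>
     (\<forall>c\<in>A. \<forall>d\<in>A.
        (\<forall>p\<in>fst c \<inter> F -` fst d.
           ((snd d \<circ> F \<circ> chart_inv c) has_derivative coord_deriv c d F p) (at (snd c p))) \<and>
        continuous_on (fst c \<inter> F -` fst d) (\<lambda>p. Blinfun (coord_deriv c d F p)))"

text \<open>A Lebesgue number for the cover by open sets with property \<open>P\<close>.\<close>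

lemma compact_uniform_cball:
  fixes Z :: "'b::euclidean_space set"
  assumes "compact Z" and "\<And>z. z \<in> Z \<Longrightarrow> \<exists>G. open G \<and> z \<in> G \<and> P G"
  shows "\<exists>\<rho>>0. \<forall>z\<in>Z. \<exists>G. open G \<and> P G \<and> cball z \<rho> \<subseteq> G"
proof -
  have "Z \<subseteq> \<Union>{G. open G \<and> P G}" using assms(2) by blast
  from Heine_Borel_lemma[OF assms(1) this]
  obtain e where e: "e > 0" "\<And>z. z \<in> Z \<Longrightarrow> \<exists>G\<in>{G. open G \<and> P G}. ball z e \<subseteq> G" by blast
  show ?thesis
  proof (intro exI[of _ "e/2"] conjI ballI)
    fix z assume "z \<in> Z"
    with e obtain G where "open G" "P G" "ball z e \<subseteq> G" by blast
    moreover have "cball z (e/2) \<subseteq> ball z e" using e(1) by auto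
    ultimately show "\<exists>G. open G \<and> P G \<and> cball z (e/2) \<subseteq> G" by blast
  qed (use e in auto)
qed

locale smooth_manifold =
  fixes A :: "('a::t2_space, 'b::euclidean_space) chart set"
  assumes atlas: "smooth_atlas A"
begin

lemma chart_open: "c \<in> A \<Longrightarrow> open (fst c)"
  and chart_image_open: "c \<in> A \<Longrightarrow> open (snd c ` fst c)"
  and chart_cont: "c \<in> A \<Longrightarrow> continuous_on (fst c) (snd c)"
  and chart_inv_cont: "c \<in> A \<Longrightarrow> continuous_on (snd c ` fst c) (chart_inv c)"
  and chart_inv_chart: "c \<in> A \<Longrightarrow> p \<in> fst c \<Longrightarrow> chart_inv c (snd c p) = p"
  using atlas by (auto simp: smooth_atlas_def is_chart_def homeomorphism_def)

lemma chart_inv_in: "c \<in> A \<Longrightarrow> z \<in> snd c ` fst c \<Longrightarrow> chart_inv c z \<in> fst c"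
  and chart_chart_inv: "c \<in> A \<Longrightarrow> z \<in> snd c ` fst c \<Longrightarrow> snd c (chart_inv c z) = z"
  by (metis imageE chart_inv_chart)+

lemma chart_ex: "\<exists>c\<in>A. p \<in> fst c"
  using atlas by (auto simp: smooth_atlas_def)

lemma chart_at: "chart_at A p \<in> A" "p \<in> fst (chart_at A p)"
proof -
  have "chart_at A p \<in> A \<and> p \<in> fst (chart_at A p)"
    unfolding chart_at_def by (rule someI_ex) (use chart_ex in blast)
  then show "chart_at A p \<in> A" "p \<in> fst (chart_at A p)" by auto
qed

lemma open_coord_image:
  assumes "c \<in> A" "open V" "V \<subseteq> fst c"
  shows "open (snd c ` V)"
proof -
  have "snd c ` V = snd c ` fst c \<inter> chart_inv c -` V"
    using assms chart_inv_chart by fastforce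
  also have "open \<dots>"
    using assms chart_inv_cont chart_image_open by (intro continuous_open_preimage) auto
  finally show ?thesis .
qed

lemma C1_on_chartsD:
  assumes "C1_on_charts A F" "c \<in> A" "d \<in> A"
  shows "continuous_on UNIV F"
    and "p \<in> fst c \<Longrightarrow> F p \<in> fst d \<Longrightarrow>
      ((snd d \<circ> F \<circ> chart_inv c) has_derivative coord_deriv c d F p) (at (snd c p))"
    and "continuous_on (fst c \<inter> F -` fst d) (\<lambda>p. Blinfun (coord_deriv c d F p))"
    and "p \<in> fst c \<Longrightarrow> F p \<in> fst d \<Longrightarrow> bounded_linear (coord_deriv c d F p)"
proof -
  show 1: "p \<in> fst c \<Longrightarrow> F p \<in> fst d \<Longrightarrow>
      ((snd d \<circ> F \<circ> chart_inv c) has_derivative coord_deriv c d F p) (at (snd c p))"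
    using assms by (auto simp: C1_on_charts_def)
  then show "p \<in> fst c \<Longrightarrow> F p \<in> fst d \<Longrightarrow> bounded_linear (coord_deriv c d F p)"
    by (metis has_derivative_bounded_linear)
qed (use assms in \<open>auto simp: C1_on_charts_def\<close>)

lemma C1_on_charts_open:
  assumes "C1_on_charts A F" "c \<in> A" "d \<in> A"
  shows "open (fst c \<inter> F -` fst d)"
  using C1_on_chartsD(1)[OF assms] assms chart_open
  by (intro open_Int open_vimage) auto

text \<open>In finite dimension, continuity of the derivative on each basis vector gives continuity
  in operator norm.\<close>

lemma C1_map_imp_C1_on_charts:
  assumes "C1_map A F"
  shows "C1_on_charts A F"
  unfolding C1_on_charts_def
proof (intro conjI ballI)
  show cont: "continuous_on UNIV F" using assms by (simp add: C1_map_def)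
  fix c d assume cd: "c \<in> A" "d \<in> A"
  let ?h = "snd d \<circ> F \<circ> chart_inv c" and ?O = "fst c \<inter> F -` fst d"
  have *: "C_k_on (Suc 0) ?h (snd c ` ?O)"
    using assms cd by (auto simp: C1_map_def)
  show deriv: "(?h has_derivative coord_deriv c d F p) (at (snd c p))" if "p \<in> ?O" for p
    using * that unfolding coord_deriv_def by (auto simp: frechet_derivative_works)
  show "continuous_on ?O (\<lambda>p. Blinfun (coord_deriv c d F p))"
  proof (rule continuous_on_blinfun_componentwise)
    fix i :: 'b
    have "continuous_on (snd c ` ?O) (\<lambda>z. frechet_derivative ?h (at z) i)" using * by simp
    then have "continuous_on ?O (\<lambda>p. frechet_derivative ?h (at (snd c p)) i)"
      by (rule continuous_on_compose2) (auto intro!: continuous_on_subset[OF chart_cont[OF cd(1)]])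
    then show "continuous_on ?O (\<lambda>p. blinfun_apply (Blinfun (coord_deriv c d F p)) i)"
    proof (rule continuous_on_eq)
      fix p assume "p \<in> ?O"
      from has_derivative_bounded_linear[OF deriv[OF this]]
      show "frechet_derivative ?h (at (snd c p)) i = blinfun_apply (Blinfun (coord_deriv c d F p)) i"
        by (simp add: bounded_linear_Blinfun_apply) (simp add: coord_deriv_def)
    qed
  qed
qed

lemma C1_on_charts_id: "C1_on_charts A id"
proof (rule C1_map_imp_C1_on_charts)
  show "C1_map A id"
    unfolding C1_map_def
  proof (intro conjI ballI)
    fix c d assume "c \<in> A" "d \<in> A"
    then show "C_k_on 1 (snd d \<circ> id \<circ> chart_inv c) (snd c ` (fst c \<inter> id -` fst d))"
      using atlas unfolding smooth_atlas_def smooth_on_def by (metis comp_id vimage_id id_apply)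
  qed (simp add: id_def)
qed

lemma chain:
  assumes "C1_on_charts A F" "C1_on_charts A G" "c \<in> A" "d \<in> A" "e \<in> A"
    and p: "p \<in> fst c" "F p \<in> fst d" "G (F p) \<in> fst e"
  shows "((snd e \<circ> (G \<circ> F) \<circ> chart_inv c) has_derivative
      (coord_deriv d e G (F p) \<circ> coord_deriv c d F p)) (at (snd c p))"
    and "coord_deriv c e (G \<circ> F) p = coord_deriv d e G (F p) \<circ> coord_deriv c d F p"
proof -
  let ?f = "snd d \<circ> F \<circ> chart_inv c" and ?g = "snd e \<circ> G \<circ> chart_inv d"
  have "?f (snd c p) = snd d (F p)" using assms by (simp add: chart_inv_chart)
  then have *: "((?g \<circ> ?f) has_derivative (coord_deriv d e G (F p) \<circ> coord_deriv c d F p)) (at (snd c p))"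
    using assms C1_on_chartsD(2)[of F c d p] C1_on_chartsD(2)[of G d e "F p"]
    by (intro diff_chain_at) auto
  show 1: "((snd e \<circ> (G \<circ> F) \<circ> chart_inv c) has_derivative
      (coord_deriv d e G (F p) \<circ> coord_deriv c d F p)) (at (snd c p))"
  proof (rule has_derivative_transform_within_open[OF *])
    show "open (snd c ` (fst c \<inter> F -` fst d))"
      using assms C1_on_charts_open open_coord_image by auto
    show "snd c p \<in> snd c ` (fst c \<inter> F -` fst d)" using p by auto
    fix z assume "z \<in> snd c ` (fst c \<inter> F -` fst d)"
    then show "(?g \<circ> ?f) z = (snd e \<circ> (G \<circ> F) \<circ> chart_inv c) z"
      using assms by (auto simp: chart_inv_chart)
  qed
  show "coord_deriv c e (G \<circ> F) p = coord_deriv d e G (F p) \<circ> coord_deriv c d F p"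
    using frechet_derivative_at[OF 1] by (simp add: coord_deriv_def)
qed

lemma C1_on_charts_compose:
  assumes "C1_on_charts A F" "C1_on_charts A G"
  shows "C1_on_charts A (G \<circ> F)"
  unfolding C1_on_charts_def
proof (intro conjI ballI)
  obtain c0 where c0: "c0 \<in> A" using chart_ex by blast
  have cF: "continuous_on UNIV F" and cG: "continuous_on UNIV G"
    using C1_on_chartsD(1) assms c0 by blast+
  show "continuous_on UNIV (G \<circ> F)"
    using cF cG by (metis continuous_on_compose continuous_on_subset subset_UNIV)
  fix c e assume ce: "c \<in> A" "e \<in> A"
  show "((snd e \<circ> (G \<circ> F) \<circ> chart_inv c) has_derivative coord_deriv c e (G \<circ> F) p) (at (snd c p))"
    if "p \<in> fst c \<inter> (G \<circ> F) -` fst e" for p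
    using chain[OF assms ce(1) chart_at(1) ce(2), of p "F p"] chart_at(2) that by simp
  show "continuous_on (fst c \<inter> (G \<circ> F) -` fst e) (\<lambda>p. Blinfun (coord_deriv c e (G \<circ> F) p))"
  proof (rule continuous_at_imp_continuous_on, rule ballI)
    fix p assume p: "p \<in> fst c \<inter> (G \<circ> F) -` fst e"
    \<comment> \<open>The intermediate points \<open>F q\<close> need not lie in one chart, so
      continuity is checked locally, with a chart around \<open>F p\<close> kept fixed near
      \<open>p\<close>.\<close>
    define d where "d = chart_at A (F p)"
    have d: "d \<in> A" "F p \<in> fst d" using chart_at by (auto simp: d_def)
    define V where "V = fst c \<inter> F -` (fst d \<inter> G -` fst e)"
    have "open V" unfolding V_def
      using open_Int[OF chart_open[OF ce(1)] open_vimage[OF C1_on_charts_open[OF assms(2) d(1) ce(2)] cF]] .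
    have "p \<in> V" using p d by (auto simp: V_def)
    have "continuous_on V (\<lambda>q. Blinfun (coord_deriv d e G (F q)))"
      by (rule continuous_on_compose2[OF C1_on_chartsD(3)[OF assms(2) d(1) ce(2)]])
        (auto simp: V_def intro: continuous_on_subset[OF cF])
    moreover have "continuous_on V (\<lambda>q. Blinfun (coord_deriv c d F q))"
      by (rule continuous_on_subset[OF C1_on_chartsD(3)[OF assms(1) ce(1) d(1)]]) (auto simp: V_def)
    ultimately have "continuous_on V (\<lambda>q. Blinfun (coord_deriv d e G (F q)) o\<^sub>L Blinfun (coord_deriv c d F q))"
      by (intro continuous_intros)
    moreover have "Blinfun (coord_deriv d e G (F q)) o\<^sub>L Blinfun (coord_deriv c d F q)
        = Blinfun (coord_deriv c e (G \<circ> F) q)" if "q \<in> V" for q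
    proof (rule blinfun_eqI)
      fix v
      have q: "q \<in> fst c" "F q \<in> fst d" "G (F q) \<in> fst e" using that by (auto simp: V_def)
      have "bounded_linear (coord_deriv d e G (F q) \<circ> coord_deriv c d F q)"
        using has_derivative_bounded_linear[OF chain(1)[OF assms ce(1) d(1) ce(2) q]] .
      then show "blinfun_apply (Blinfun (coord_deriv d e G (F q)) o\<^sub>L Blinfun (coord_deriv c d F q)) v
          = blinfun_apply (Blinfun (coord_deriv c e (G \<circ> F) q)) v"
        using q d ce C1_on_chartsD(4)[OF assms(1) ce(1) d(1)] C1_on_chartsD(4)[OF assms(2) d(1) ce(2)]
        by (simp add: chain(2)[OF assms ce(1) d(1) ce(2) q] bounded_linear_Blinfun_apply)
    qed
    ultimately have "continuous_on V (\<lambda>q. Blinfun (coord_deriv c e (G \<circ> F) q))"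
      by (rule continuous_on_eq)
    then show "isCont (\<lambda>q. Blinfun (coord_deriv c e (G \<circ> F) q)) p"
      using \<open>open V\<close> \<open>p \<in> V\<close> by (simp add: continuous_on_eq_continuous_at)
  qed
qed

lemma C1_on_charts_funpow: "C1_on_charts A F \<Longrightarrow> C1_on_charts A (F ^^ n)"
  by (induction n) (auto simp: C1_on_charts_id C1_on_charts_compose)

lemma coord_deriv_id:
  assumes "c \<in> A" "p \<in> fst c"
  shows "coord_deriv c c id p v = v"
proof -
  have "((\<lambda>z. z) has_derivative (\<lambda>v. v)) (at (snd c p))" by (rule has_derivative_ident)
  then have "((snd c \<circ> id \<circ> chart_inv c) has_derivative (\<lambda>v. v)) (at (snd c p))"
    by (rule has_derivative_transform_within_open[OF _ chart_image_open[OF assms(1)]])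
      (use assms in \<open>auto simp: chart_inv_chart\<close>)
  from frechet_derivative_at[OF this] show ?thesis by (simp add: coord_deriv_def fun_eq_iff)
qed

section \<open>Tangent vectors and the differential in coordinates\<close>

abbreviation T where "T \<equiv> tangent_of_coords A"

lemma T_eq: "T c p = coord_deriv c (chart_at A p) id p"
  by (simp add: tangent_of_coords_def coord_deriv_def)

lemma differential_eq: "differential A F p = coord_deriv (chart_at A p) (chart_at A (F p)) F p"
  by (simp add: differential_def coord_deriv_def)

lemma linear_T: "c \<in> A \<Longrightarrow> p \<in> fst c \<Longrightarrow> linear (T c p)"
  unfolding T_eq by (rule bounded_linear.linear, rule C1_on_chartsD(4)[OF C1_on_charts_id])
    (simp_all add: chart_at)

text \<open>Both sides are the derivative of \<open>F\<close> from the chart \<open>c\<close> into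
  the chosen chart at \<open>F p\<close>, factored once through the chosen chart at \<open>p\<close>
  and once through \<open>d\<close>.\<close>

lemma differential_T:
  assumes "C1_on_charts A F" "c \<in> A" "d \<in> A" "p \<in> fst c" "F p \<in> fst d"
  shows "differential A F p (T c p v) = T d (F p) (coord_deriv c d F p v)"
  using chain(2)[OF C1_on_charts_id assms(1) assms(2) chart_at(1) chart_at(1), of p p "F p"]
    chain(2)[OF assms(1) C1_on_charts_id assms(2,3) chart_at(1), of p "F p"] assms chart_at(2)
  by (simp add: T_eq differential_eq fun_eq_iff)

lemma T_inverse:
  assumes "c \<in> A" "p \<in> fst c"
  shows "coord_deriv (chart_at A p) c id p (T c p v) = v" "T c p (coord_deriv (chart_at A p) c id p v) = v"
  using chain(2)[OF C1_on_charts_id C1_on_charts_id assms(1) chart_at(1) assms(1), of p p]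
   chain(2)[OF C1_on_charts_id C1_on_charts_id chart_at(1) assms(1) chart_at(1), of p p p] assms chart_at(2)
  by (auto simp: T_eq fun_eq_iff coord_deriv_id chart_at)

lemma T_inj: "c \<in> A \<Longrightarrow> p \<in> fst c \<Longrightarrow> T c p v = T c p w \<longleftrightarrow> v = w"
  by (metis T_inverse(1))

lemma compact_chart_neighbourhood:
  assumes "c \<in> A" "p \<in> fst c"
  obtains r where "r > 0" "cball (snd c p) r \<subseteq> snd c ` fst c"
    "compact (chart_inv c ` cball (snd c p) r)" "chart_inv c ` cball (snd c p) r \<subseteq> fst c"
    "open (chart_inv c ` ball (snd c p) r)" "p \<in> chart_inv c ` ball (snd c p) r"
proof -
  obtain r where r: "r > 0" "cball (snd c p) r \<subseteq> snd c ` fst c"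
    using chart_image_open[OF assms(1)] assms(2) by (metis image_eqI open_contains_cball)
  have "chart_inv c ` ball (snd c p) r = fst c \<inter> snd c -` ball (snd c p) r"
  proof -
    have "ball (snd c p) r \<subseteq> snd c ` fst c" using r(2) by (meson ball_subset_cball subset_trans)
    show ?thesis
    proof (intro set_eqI iffI)
      fix q assume "q \<in> chart_inv c ` ball (snd c p) r"
      then show "q \<in> fst c \<inter> snd c -` ball (snd c p) r"
        using \<open>ball (snd c p) r \<subseteq> snd c ` fst c\<close> chart_inv_in[OF assms(1)] chart_chart_inv[OF assms(1)]
        by auto
    next
      fix q assume "q \<in> fst c \<inter> snd c -` ball (snd c p) r"
      then have "q = chart_inv c (snd c q)" "snd c q \<in> ball (snd c p) r"
        using chart_inv_chart[OF assms(1)] by auto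
      then show "q \<in> chart_inv c ` ball (snd c p) r" by blast
    qed
  qed
  moreover have "open (fst c \<inter> snd c -` ball (snd c p) r)"
    using chart_cont chart_open assms by (intro continuous_open_preimage) auto
  ultimately have "open (chart_inv c ` ball (snd c p) r)" by simp
  moreover have "compact (chart_inv c ` cball (snd c p) r)"
    using continuous_on_subset[OF chart_inv_cont[OF assms(1)] r(2)] by (simp add: compact_continuous_image)
  moreover have "chart_inv c ` cball (snd c p) r \<subseteq> fst c" using r(2) chart_inv_in assms by blast
  moreover have "p \<in> chart_inv c ` ball (snd c p) r"
    by (rule image_eqI[of _ _ "snd c p"]) (use assms r in \<open>auto simp: chart_inv_chart\<close>)
  ultimately show ?thesis using that r by blast
qed

section \<open>Constants that are uniform over compact pieces of charts\<close>

lemma finite_compact_cover: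
  assumes "compact (UNIV :: 'a set)"
  shows "\<exists>I. finite I \<and> (\<forall>(c, K)\<in>I. c \<in> A \<and> compact K \<and> K \<subseteq> fst c) \<and> (\<forall>p. \<exists>(c, K)\<in>I. p \<in> interior K)"
proof -
  have "\<exists>c K. c \<in> A \<and> compact K \<and> K \<subseteq> fst c \<and> p \<in> interior K" for p
  proof -
    obtain c where c: "c \<in> A" "p \<in> fst c" using chart_ex by blast
    from compact_chart_neighbourhood[OF this] obtain r where r:
      "compact (chart_inv c ` cball (snd c p) r)" "chart_inv c ` cball (snd c p) r \<subseteq> fst c"
      "open (chart_inv c ` ball (snd c p) r)" "p \<in> chart_inv c ` ball (snd c p) r" by metis
    have "p \<in> interior (chart_inv c ` cball (snd c p) r)"
      by (rule interiorI[OF r(3,4)]) auto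
    then show ?thesis using c r by blast
  qed
  then obtain c K where cK: "\<And>p. c p \<in> A \<and> compact (K p) \<and> K p \<subseteq> fst (c p) \<and> p \<in> interior (K p)"
    by metis
  obtain Q where Q: "finite Q" "UNIV \<subseteq> (\<Union>p\<in>Q. interior (K p))"
  proof (rule compactE_image[OF assms, of UNIV "\<lambda>p. interior (K p)"])
    show "UNIV \<subseteq> (\<Union>p. interior (K p))" using cK by auto
  qed auto
  have "\<exists>(d, L)\<in>(\<lambda>p. (c p, K p)) ` Q. p \<in> interior L" for p
  proof -
    obtain q where "q \<in> Q" "p \<in> interior (K q)" using Q(2) by blast
    then show ?thesis by auto
  qed
  then show ?thesis using Q(1) cK by (intro exI[of _ "(\<lambda>p. (c p, K p)) ` Q"]) auto
qed

text \<open>Mean value inequality: the derivative of the remainder at \<open>v\<close> is the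
  derivative at the shifted point minus that at \<open>p\<close>. A Lebesgue number for open sets on
  which the derivative oscillates by at most \<open>\<epsilon>\<close> makes \<open>\<rho>\<close>
  independent of \<open>p\<close>. The remainder does not vanish at \<open>0\<close> here; only its
  differences are estimated.\<close>

lemma uniform_remainder:
  assumes F: "C1_on_charts A F" and c: "c \<in> A" "compact K" "K \<subseteq> fst c"
    and d: "d \<in> A" "compact L" "L \<subseteq> fst d" and "\<epsilon> > 0"
  shows "\<exists>\<rho>>0. \<forall>p\<in>K. F p \<in> L \<longrightarrow>
     (\<forall>v. norm v \<le> \<rho> \<longrightarrow> snd c p + v \<in> snd c ` fst c \<and> F (chart_inv c (snd c p + v)) \<in> fst d) \<and>
     (\<forall>a b. norm a \<le> \<rho> \<longrightarrow> norm b \<le> \<rho> \<longrightarrow>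
        norm ((snd d (F (chart_inv c (snd c p + a))) - coord_deriv c d F p a)
          - (snd d (F (chart_inv c (snd c p + b))) - coord_deriv c d F p b)) \<le> \<epsilon> * norm (a - b))"
proof -
  let ?O = "fst c \<inter> F -` fst d"
  define D where "D z = Blinfun (coord_deriv c d F (chart_inv c z))" for z
  define P where "P G \<longleftrightarrow> G \<subseteq> snd c ` ?O \<and> (\<forall>y\<in>G. \<forall>z\<in>G. norm (D y - D z) \<le> \<epsilon>)" for G
  have contF: "continuous_on UNIV F" using C1_on_chartsD(1)[OF F c(1) d(1)] .
  have opn: "open (snd c ` ?O)" using C1_on_charts_open[OF F c(1) d(1)] open_coord_image c by auto
  have contD: "continuous_on (snd c ` ?O) D"
    unfolding D_def
    by (rule continuous_on_compose2[OF C1_on_chartsD(3)[OF F c(1) d(1)]])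
      (use c in \<open>auto simp: chart_inv_chart intro!: continuous_on_subset[OF chart_inv_cont[OF c(1)]]\<close>)
  have Z: "compact (snd c ` (K \<inter> F -` L))"
  proof (rule compact_continuous_image)
    show "continuous_on (K \<inter> F -` L) (snd c)" using chart_cont[OF c(1)] c(3) continuous_on_subset by blast
    show "compact (K \<inter> F -` L)"
      using c(2) compact_imp_closed[OF d(2)] contF by (intro compact_Int_closed closed_vimage) auto
  qed
  have "\<exists>G. open G \<and> z \<in> G \<and> P G" if z: "z \<in> snd c ` (K \<inter> F -` L)" for z
  proof -
    have zO: "z \<in> snd c ` ?O" using z c d by blast
    have "continuous_on (snd c ` ?O) (\<lambda>y. norm (D y - D z))"
      using contD by (intro continuous_intros)
    then have "open (snd c ` ?O \<inter> (\<lambda>y. norm (D y - D z)) -` {..<\<epsilon>/2})"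
      using opn by (rule continuous_open_preimage) simp
    moreover have "P (snd c ` ?O \<inter> (\<lambda>y. norm (D y - D z)) -` {..<\<epsilon>/2})"
      unfolding P_def
    proof (intro conjI ballI)
      fix x y assume "x \<in> snd c ` ?O \<inter> (\<lambda>y. norm (D y - D z)) -` {..<\<epsilon>/2}"
        "y \<in> snd c ` ?O \<inter> (\<lambda>y. norm (D y - D z)) -` {..<\<epsilon>/2}"
      then have "norm (D x - D z) < \<epsilon>/2" "norm (D y - D z) < \<epsilon>/2" by auto
      then show "norm (D x - D y) \<le> \<epsilon>" using norm_triangle_ineq4[of "D x - D z" "D y - D z"] by simp
    qed auto
    ultimately show ?thesis using zO \<open>\<epsilon> > 0\<close> by (intro exI[of _ "snd c ` ?O \<inter> (\<lambda>y. norm (D y - D z)) -` {..<\<epsilon>/2}"]) auto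
  qed
  from compact_uniform_cball[OF Z this] obtain \<rho> where \<rho>: "\<rho> > 0"
    "\<And>z. z \<in> snd c ` (K \<inter> F -` L) \<Longrightarrow> \<exists>G. open G \<and> P G \<and> cball z \<rho> \<subseteq> G" by blast
  show ?thesis
  proof (intro exI[of _ \<rho>] conjI ballI impI allI)
    fix p assume p: "p \<in> K" "F p \<in> L"
    define z where "z = snd c p"
    have pc: "p \<in> fst c" "F p \<in> fst d" using p c d by auto
    obtain G where G: "P G" "cball z \<rho> \<subseteq> G" using \<rho>(2)[of z] p by (auto simp: z_def)
    have inO: "z + v \<in> snd c ` ?O" if "norm v \<le> \<rho>" for v
      using that G by (auto simp: P_def dist_norm subset_iff)
    show 1: "snd c p + v \<in> snd c ` fst c" "F (chart_inv c (snd c p + v)) \<in> fst d" if "norm v \<le> \<rho>" for v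
      using inO[OF that] c by (auto simp: z_def chart_inv_chart)
    define R where "R v = snd d (F (chart_inv c (z + v))) - coord_deriv c d F p v" for v
    have D0: "blinfun_apply (D z) = coord_deriv c d F p"
      unfolding D_def z_def using pc c C1_on_chartsD(4)[OF F c(1) d(1)] 
      by (simp add: chart_inv_chart bounded_linear_Blinfun_apply)
    have "norm (R a - R b) \<le> \<epsilon> * norm (a - b)" if ab: "norm a \<le> \<rho>" "norm b \<le> \<rho>" for a b
    proof (rule differentiable_bound[of "cball 0 \<rho>" R "\<lambda>v. blinfun_apply (D (z + v) - D z)"])
      fix v :: 'b assume "v \<in> cball 0 \<rho>"
      then have v: "norm v \<le> \<rho>" by simp
      define q where "q = chart_inv c (z + v)"
      have q: "q \<in> fst c" "F q \<in> fst d" "snd c q = z + v"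
        using inO[OF v] c by (auto simp: q_def chart_inv_chart)
      have Dq: "blinfun_apply (D (z + v)) = coord_deriv c d F q"
        unfolding D_def q_def[symmetric] using q C1_on_chartsD(4)[OF F c(1) d(1)] 
        by (simp add: bounded_linear_Blinfun_apply)
      have "((snd d \<circ> F \<circ> chart_inv c) has_derivative blinfun_apply (D (z + v))) (at (z + v))"
        using C1_on_chartsD(2)[OF F c(1) d(1) q(1,2)] q(3) Dq by simp
      then have "((\<lambda>v. (snd d \<circ> F \<circ> chart_inv c) (z + v)) has_derivative blinfun_apply (D (z + v))) (at v)"
        by (rule has_derivative_compose[of "\<lambda>v. z + v" "\<lambda>v. v" v UNIV, rotated]) (auto intro!: derivative_eq_intros)
      then have "((\<lambda>v. (snd d \<circ> F \<circ> chart_inv c) (z + v) - blinfun_apply (D z) v)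
          has_derivative (\<lambda>h. blinfun_apply (D (z + v)) h - blinfun_apply (D z) h)) (at v)"
        by (intro has_derivative_diff bounded_linear_imp_has_derivative) (auto intro: blinfun.bounded_linear_right)
      then have "(R has_derivative blinfun_apply (D (z + v) - D z)) (at v)"
        unfolding R_def D0[symmetric] by (simp add: minus_blinfun.rep_eq comp_def)
      then show "(R has_derivative blinfun_apply (D (z + v) - D z)) (at v within cball 0 \<rho>)"
        by (rule has_derivative_at_withinI)
      show "onorm (blinfun_apply (D (z + v) - D z)) \<le> \<epsilon>"
        using G v \<rho>(1) by (auto simp: P_def norm_blinfun.rep_eq[symmetric] dist_norm subset_iff)
    qed (use ab in auto)
    then show "norm ((snd d (F (chart_inv c (snd c p + a))) - coord_deriv c d F p a)
          - (snd d (F (chart_inv c (snd c p + b))) - coord_deriv c d F p b)) \<le> \<epsilon> * norm (a - b)"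
      if "norm a \<le> \<rho>" "norm b \<le> \<rho>" for a b using that by (simp add: R_def z_def)
  qed (rule \<rho>(1))
qed

lemma uniform_bound:
  assumes F: "C1_on_charts A F" and c: "c \<in> A" "compact K" "K \<subseteq> fst c"
    and d: "d \<in> A" "compact L" "L \<subseteq> fst d"
  shows "\<exists>B>0. \<forall>p\<in>K. F p \<in> L \<longrightarrow> (\<forall>v. norm (coord_deriv c d F p v) \<le> B * norm v)"
proof -
  have "compact (K \<inter> F -` L)"
    using c(2) compact_imp_closed[OF d(2)] C1_on_chartsD(1)[OF F c(1) d(1)]
    by (intro compact_Int_closed closed_vimage) auto
  moreover have "continuous_on (K \<inter> F -` L) (\<lambda>p. Blinfun (coord_deriv c d F p))"
    by (rule continuous_on_subset[OF C1_on_chartsD(3)[OF F c(1) d(1)]]) (use c d in auto)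
  ultimately have "bounded ((\<lambda>p. Blinfun (coord_deriv c d F p)) ` (K \<inter> F -` L))"
    by (intro compact_imp_bounded compact_continuous_image)
  then obtain B where B: "B > 0" "\<And>p. p \<in> K \<inter> F -` L \<Longrightarrow> norm (Blinfun (coord_deriv c d F p)) \<le> B"
    unfolding bounded_pos by blast
  have "norm (coord_deriv c d F p v) \<le> B * norm v" if "p \<in> K" "F p \<in> L" for p v
  proof -
    have "coord_deriv c d F p = blinfun_apply (Blinfun (coord_deriv c d F p))"
      using C1_on_chartsD(4)[OF F c(1) d(1)] that c d by (subst bounded_linear_Blinfun_apply) auto
    then have "norm (coord_deriv c d F p v) \<le> norm (Blinfun (coord_deriv c d F p)) * norm v"
      by (metis norm_blinfun)
    also have "\<dots> \<le> B * norm v" using B that by (intro mult_right_mono) auto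
    finally show ?thesis .
  qed
  then show ?thesis using B(1) by blast
qed

text \<open>Translates the neighbourhood \<open>W\<close> of the diagonal into a Euclidean radius in
  the chart.\<close>

lemma uniform_neighbourhood:
  assumes c: "c \<in> A" "compact K" "K \<subseteq> fst c" and W: "open W" "\<And>p. (p, p) \<in> W"
  shows "\<exists>\<rho>>0. \<forall>p\<in>K. \<forall>v::'b. norm v \<le> \<rho> \<longrightarrow>
     snd c p + v \<in> snd c ` fst c \<and> (chart_inv c (snd c p + v), p) \<in> W"
proof -
  define P where "P G \<longleftrightarrow> G \<subseteq> snd c ` fst c \<and> (\<forall>y\<in>G. \<forall>z\<in>G. (chart_inv c y, chart_inv c z) \<in> W)" for G
  have "compact (snd c ` K)"
    using c chart_cont continuous_on_subset by (intro compact_continuous_image) blast+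
  moreover have "\<exists>G. open G \<and> z \<in> G \<and> P G" if z: "z \<in> snd c ` K" for z
  proof -
    obtain V1 V2 where V: "open V1" "open V2" "(chart_inv c z, chart_inv c z) \<in> V1 \<times> V2" "V1 \<times> V2 \<subseteq> W"
      using open_prod_elim[OF W(1) W(2)] by metis
    define G where "G = snd c ` fst c \<inter> chart_inv c -` (V1 \<inter> V2)"
    have "open G" unfolding G_def
      using chart_inv_cont[OF c(1)] chart_image_open[OF c(1)] open_Int[OF V(1,2)] by (rule continuous_open_preimage)
    moreover have "z \<in> G" using V z c by (auto simp: G_def)
    moreover have "P G" using V by (auto simp: G_def P_def)
    ultimately show ?thesis by blast
  qed
  ultimately obtain \<rho> where \<rho>: "\<rho> > 0" "\<And>z. z \<in> snd c ` K \<Longrightarrow> \<exists>G. open G \<and> P G \<and> cball z \<rho> \<subseteq> G"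
    using compact_uniform_cball[of "snd c ` K" P] by blast
  show ?thesis
  proof (intro exI[of _ \<rho>] conjI ballI allI impI)
    fix p and v :: 'b assume pv: "p \<in> K" "norm v \<le> \<rho>"
    then obtain G where G: "P G" "cball (snd c p) \<rho> \<subseteq> G" using \<rho>(2)[of "snd c p"] by auto
    then have in_G: "snd c p + v \<in> G" "snd c p \<in> G" using pv \<rho>(1) by (auto simp: dist_norm subset_iff)
    then show "snd c p + v \<in> snd c ` fst c" using G by (auto simp: P_def)
    have "chart_inv c (snd c p) = p" using chart_inv_chart[OF c(1)] c pv by auto
    then show "(chart_inv c (snd c p + v), p) \<in> W" using in_G G by (metis P_def)
  qed (rule \<rho>(1))
qed

text \<open>By homogeneity unit vectors suffice, and on the compact set
  \<open>K \<times> sphere 0 1\<close> the Riemannian norm has a positive minimum \<open>a\<close>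
  and a maximum \<open>b\<close>.\<close>

lemma norm_equivalence:
  assumes g: "riemannian_metric A g" and c: "c \<in> A" "compact K" "K \<subseteq> fst c"
  shows "\<exists>M>0. \<forall>p\<in>K. \<forall>v. norm v \<le> M * riem_norm g p (T c p v) \<and> riem_norm g p (T c p v) \<le> M * norm v"
proof (cases "K = {}")
  case False
  define q where "q p v = g p (T c p v) (T c p v)" for p v
  have bil: "bilinear (g p)" and pos: "v \<noteq> 0 \<Longrightarrow> g p v v > 0" for p v
    using g by (auto simp: riemannian_metric_def)
  have cont: "continuous_on K (\<lambda>p. g p (T c p v) (T c p w))" for v w
  proof -
    have "C_k_on 0 (\<lambda>z. let p = chart_inv c z in g p (T c p v) (T c p w)) (snd c ` fst c)"
      using g c(1) unfolding riemannian_metric_def smooth_on_def by blast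
    then have "continuous_on (snd c ` fst c) (\<lambda>z. g (chart_inv c z) (T c (chart_inv c z) v) (T c (chart_inv c z) w))"
      by (simp add: Let_def)
    then have "continuous_on K (\<lambda>p. g (chart_inv c (snd c p)) (T c (chart_inv c (snd c p)) v) (T c (chart_inv c (snd c p)) w))"
      by (rule continuous_on_compose2) (use c in \<open>auto intro!: continuous_on_subset[OF chart_cont[OF c(1)]]\<close>)
    then show ?thesis by (rule continuous_on_eq) (use c in \<open>auto simp: chart_inv_chart\<close>)
  qed
  \<comment> \<open>Smoothness of the metric is given for fixed pairs of vectors; expanding in the
    basis makes it jointly continuous in point and vector.\<close>
  have q_sum: "q p v = (\<Sum>i\<in>Basis. \<Sum>j\<in>Basis. (v \<bullet> i) * (v \<bullet> j) * g p (T c p i) (T c p j))" if "p \<in> K" for p v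
  proof -
    have lin: "linear (T c p)" using linear_T[OF c(1)] c that by auto
    have "T c p v = (\<Sum>i\<in>Basis. (v \<bullet> i) *\<^sub>R T c p i)"
      using linear_sum[OF lin, of "\<lambda>i. (v \<bullet> i) *\<^sub>R i" Basis] by (simp add: euclidean_representation linear_cmul[OF lin])
    then have "q p v = (\<Sum>(i, j)\<in>Basis \<times> Basis. g p ((v \<bullet> i) *\<^sub>R T c p i) ((v \<bullet> j) *\<^sub>R T c p j))"
      unfolding q_def by (simp add: bilinear_sum[OF bil])
    also have "\<dots> = (\<Sum>i\<in>Basis. \<Sum>j\<in>Basis. (v \<bullet> i) * (v \<bullet> j) * g p (T c p i) (T c p j))"
      by (simp add: sum.cartesian_product bilinear_lmul[OF bil] bilinear_rmul[OF bil] mult_ac)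
    finally show ?thesis .
  qed
  have "continuous_on (K \<times> sphere 0 1) (\<lambda>x. \<Sum>i\<in>Basis. \<Sum>j\<in>Basis.
      (snd x \<bullet> i) * (snd x \<bullet> j) * g (fst x) (T c (fst x) i) (T c (fst x) j))"
    by (intro continuous_intros continuous_on_compose2[OF cont]) auto
  then have cq: "continuous_on (K \<times> sphere 0 1) (\<lambda>x. sqrt (q (fst x) (snd x)))"
    by (intro continuous_intros) (auto elim!: continuous_on_eq simp: q_sum)
  have cpt: "compact (K \<times> sphere (0::'b) 1)" using c by (intro compact_Times) auto
  have ne: "K \<times> sphere (0::'b) 1 \<noteq> {}" using False by simp
  obtain x where x: "x \<in> K \<times> sphere 0 1" 
    "\<And>y. y \<in> K \<times> sphere 0 1 \<Longrightarrow> sqrt (q (fst x) (snd x)) \<le> sqrt (q (fst y) (snd y))"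
    using continuous_attains_inf[OF cpt ne cq] by blast
  obtain y where y: "y \<in> K \<times> sphere 0 1" 
    "\<And>z. z \<in> K \<times> sphere 0 1 \<Longrightarrow> sqrt (q (fst z) (snd z)) \<le> sqrt (q (fst y) (snd y))"
    using continuous_attains_sup[OF cpt ne cq] by blast
  define a where "a = sqrt (q (fst x) (snd x))"
  define b where "b = sqrt (q (fst y) (snd y))"
  have qpos: "q p v > 0" if "p \<in> K" "v \<noteq> 0" for p v
  proof -
    have "T c p v \<noteq> 0" using T_inj[of c p v 0] linear_0[OF linear_T, of c p] c that by auto
    then show ?thesis by (simp add: q_def pos)
  qed
  have "fst x \<in> K" "snd x \<noteq> 0" "fst y \<in> K" "snd y \<noteq> 0" using x(1) y(1) by (auto simp: mem_Times_iff)
  then have "a > 0" "b > 0" unfolding a_def b_def using qpos by auto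
  have main: "a * norm v \<le> riem_norm g p (T c p v) \<and> riem_norm g p (T c p v) \<le> b * norm v" if p: "p \<in> K" for p v
  proof (cases "v = 0")
    case True
    then show ?thesis using linear_0[OF linear_T, of c p] p c by (auto simp: riem_norm_def bilinear_lzero[OF bil])
  next
    case False
    define w where "w = v /\<^sub>R norm v"
    have w: "v = norm v *\<^sub>R w" "norm w = 1" using False by (auto simp: w_def)
    have "linear (T c p)" using linear_T[OF c(1)] c p by auto
    then have "q p (t *\<^sub>R w) = t\<^sup>2 * q p w" for t
      unfolding q_def by (simp add: linear_cmul bilinear_lmul[OF bil] bilinear_rmul[OF bil] power2_eq_square)
    from this[of "norm v"] have "q p v = (norm v)\<^sup>2 * q p w" using w(1) by simp
    then have "riem_norm g p (T c p v) = norm v * sqrt (q p w)"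
      unfolding riem_norm_def q_def[symmetric] by (simp add: real_sqrt_mult)
    moreover have "a \<le> sqrt (q p w)" "sqrt (q p w) \<le> b"
      using x(2)[of "(p, w)"] y(2)[of "(p, w)"] p w by (auto simp: a_def b_def)
    ultimately show ?thesis by (simp add: mult.commute[of _ "norm v"] mult_left_mono)
  qed
  define M where "M = max b (1 / a)"
  have "norm v \<le> M * riem_norm g p (T c p v) \<and> riem_norm g p (T c p v) \<le> M * norm v" if "p \<in> K" for p v
  proof -
    have "norm v \<le> (1 / a) * riem_norm g p (T c p v)" using main[OF that] \<open>a > 0\<close> by (simp add: field_simps)
    also have "\<dots> \<le> M * riem_norm g p (T c p v)"
    proof (rule mult_right_mono)
      have "0 \<le> a * norm v" using \<open>a > 0\<close> by simp
      then show "0 \<le> riem_norm g p (T c p v)" using main[OF that, of v] by linarith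
    qed (simp add: M_def)
    finally have "norm v \<le> M * riem_norm g p (T c p v)" .
    moreover have "b * norm v \<le> M * norm v" by (intro mult_right_mono) (auto simp: M_def)
    ultimately show ?thesis using main[OF that, of v] by linarith
  qed
  moreover have "M > 0" using \<open>b > 0\<close> by (simp add: M_def)
  ultimately show ?thesis by blast
qed (auto intro!: exI[of _ 1])

end

section \<open>The closing lemma\<close>

lemma finite_uniform_large:
  fixes P :: "'i \<Rightarrow> real \<Rightarrow> bool"
  assumes "finite I" "\<And>i. i \<in> I \<Longrightarrow> \<exists>M>0. P i M"
    and mono: "\<And>i M M'. i \<in> I \<Longrightarrow> P i M \<Longrightarrow> M \<le> M' \<Longrightarrow> P i M'"
  shows "\<exists>M>0. \<forall>i\<in>I. P i M"
proof -
  obtain M where M: "\<And>i. i \<in> I \<Longrightarrow> M i > 0 \<and> P i (M i)" using assms(2) by metis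
  show ?thesis
  proof (intro exI[of _ "1 + sum M I"] conjI ballI)
    have "sum M I \<ge> 0" using M by (intro sum_nonneg) (simp add: less_imp_le)
    then show "1 + sum M I > 0" by simp
    fix i assume i: "i \<in> I"
    have "M i \<le> sum M I" using M assms(1) i by (intro member_le_sum) (auto simp: less_imp_le)
    then show "P i (1 + sum M I)" using mono[OF i, of "M i"] M[OF i] by simp
  qed
qed

lemma finite_uniform_small:
  fixes P :: "'i \<Rightarrow> real \<Rightarrow> bool"
  assumes "finite I" "\<And>i. i \<in> I \<Longrightarrow> \<exists>r>0. P i r"
    and mono: "\<And>i r r'. i \<in> I \<Longrightarrow> P i r \<Longrightarrow> 0 < r' \<Longrightarrow> r' \<le> r \<Longrightarrow> P i r'"
  shows "\<exists>r>0. \<forall>i\<in>I. P i r"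
  using assms
proof (induction I rule: finite_induct)
  case empty
  show ?case by (intro exI[of _ 1]) simp
next
  case (insert i I)
  have "\<exists>r>0. \<forall>i\<in>I. P i r" by (rule insert.IH) (use insert.prems in blast)+
  then obtain r where r: "r > 0" "\<forall>i\<in>I. P i r" by blast
  obtain r' where r': "r' > 0" "P i r'" using insert.prems by blast
  have "\<forall>j\<in>insert i I. P j (min r r')"
    using r r' insert.prems(2)[of _ r "min r r'"] insert.prems(2)[of _ r' "min r r'"] by auto
  then show ?case using r r' by (intro exI[of _ "min r r'"]) auto
qed

lemma inv_funpow_cancel:
  assumes "bij f"
  shows "(inv f ^^ k) ((f ^^ k) x) = x" "(f ^^ k) ((inv f ^^ k) x) = x"
proof (induction k arbitrary: x)
  case (Suc k)
  { case 1
    have "(inv f ^^ Suc k) ((f ^^ Suc k) x) = (inv f ^^ k) (inv f (f ((f ^^ k) x)))"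
      by (simp add: funpow_swap1)
    then show ?case using Suc assms by (simp add: bij_is_inj) }
  { case 2
    have "(f ^^ Suc k) ((inv f ^^ Suc k) x) = (f ^^ k) (f (inv f ((inv f ^^ k) x)))"
      by (simp add: funpow_swap1)
    then show ?case using Suc assms by (simp add: bij_is_surj surj_f_inv_f) }
qed auto

context smooth_manifold
begin

lemma orbit_cocycle:
  assumes F: "C1_on_charts A f" and c: "\<And>i. c i \<in> A" "\<And>i. (f ^^ i) x \<in> fst (c i)"
  shows "cocycle (\<lambda>i. coord_deriv (c i) (c (Suc i)) f ((f ^^ i) x)) i k v
    = coord_deriv (c i) (c (i + k)) (f ^^ k) ((f ^^ i) x) v"
proof (induction k)
  case 0
  then show ?case using c by (simp add: coord_deriv_id[unfolded id_def] id_def)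
next
  case (Suc k)
  have e: "(f ^^ k) ((f ^^ i) x) = (f ^^ (i + k)) x"
    by (metis add.commute comp_apply funpow_add)
  have "f ^^ Suc k = f \<circ> f ^^ k" by simp
  then have "coord_deriv (c i) (c (i + Suc k)) (f ^^ Suc k) ((f ^^ i) x)
      = coord_deriv (c (i + k)) (c (i + Suc k)) f ((f ^^ (i + k)) x) \<circ>
        coord_deriv (c i) (c (i + k)) (f ^^ k) ((f ^^ i) x)"
    using chain(2)[OF C1_on_charts_funpow[OF F, of k] F c(1)[of i] c(1)[of "i + k"] c(1)[of "i + Suc k"],
        of "(f ^^ i) x"] c(2)[of i] c(2)[of "i + k"] c(2)[of "i + Suc k"] by (simp add: e)
  from fun_cong[OF this, of v] Suc show ?case by (simp del: funpow.simps)
qed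

text \<open>The charts along the orbit are arbitrary as long as the norm comparison holds with one
  \<open>M\<close>. Passing from the Euclidean to the Riemannian norm at one end and back at the
  other turns \<open>C0\<close> into \<open>M * C0 * M\<close>.\<close>

lemma hyperbolic_sequence_along_orbit:
  fixes f :: "'a \<Rightarrow> 'a" and Es Eu :: "'a \<Rightarrow> 'b set"
  assumes f: "C1_on_charts A f" "C1_on_charts A (inv f)" "bij f"
    and c: "\<And>i. c i \<in> A" "\<And>i. (f ^^ i) x \<in> fst (c i)"
    and orbit: "\<And>i. (f ^^ i) x \<in> \<Lambda>"
    and sub: "\<And>p. p \<in> \<Lambda> \<Longrightarrow> subspace (Es p)" "\<And>p. p \<in> \<Lambda> \<Longrightarrow> subspace (Eu p)"
    and decomp: "\<And>p v. p \<in> \<Lambda> \<Longrightarrow> \<exists>a\<in>Es p. \<exists>b\<in>Eu p. v = a + b"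
    and inv: "\<And>p. p \<in> \<Lambda> \<Longrightarrow> differential A f p ` Es p = Es (f p)"
      "\<And>p. p \<in> \<Lambda> \<Longrightarrow> differential A f p ` Eu p = Eu (f p)"
    and contr: "\<And>p v n. p \<in> \<Lambda> \<Longrightarrow> v \<in> Es p \<Longrightarrow>
      riem_norm g ((f ^^ n) p) (differential A (f ^^ n) p v) \<le> C0 * \<kappa> ^ n * riem_norm g p v"
    and expan: "\<And>p v n. p \<in> \<Lambda> \<Longrightarrow> v \<in> Eu p \<Longrightarrow>
      riem_norm g ((inv f ^^ n) p) (differential A (inv f ^^ n) p v) \<le> C0 * \<kappa> ^ n * riem_norm g p v"
    and C0: "C0 > 0" and \<kappa>: "0 < \<kappa>" "\<kappa> < 1" and M: "M > 0"
    and norms: "\<And>i v. norm v \<le> M * riem_norm g ((f ^^ i) x) (T (c i) ((f ^^ i) x) v)"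
      "\<And>i v. riem_norm g ((f ^^ i) x) (T (c i) ((f ^^ i) x) v) \<le> M * norm v"
    and L: "L > 0" "\<And>i v. norm (coord_deriv (c i) (c (Suc i)) f ((f ^^ i) x) v) \<le> L * norm v"
    and m: "(M * C0 * M) * \<kappa> ^ m \<le> 1 / 2"
  shows "hyperbolic_sequence (\<lambda>i. coord_deriv (c i) (c (Suc i)) f ((f ^^ i) x))
    (\<lambda>i. {v. T (c i) ((f ^^ i) x) v \<in> Es ((f ^^ i) x)})
    (\<lambda>i. {v. T (c i) ((f ^^ i) x) v \<in> Eu ((f ^^ i) x)}) (M * C0 * M) \<kappa> L m"
proof -
  define p where "p i = (f ^^ i) x" for i
  define \<tau> where "\<tau> i = T (c i) (p i)" for i
  define D where "D i = coord_deriv (c i) (c (Suc i)) f (p i)" for i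
  have p: "p i \<in> \<Lambda>" "f (p i) = p (Suc i)" "p i \<in> fst (c i)" "(f ^^ k) (p i) = p (i + k)" for i k
    using orbit c(2) by (auto simp: p_def funpow_add add.commute[of i k])
  have lin\<tau>: "linear (\<tau> i)" for i unfolding \<tau>_def using linear_T c p by blast
  have inj\<tau>: "\<tau> i v = \<tau> i w \<longleftrightarrow> v = w" for i v w unfolding \<tau>_def using T_inj c p by blast
  have surj\<tau>: "\<exists>w. \<tau> i w = v" for i v unfolding \<tau>_def using T_inverse(2) c p by blast
  have \<tau>D: "\<tau> (Suc i) (D i v) = differential A f (p i) (\<tau> i v)" for i v
    using differential_T[OF f(1) c(1)[of i] c(1)[of "Suc i"], of "p i"] p(2)[of i] p(3)[of i] p(3)[of "Suc i"]
    by (simp add: \<tau>_def D_def)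
  have coc: "cocycle D i k v = coord_deriv (c i) (c (i + k)) (f ^^ k) (p i) v" for i k v
    unfolding D_def p_def by (rule orbit_cocycle[OF f(1) c])
  have \<tau>coc: "\<tau> (i + k) (cocycle D i k v) = differential A (f ^^ k) (p i) (\<tau> i v)" for i k v
    using differential_T[OF C1_on_charts_funpow[OF f(1)] c(1)[of i] c(1)[of "i + k"], of "p i" k]
      p(4)[of k i] p(3)[of i] p(3)[of "i + k"]
    by (simp add: \<tau>_def coc)
  \<comment> \<open>Hyperbolicity bounds unstable vectors under \<open>inv f\<close>, whereas the
    locale compares \<open>u\<close> with its forward image; this identity makes \<open>u\<close>
    the backward image of its forward image.\<close>
  have pullback: "differential A (inv f ^^ k) (p (i + k)) (\<tau> (i + k) (cocycle D i k v)) = \<tau> i v" for i k v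
  proof -
    have e: "(inv f ^^ k) (p (i + k)) = p i" using inv_funpow_cancel(1)[OF f(3)] p(4) by metis
    have "inv f ^^ k \<circ> f ^^ k = id" using inv_funpow_cancel(1)[OF f(3)] by (auto simp: fun_eq_iff)
    then have "coord_deriv (c (i + k)) (c i) (inv f ^^ k) (p (i + k)) (cocycle D i k v) = v"
    proof -
      assume id: "inv f ^^ k \<circ> f ^^ k = id"
      have "coord_deriv (c i) (c i) (inv f ^^ k \<circ> f ^^ k) (p i) =
          coord_deriv (c (i + k)) (c i) (inv f ^^ k) ((f ^^ k) (p i)) \<circ> coord_deriv (c i) (c (i + k)) (f ^^ k) (p i)"
        by (rule chain(2)[OF C1_on_charts_funpow[OF f(1)] C1_on_charts_funpow[OF f(2)]])
          (simp_all only: c(1) p(3,4) e)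
      from fun_cong[OF this, of v] show ?thesis
        by (simp only: id coc comp_apply p(4) coord_deriv_id[OF c(1) p(3)])
    qed
    then show ?thesis
      using differential_T[OF C1_on_charts_funpow[OF f(2)] c(1)[of "i + k"] c(1)[of i], of "p (i + k)" k]
        p(3)[of i] p(3)[of "i + k"] e by (simp add: \<tau>_def)
  qed
  have EsD: "\<tau> (Suc i) (D i v) \<in> Es (p (Suc i))" if "\<tau> i v \<in> Es (p i)" for i v
    unfolding \<tau>D using inv(1)[OF p(1)[of i]] p(2)[of i] that by auto
  have EuD: "\<tau> (Suc i) (D i v) \<in> Eu (p (Suc i))" if "\<tau> i v \<in> Eu (p i)" for i v
    unfolding \<tau>D using inv(2)[OF p(1)[of i]] p(2)[of i] that by auto
  have Eucoc: "\<tau> (i + k) (cocycle D i k v) \<in> Eu (p (i + k))" if "\<tau> i v \<in> Eu (p i)" for i k v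
  proof (induction k)
    case (Suc k)
    show ?case using EuD[OF Suc] by simp
  qed (simp add: that)
  have nm: "norm v \<le> M * riem_norm g (p i) (\<tau> i v)" "riem_norm g (p i) (\<tau> i v) \<le> M * norm v" for i v
    using norms by (simp_all add: p_def \<tau>_def)
  have CM: "0 \<le> M * (C0 * \<kappa> ^ k)" for k using C0 M \<kappa> by simp
  have "hyperbolic_sequence D (\<lambda>i. {v. \<tau> i v \<in> Es (p i)}) (\<lambda>i. {v. \<tau> i v \<in> Eu (p i)}) (M * C0 * M) \<kappa> L m"
  proof (rule hyperbolic_sequence.intro)
    show "linear (D i)" for i
      using C1_on_chartsD(4)[OF f(1) c(1)[of i] c(1)[of "Suc i"], of "p i"] p(2)[of i] p(3)[of i] p(3)[of "Suc i"]
      by (auto simp: D_def intro: bounded_linear.linear)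
    show "subspace {v. \<tau> i v \<in> Es (p i)}" "subspace {v. \<tau> i v \<in> Eu (p i)}" for i
      using linear_subspace_linear_preimage[OF lin\<tau> sub(1)[OF p(1)]] linear_subspace_linear_preimage[OF lin\<tau> sub(2)[OF p(1)]]
      by simp_all
    show "D i ` {v. \<tau> i v \<in> Es (p i)} \<subseteq> {v. \<tau> (Suc i) v \<in> Es (p (Suc i))}" for i
      using EsD by auto
    show "D i ` {v. \<tau> i v \<in> Eu (p i)} = {v. \<tau> (Suc i) v \<in> Eu (p (Suc i))}" for i
    proof (intro set_eqI iffI)
      fix w assume "w \<in> {v. \<tau> (Suc i) v \<in> Eu (p (Suc i))}"
      then have "\<tau> (Suc i) w \<in> differential A f (p i) ` Eu (p i)" using inv(2)[OF p(1)[of i]] p(2)[of i] by simp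
      then obtain e where e: "e \<in> Eu (p i)" "\<tau> (Suc i) w = differential A f (p i) e" by blast
      obtain v where v: "\<tau> i v = e" using surj\<tau> by blast
      have "w = D i v" using e(2) by (simp add: v[symmetric] \<tau>D[symmetric] inj\<tau>)
      then show "w \<in> D i ` {v. \<tau> i v \<in> Eu (p i)}" using e v by blast
    qed (use EuD in auto)
    show "\<exists>s\<in>{v. \<tau> i v \<in> Es (p i)}. \<exists>u\<in>{v. \<tau> i v \<in> Eu (p i)}. v = s + u" for i v
    proof -
      obtain a b where ab: "a \<in> Es (p i)" "b \<in> Eu (p i)" "\<tau> i v = a + b" using decomp[OF p(1)] by metis
      obtain s u where su: "\<tau> i s = a" "\<tau> i u = b" using surj\<tau> by metis
      have "\<tau> i v = \<tau> i (s + u)" using ab su by (simp add: linear_add[OF lin\<tau>])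
      then have "v = s + u" by (simp only: inj\<tau>)
      then show ?thesis using ab su by blast
    qed
    show "norm (cocycle D i k s) \<le> (M * C0 * M) * \<kappa> ^ k * norm s" if "s \<in> {v. \<tau> i v \<in> Es (p i)}" for i k s
    proof -
      have "norm (cocycle D i k s) \<le> M * riem_norm g (p (i + k)) (\<tau> (i + k) (cocycle D i k s))" by (rule nm)
      also have "\<dots> \<le> M * (C0 * \<kappa> ^ k * riem_norm g (p i) (\<tau> i s))"
        using contr[OF p(1)[of i], of "\<tau> i s" k] that M by (simp add: p(4) \<tau>coc)
      also have "\<dots> = M * (C0 * \<kappa> ^ k) * riem_norm g (p i) (\<tau> i s)" by (simp add: mult_ac)
      also have "\<dots> \<le> M * (C0 * \<kappa> ^ k) * (M * norm s)" using CM nm by (intro mult_left_mono)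
      finally show ?thesis by (simp add: mult_ac)
    qed
    show "norm u \<le> (M * C0 * M) * \<kappa> ^ k * norm (cocycle D i k u)" if "u \<in> {v. \<tau> i v \<in> Eu (p i)}" for i k u
    proof -
      have e: "(inv f ^^ k) (p (i + k)) = p i" using inv_funpow_cancel(1)[OF f(3)] p(4) by metis
      have "norm u \<le> M * riem_norm g (p i) (\<tau> i u)" by (rule nm)
      also have "\<dots> \<le> M * (C0 * \<kappa> ^ k * riem_norm g (p (i + k)) (\<tau> (i + k) (cocycle D i k u)))"
        using expan[OF p(1)[of "i + k"], of "\<tau> (i + k) (cocycle D i k u)" k] Eucoc[of i u k] that M
        by (simp add: e pullback)
      also have "\<dots> = M * (C0 * \<kappa> ^ k) * riem_norm g (p (i + k)) (\<tau> (i + k) (cocycle D i k u))" by (simp add: mult_ac)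
      also have "\<dots> \<le> M * (C0 * \<kappa> ^ k) * (M * norm (cocycle D i k u))" using CM nm by (intro mult_left_mono)
      finally show ?thesis by (simp add: mult_ac)
    qed
    show "norm (D i v) \<le> L * norm v" for i v using L(2) by (simp add: D_def p_def)
  qed (use M C0 \<kappa> L m in auto)
  then show ?thesis by (simp only: D_def[abs_def] \<tau>_def p_def)
qed

end

text \<open>A single \<open>V\<close> serves all large return times, because every constant below is
  chosen from the finite cover, the hyperbolicity data and \<open>W\<close>.\<close>

lemma closing_lemma:
  fixes A :: "('a::{t2_space, second_countable_topology}, 'b::euclidean_space) chart set"
  assumes mfd: "compact_riemannian_manifold A g" and diffeo: "diffeomorphism A f"
    and hyp: "hyperbolic_set A g f \<Lambda>" and x: "x \<in> \<Lambda>"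
    and W: "open W" "\<And>p. (p, p) \<in> W"
  shows "\<exists>V n0. open V \<and> x \<in> V \<and> (\<forall>n\<ge>n0. (f ^^ n) x \<in> V \<longrightarrow>
    (\<exists>p. (f ^^ n) p = p \<and> (\<forall>i<n. ((f ^^ i) p, (f ^^ i) x) \<in> W)))"
proof -
  interpret smooth_manifold A
    using mfd by unfold_locales (simp add: compact_riemannian_manifold_def)
  have f: "C1_on_charts A f" "C1_on_charts A (inv f)" "bij f"
    using diffeo C1_map_imp_C1_on_charts by (auto simp: diffeomorphism_def)
  have contf: "continuous_on UNIV (f ^^ k)" for k
    using C1_on_chartsD(1)[OF C1_on_charts_funpow[OF f(1)] chart_at(1) chart_at(1)] .
  have g: "riemannian_metric A g" and cpt: "compact (UNIV :: 'a set)"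
    using mfd by (auto simp: compact_riemannian_manifold_def)
  have orbit: "(f ^^ i) x \<in> \<Lambda>" for i
    using hyp x by (induction i) (auto simp: hyperbolic_set_def)
  obtain Es Eu C0 \<kappa> where C0: "C0 > 0" and \<kappa>: "0 < \<kappa>" "\<kappa> < 1"
    and sub: "\<And>p. p \<in> \<Lambda> \<Longrightarrow> subspace (Es p)" "\<And>p. p \<in> \<Lambda> \<Longrightarrow> subspace (Eu p)"
    and decomp: "\<And>p v. p \<in> \<Lambda> \<Longrightarrow> \<exists>a\<in>Es p. \<exists>b\<in>Eu p. v = a + b"
    and inv: "\<And>p. p \<in> \<Lambda> \<Longrightarrow> differential A f p ` Es p = Es (f p)"
      "\<And>p. p \<in> \<Lambda> \<Longrightarrow> differential A f p ` Eu p = Eu (f p)"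
    and contr: "\<And>p v n. p \<in> \<Lambda> \<Longrightarrow> v \<in> Es p \<Longrightarrow>
      riem_norm g ((f ^^ n) p) (differential A (f ^^ n) p v) \<le> C0 * \<kappa> ^ n * riem_norm g p v"
    and expan: "\<And>p v n. p \<in> \<Lambda> \<Longrightarrow> v \<in> Eu p \<Longrightarrow>
      riem_norm g ((inv f ^^ n) p) (differential A (inv f ^^ n) p v) \<le> C0 * \<kappa> ^ n * riem_norm g p v"
  proof -
    from hyp obtain Es Eu C0 \<kappa> where *: "C0 > 0" "0 < \<kappa>" "\<kappa> < 1" and
      all: "\<forall>x\<in>\<Lambda>. subspace (Es x) \<and> subspace (Eu x) \<and> Es x \<inter> Eu x = {0} \<and>
        (\<forall>v. \<exists>a\<in>Es x. \<exists>b\<in>Eu x. v = a + b) \<and>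
        differential A f x ` Es x = Es (f x) \<and> differential A f x ` Eu x = Eu (f x) \<and>
        (\<forall>v\<in>Es x. \<forall>n. riem_norm g ((f ^^ n) x) (differential A (f ^^ n) x v)
          \<le> C0 * \<kappa> ^ n * riem_norm g x v) \<and>
        (\<forall>v\<in>Eu x. \<forall>n. riem_norm g ((inv f ^^ n) x) (differential A (inv f ^^ n) x v)
          \<le> C0 * \<kappa> ^ n * riem_norm g x v)"
      unfolding hyperbolic_set_def by (elim conjE exE) (rule that)
    show thesis by (rule that[OF *, of Es Eu]) (use all in \<open>simp_all del: funpow.simps\<close>)
  qed
  obtain I where I0: "finite I \<and> (\<forall>(c, K)\<in>I. c \<in> A \<and> compact K \<and> K \<subseteq> fst c) \<and>
      (\<forall>p. \<exists>(c, K)\<in>I. p \<in> interior K)"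
    using finite_compact_cover[OF cpt] by (rule exE)
  then have I: "finite I" "\<And>c K. (c, K) \<in> I \<Longrightarrow> c \<in> A \<and> compact K \<and> K \<subseteq> fst c"
    by auto
  have I_cover: "\<exists>k\<in>I. p \<in> interior (snd k)" for p
  proof -
    have "\<exists>(c, K)\<in>I. p \<in> interior K" using I0 by blast
    then show ?thesis by (simp add: split_beta)
  qed
  define good where "good k p \<longleftrightarrow> k \<in> I \<and> p \<in> snd k" for k :: "('a, 'b) chart \<times> 'a set" and p
  have goodD: "fst k \<in> A" "p \<in> fst (fst k)" "p \<in> snd k" "k \<in> I" if "good k p" for k p
    using that I(2)[of "fst k" "snd k"] by (auto simp: good_def)
  have IK: "fst k \<in> A" "compact (snd k)" "snd k \<subseteq> fst (fst k)" if "k \<in> I" for k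
    using that I(2)[of "fst k" "snd k"] by auto

  have "\<exists>M>0. \<forall>k\<in>I. \<forall>p\<in>snd k. \<forall>v. norm v \<le> M * riem_norm g p (T (fst k) p v) \<and>
      riem_norm g p (T (fst k) p v) \<le> M * norm v"
  proof (rule finite_uniform_large[OF I(1)])
    show "\<exists>M>0. \<forall>p\<in>snd k. \<forall>v. norm v \<le> M * riem_norm g p (T (fst k) p v) \<and>
      riem_norm g p (T (fst k) p v) \<le> M * norm v" if "k \<in> I" for k
      using norm_equivalence[OF g IK[OF that]] .
    have nonneg: "riem_norm g p v \<ge> 0" for p v
      using g by (cases "v = 0") (auto simp: riemannian_metric_def riem_norm_def bilinear_lzero less_imp_le)
    fix k M M' assume "\<forall>p\<in>snd k. \<forall>v. norm v \<le> M * riem_norm g p (T (fst k) p v) \<and>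
      riem_norm g p (T (fst k) p v) \<le> M * norm v" and "M \<le> (M'::real)"
    then show "\<forall>p\<in>snd k. \<forall>v. norm v \<le> M' * riem_norm g p (T (fst k) p v) \<and>
      riem_norm g p (T (fst k) p v) \<le> M' * norm v"
      using mult_right_mono[OF \<open>M \<le> M'\<close>] nonneg norm_ge_zero by (meson order_trans)
  qed
  then obtain M where M: "M > 0" "\<And>k p v. good k p \<Longrightarrow> norm v \<le> M * riem_norm g p (T (fst k) p v)"
    "\<And>k p v. good k p \<Longrightarrow> riem_norm g p (T (fst k) p v) \<le> M * norm v"
    unfolding good_def by blast
  have "\<exists>L>0. \<forall>kl\<in>I \<times> I. \<forall>p\<in>snd (fst kl). f p \<in> snd (snd kl) \<longrightarrow>
      (\<forall>v. norm (coord_deriv (fst (fst kl)) (fst (snd kl)) f p v) \<le> L * norm v)"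
  proof (rule finite_uniform_large)
    show "finite (I \<times> I)" using I(1) by simp
    fix kl assume "kl \<in> I \<times> I"
    then have kl: "fst kl \<in> I" "snd kl \<in> I" by auto
    show "\<exists>L>0. \<forall>p\<in>snd (fst kl). f p \<in> snd (snd kl) \<longrightarrow>
      (\<forall>v. norm (coord_deriv (fst (fst kl)) (fst (snd kl)) f p v) \<le> L * norm v)"
      using uniform_bound[OF f(1) IK[OF kl(1)] IK[OF kl(2)]] .
  next
    fix kl M M' assume "\<forall>p\<in>snd (fst kl). f p \<in> snd (snd kl) \<longrightarrow>
      (\<forall>v. norm (coord_deriv (fst (fst kl)) (fst (snd kl)) f p v) \<le> M * norm v)" and "M \<le> (M'::real)"
    then show "\<forall>p\<in>snd (fst kl). f p \<in> snd (snd kl) \<longrightarrow>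
      (\<forall>v. norm (coord_deriv (fst (fst kl)) (fst (snd kl)) f p v) \<le> M' * norm v)"
      using mult_right_mono[OF \<open>M \<le> M'\<close>] norm_ge_zero by (meson order_trans)
  qed
  then obtain L where L0: "L > 0" "\<forall>kl\<in>I \<times> I. \<forall>p\<in>snd (fst kl). f p \<in> snd (snd kl) \<longrightarrow>
      (\<forall>v. norm (coord_deriv (fst (fst kl)) (fst (snd kl)) f p v) \<le> L * norm v)" by blast
  have L: "L > 0" "\<And>k l p v. good k p \<Longrightarrow> good l (f p) \<Longrightarrow>
      norm (coord_deriv (fst k) (fst l) f p v) \<le> L * norm v"
  proof -
    fix k l p v assume "good k p" "good l (f p)"
    then show "norm (coord_deriv (fst k) (fst l) f p v) \<le> L * norm v"
      using bspec[OF L0(2), of "(k, l)"] by (simp add: good_def)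
  qed (rule L0(1))
  define C where "C = M * C0 * M"
  have C: "C > 0" using M C0 by (simp add: C_def)
  have "(\<lambda>n. C * \<kappa> ^ n) \<longlonglongrightarrow> C * 0"
    using \<kappa> by (intro tendsto_mult_left LIMSEQ_power_zero) auto
  then have lim: "(\<lambda>n. C * \<kappa> ^ n) \<longlonglongrightarrow> 0" by simp
  then have "\<forall>\<^sub>F n in sequentially. C * \<kappa> ^ n < 1 / 2" by (rule order_tendstoD) simp
  then obtain m where m: "C * \<kappa> ^ m \<le> 1 / 2" by (auto simp: eventually_sequentially intro: less_imp_le)
  define q0 where "q0 = angle_const L m"
  define K where "K = shadowing_const C \<kappa> L m"
  have q0: "q0 > 0" unfolding q0_def using L by (simp add: angle_const_pos)
  have K: "K > 0" unfolding K_def using L C \<kappa> by (simp add: shadowing_const_pos)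
  have "(\<lambda>n. 4 * q0 * (C * \<kappa> ^ n)) \<longlonglongrightarrow> 4 * q0 * 0" using lim by (intro tendsto_mult_left)
  then have "(\<lambda>n. 4 * q0 * (C * \<kappa> ^ n)) \<longlonglongrightarrow> 0" by simp
  then have "\<forall>\<^sub>F n in sequentially. 4 * q0 * (C * \<kappa> ^ n) < 1" by (rule order_tendstoD) simp
  then obtain n1 where n1: "\<And>n. n \<ge> n1 \<Longrightarrow> 4 * q0 * (C * \<kappa> ^ n) < 1"
    by (auto simp: eventually_sequentially)
  \<comment> \<open>The Lipschitz constant that makes the iteration of
    \<open>periodic_nonlinear_solution\<close> contract by one half.\<close>
  define \<epsilon> where "\<epsilon> = 1 / (2 * K)"
  have \<epsilon>: "\<epsilon> > 0" "K * \<epsilon> \<le> 1 / 2" using K by (simp_all add: \<epsilon>_def)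

  define Rem where "Rem k l p v = snd (fst l) (f (chart_inv (fst k) (snd (fst k) p + v))) - coord_deriv (fst k) (fst l) f p v"
    for k l :: "('a, 'b) chart \<times> 'a set" and p v
  have "\<exists>\<rho>>0. \<forall>kl\<in>I \<times> I. \<forall>p\<in>snd (fst kl). f p \<in> snd (snd kl) \<longrightarrow>
      (\<forall>v. norm v \<le> \<rho> \<longrightarrow> snd (fst (fst kl)) p + v \<in> snd (fst (fst kl)) ` fst (fst (fst kl)) \<and>
        f (chart_inv (fst (fst kl)) (snd (fst (fst kl)) p + v)) \<in> fst (fst (snd kl))) \<and>
      (\<forall>a b. norm a \<le> \<rho> \<longrightarrow> norm b \<le> \<rho> \<longrightarrow>
        norm (Rem (fst kl) (snd kl) p a - Rem (fst kl) (snd kl) p b) \<le> \<epsilon> * norm (a - b))"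
  proof (rule finite_uniform_small)
    show "finite (I \<times> I)" using I(1) by simp
    fix kl assume "kl \<in> I \<times> I"
    then have kl: "fst kl \<in> I" "snd kl \<in> I" by auto
    show "\<exists>\<rho>>0. \<forall>p\<in>snd (fst kl). f p \<in> snd (snd kl) \<longrightarrow>
      (\<forall>v. norm v \<le> \<rho> \<longrightarrow> snd (fst (fst kl)) p + v \<in> snd (fst (fst kl)) ` fst (fst (fst kl)) \<and>
        f (chart_inv (fst (fst kl)) (snd (fst (fst kl)) p + v)) \<in> fst (fst (snd kl))) \<and>
      (\<forall>a b. norm a \<le> \<rho> \<longrightarrow> norm b \<le> \<rho> \<longrightarrow>
        norm (Rem (fst kl) (snd kl) p a - Rem (fst kl) (snd kl) p b) \<le> \<epsilon> * norm (a - b))"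
      unfolding Rem_def using uniform_remainder[OF f(1) IK[OF kl(1)] IK[OF kl(2)] \<epsilon>(1)] .
  qed (meson order_trans)
  then obtain \<rho>1 where \<rho>1: "\<rho>1 > 0"
    and all: "\<forall>kl\<in>I \<times> I. \<forall>p\<in>snd (fst kl). f p \<in> snd (snd kl) \<longrightarrow>
      (\<forall>v. norm v \<le> \<rho>1 \<longrightarrow> snd (fst (fst kl)) p + v \<in> snd (fst (fst kl)) ` fst (fst (fst kl)) \<and>
        f (chart_inv (fst (fst kl)) (snd (fst (fst kl)) p + v)) \<in> fst (fst (snd kl))) \<and>
      (\<forall>a b. norm a \<le> \<rho>1 \<longrightarrow> norm b \<le> \<rho>1 \<longrightarrow>
        norm (Rem (fst kl) (snd kl) p a - Rem (fst kl) (snd kl) p b) \<le> \<epsilon> * norm (a - b))"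
    by blast
  have stay: "snd (fst k) p + v \<in> snd (fst k) ` fst (fst k) \<and>
        f (chart_inv (fst k) (snd (fst k) p + v)) \<in> fst (fst l)"
    if "good k p" "good l (f p)" "norm v \<le> \<rho>1" for k l p v
    using bspec[OF all, of "(k, l)"] that by (simp add: good_def)
  have rem: "norm (Rem k l p a - Rem k l p b) \<le> \<epsilon> * norm (a - b)"
    if "good k p" "good l (f p)" "norm a \<le> \<rho>1" "norm b \<le> \<rho>1" for k l p a b
    using bspec[OF all, of "(k, l)"] that by (simp add: good_def)
  have "\<exists>\<rho>>0. \<forall>k\<in>I. \<forall>p\<in>snd k. \<forall>v::'b. norm v \<le> \<rho> \<longrightarrow>
     snd (fst k) p + v \<in> snd (fst k) ` fst (fst k) \<and> (chart_inv (fst k) (snd (fst k) p + v), p) \<in> W"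
  proof (rule finite_uniform_small[OF I(1)])
    show "\<exists>\<rho>>0. \<forall>p\<in>snd k. \<forall>v::'b. norm v \<le> \<rho> \<longrightarrow>
     snd (fst k) p + v \<in> snd (fst k) ` fst (fst k) \<and> (chart_inv (fst k) (snd (fst k) p + v), p) \<in> W" if "k \<in> I" for k
      using uniform_neighbourhood[OF IK[OF that] W] .
  qed (meson order_trans)
  then obtain \<rho>2 where \<rho>2: "\<rho>2 > 0" "\<And>k p v. good k p \<Longrightarrow> norm v \<le> \<rho>2 \<Longrightarrow>
     snd (fst k) p + v \<in> snd (fst k) ` fst (fst k) \<and> (chart_inv (fst k) (snd (fst k) p + v), p) \<in> W"
    unfolding good_def by blast
  define \<rho> where "\<rho> = min \<rho>1 \<rho>2"
  have \<rho>: "\<rho> > 0" "\<rho> \<le> \<rho>1" "\<rho> \<le> \<rho>2" using \<rho>1 \<rho>2 by (auto simp: \<rho>_def)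

  have "\<exists>k. good k q \<and> q \<in> interior (snd k)" for q
  proof -
    obtain k where "k \<in> I" "q \<in> interior (snd k)" using I_cover[of q] by blast
    then show ?thesis using interior_subset[of "snd k"] by (intro exI[of _ k]) (auto simp: good_def)
  qed
  then obtain k where k: "\<And>q. good (k q) q" "\<And>q. q \<in> interior (snd (k q))" by metis
  define k0 where "k0 = k x"
  define km where "km = k ((f ^^ m) x)"
  have k0: "fst k0 \<in> A" "x \<in> fst (fst k0)" and km: "fst km \<in> A" "(f ^^ m) x \<in> fst (fst km)"
    using goodD[OF k(1)] by (auto simp: k0_def km_def)
  define Dm where "Dm y = Blinfun (coord_deriv (fst k0) (fst km) (f ^^ m) y)" for y
  \<comment> \<open>With this radius the mismatch \<open>z n - z 0\<close> between the endpoints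
    satisfies \<open>2 * K * norm (z n - z 0) \<le> \<rho>\<close>.\<close>
  define O1 where "O1 = fst (fst k0) \<inter> snd (fst k0) -` ball (snd (fst k0) x) (\<rho> / (2 * K))"
  \<comment> \<open>Changing the derivative of \<open>f ^^ m\<close> by at most \<open>1 / 2\<close>
    costs exactly the \<open>norm u / 2\<close> that \<open>norm_le_of_hyperbolic_pair\<close>
    tolerates.\<close>
  define O2 where "O2 = (fst (fst k0) \<inter> (f ^^ m) -` fst (fst km)) \<inter> Dm -` ball (Dm x) (1 / 2)"
  define V where "V = interior (snd k0) \<inter> (f ^^ m) -` interior (snd km) \<inter> O1 \<inter> O2"
  have "open O1" unfolding O1_def
    using chart_cont[OF k0(1)] chart_open[OF k0(1)] by (rule continuous_open_preimage) simp
  moreover have "open O2" unfolding O2_def Dm_def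
    using C1_on_chartsD(3)[OF C1_on_charts_funpow[OF f(1)] k0(1) km(1)]
      C1_on_charts_open[OF C1_on_charts_funpow[OF f(1)] k0(1) km(1)] by (rule continuous_open_preimage) simp
  moreover have "open ((f ^^ m) -` interior (snd km))" using contf by (intro open_vimage) auto
  ultimately have "open V" unfolding V_def by auto
  have "x \<in> V" unfolding V_def O1_def O2_def
    using k(2)[of x] k(2)[of "(f ^^ m) x"] k0 km \<rho> K by (simp add: k0_def[symmetric] km_def[symmetric])

  \<comment> \<open>\<open>n \<ge> n1\<close> gives the absorption in
    \<open>periodic_estimate\<close>; \<open>n > m\<close> keeps index \<open>m\<close> apart from
    index \<open>n\<close>, where the chart is overridden.\<close>
  have "\<exists>p. (f ^^ n) p = p \<and> (\<forall>i<n. ((f ^^ i) p, (f ^^ i) x) \<in> W)"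
    if n: "n \<ge> max n1 (Suc m)" and xV: "(f ^^ n) x \<in> V" for n
  proof -
    \<comment> \<open>The chart at \<open>f\<^sup>n x\<close> is the one at \<open>x\<close>, and the chart at \<open>f\<^bsup>n+m\<^esup> x\<close> the one at \<open>f\<^sup>m x\<close>.\<close>
    define ks where "ks i = (if i = n then k0 else if i = n + m then km else k ((f ^^ i) x))" for i
    define c where "c i = fst (ks i)" for i
    define p where "p i = (f ^^ i) x" for i
    have fp: "f (p i) = p (Suc i)" for i by (simp add: p_def)
    have ks: "ks 0 = k0" "ks n = k0" "ks m = km" "ks (n + m) = km"
      using n by (auto simp: ks_def k0_def km_def)
    have gd: "good (ks i) (p i)" for i
    proof -
      have "good k0 (p n)" using xV interior_subset goodD(4)[OF k(1)] by (auto simp: V_def p_def k0_def good_def)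
      moreover have "good km (p (n + m))"
        using xV interior_subset goodD(4)[OF k(1)] by (auto simp: V_def p_def km_def good_def funpow_add add.commute[of n m])
      ultimately show ?thesis using k(1) by (auto simp: ks_def p_def)
    qed
    have cA: "c i \<in> A" "(f ^^ i) x \<in> fst (c i)" "p i \<in> fst (c i)" for i
      using goodD[OF gd[of i]] by (auto simp: c_def p_def)
    define D where "D i = coord_deriv (c i) (c (Suc i)) f (p i)" for i
    define S where "S i = {v. T (c i) (p i) v \<in> Es (p i)}" for i
    define U where "U i = {v. T (c i) (p i) v \<in> Eu (p i)}" for i
    have gdS: "good (ks (Suc i)) (f (p i))" for i using gd[of "Suc i"] by (simp add: fp)
    interpret hyperbolic_sequence D S U C \<kappa> L m
      unfolding D_def S_def U_def p_def C_def
    proof (rule hyperbolic_sequence_along_orbit[where \<Lambda> = \<Lambda> and g = g])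
      show "norm v \<le> M * riem_norm g ((f ^^ i) x) (T (c i) ((f ^^ i) x) v)"
        "riem_norm g ((f ^^ i) x) (T (c i) ((f ^^ i) x) v) \<le> M * norm v" for i v
        using M(2,3)[OF gd] by (simp_all add: c_def p_def)
      show "norm (coord_deriv (c i) (c (Suc i)) f ((f ^^ i) x) v) \<le> L * norm v" for i v
        using L(2)[OF gd gdS] by (simp add: c_def p_def)
    qed (fact f cA orbit sub decomp inv contr expan C0 \<kappa> M(1) L(1) m[unfolded C_def])+
    have Dm: "blinfun_apply (Dm y) = coord_deriv (fst k0) (fst km) (f ^^ m) y"
      if "y \<in> fst (fst k0)" "(f ^^ m) y \<in> fst (fst km)" for y
      unfolding Dm_def
      using C1_on_chartsD(4)[OF C1_on_charts_funpow[OF f(1)] k0(1) km(1) that] by (rule bounded_linear_Blinfun_apply)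
    have coc: "cocycle D i j v = coord_deriv (c i) (c (i + j)) (f ^^ j) (p i) v" for i j v
      unfolding D_def p_def by (rule orbit_cocycle[OF f(1) cA(1,2)])
    have coc0: "cocycle D 0 m v = Dm x v" and cocn: "cocycle D n m v = Dm ((f ^^ n) x) v" for v
      using coc[of 0 m v] coc[of n m v] Dm k0 km xV ks
      by (auto simp: c_def V_def O2_def p_def)
    have wrap: "norm s \<le> angle_const L m * norm (s + u) \<and> norm u \<le> angle_const L m * norm (s + u)"
      if su: "s \<in> S 0" "u \<in> U n" for s u
    proof -
      have "norm (Dm ((f ^^ n) x) - Dm x) \<le> 1 / 2"
        using xV by (auto simp: V_def O2_def dist_norm norm_minus_commute)
      then have "norm ((Dm ((f ^^ n) x) - Dm x) u) \<le> 1 / 2 * norm u"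
        using norm_blinfun[of "Dm ((f ^^ n) x) - Dm x" u] mult_right_mono[of _ "1/2" "norm u"] by fastforce
      then have 1: "norm (Dm ((f ^^ n) x) u - Dm x u) \<le> norm u / 2" by (simp add: blinfun.diff_left)
      have 2: "norm (Dm x (s + u)) \<le> L ^ m * norm (s + u)"
        using cocycle_bound[of 0 m "s + u"] by (simp add: coc0)
      \<comment> \<open>\<open>s\<close> is moved by the derivative at \<open>x\<close> and
        \<open>u\<close> by the one at the return point. Both are read in the charts of
        \<open>k0\<close> and \<open>km\<close>, so their sum makes sense and differs little from
        \<open>Dm x (s + u)\<close>.\<close>
      have "cocycle D 0 m s + cocycle D n m u = Dm x (s + u) + (Dm ((f ^^ n) x) u - Dm x u)"
        by (simp add: coc0 cocn blinfun.add_right)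
      then have "norm (cocycle D 0 m s + cocycle D n m u) \<le> L ^ m * norm (s + u) + norm u / 2"
        using norm_triangle_mono[OF 2 1] by simp
      from norm_le_of_hyperbolic_pair[OF expan_m[OF su(2)] contr_m[OF su(1)] this]
      show ?thesis by (simp add: angle_const_def)
    qed
    have nC: "4 * angle_const L m * C * \<kappa> ^ n \<le> 1" using n1[of n] n by (simp add: q0_def mult.assoc)
    have est: "norm (v i) \<le> K * \<omega>"
      if "\<And>i. i < n \<Longrightarrow> norm (v (Suc i) - D i (v i)) \<le> \<omega>" "norm (v 0 - v n) \<le> \<omega>" "i \<le> n" for v \<omega> i
      unfolding K_def using periodic_estimate[OF that(1,2) wrap nC that(3)] by blast
    define z where "z i = snd (c i) (p i)" for i
    \<comment> \<open>In coordinates relative to the orbit of \<open>x\<close>, \<open>f\<close> is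
      \<open>D i + R i\<close>. Thus the recursion says that the perturbed points form an orbit, and
      \<open>v 0 - v n = z n - z 0\<close> says that the points at times \<open>0\<close> and
      \<open>n\<close> have equal coordinates in the same chart.\<close>
    define R where "R i v = snd (c (Suc i)) (f (chart_inv (c i) (z i + v))) - z (Suc i) - D i v" for i v
    have R_Rem: "R i v = Rem (ks i) (ks (Suc i)) (p i) v - z (Suc i)" for i v
      by (simp add: R_def Rem_def z_def c_def D_def)
    have c0n: "c n = c 0" using ks by (simp add: c_def)
    have "norm (z n - z 0) \<le> \<rho> / (2 * K)"
      using xV ks by (auto simp: z_def c_def p_def V_def O1_def dist_norm norm_minus_commute)
    then have zn: "2 * K * norm (z n - z 0) \<le> \<rho>" using K by (simp add: field_simps)
    have "\<exists>v. (\<forall>i<n. v (Suc i) = D i (v i) + R i (v i)) \<and> v 0 - v n = z n - z 0 \<and> (\<forall>i\<le>n. norm (v i) \<le> \<rho>)"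
    proof (rule periodic_nonlinear_solution[of D n K \<rho> \<epsilon> R "z n - z 0"])
      show "R i 0 = 0" for i
        using cA(1,3) lin linear_0 by (auto simp: R_def z_def chart_inv_chart fp)
      show "norm (R i a - R i b) \<le> \<epsilon> * norm (a - b)" if "norm a \<le> \<rho>" "norm b \<le> \<rho>" for i a b
        using rem[OF gd gdS, of a b i] that \<rho> by (simp add: R_Rem)
    qed (use lin est K \<rho> \<epsilon> zn in \<open>auto simp: less_imp_le\<close>)
    then obtain v where v: "\<And>i. i < n \<Longrightarrow> v (Suc i) = D i (v i) + R i (v i)" "v 0 - v n = z n - z 0"
      "\<And>i. i \<le> n \<Longrightarrow> norm (v i) \<le> \<rho>" by blast
    define y where "y i = chart_inv (c i) (z i + v i)" for i
    have step: "f (y i) = y (Suc i)" if "i < n" for i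
    proof -
      have "f (y i) \<in> fst (c (Suc i))"
        using stay[OF gd gdS, of "v i" i] v(3)[of i] that \<rho> by (simp add: y_def z_def c_def)
      moreover have "snd (c (Suc i)) (f (y i)) = z (Suc i) + v (Suc i)"
        using v(1)[OF that] by (simp add: y_def R_def)
      ultimately show ?thesis unfolding y_def[of "Suc i"] by (metis cA(1) chart_inv_chart)
    qed
    have orb: "(f ^^ i) (y 0) = y i" if "i \<le> n" for i
      using that by (induction i) (auto simp: step)
    have "y n = y 0" using v(2) by (simp add: y_def c0n algebra_simps)
    then have "(f ^^ n) (y 0) = y 0" using orb[of n] by simp
    moreover have "((f ^^ i) (y 0), (f ^^ i) x) \<in> W" if "i < n" for i
      using \<rho>2(2)[OF gd, of "v i" i] v(3)[of i] orb[of i] that \<rho> by (simp add: y_def z_def c_def p_def)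
    ultimately show ?thesis by blast
  qed
  then show ?thesis using \<open>open V\<close> \<open>x \<in> V\<close> by blast
qed

section \<open>The ergodic theorem\<close>

locale ergodic_system = prob_space M for M :: "'a measure" +
  fixes T :: "'a \<Rightarrow> 'a"
  assumes T_meas [measurable]: "T \<in> measurable M M" and T_inv: "distr M M T = M"
    and ergodic: "\<And>B. B \<in> sets M \<Longrightarrow> T -` B \<inter> space M = B \<Longrightarrow> measure M B = 0 \<or> measure M B = 1"
begin

lemma T_space: "x \<in> space M \<Longrightarrow> T x \<in> space M"
  using T_meas by (rule measurable_space)

lemma funpow_meas [measurable]: "T ^^ n \<in> measurable M M"
proof (induction n)
  case (Suc n)
  show ?case using measurable_comp[OF Suc T_meas] by simp
qed (simp add: id_def)

lemma integral_T:
  assumes [measurable]: "h \<in> borel_measurable M"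
  shows "(\<integral>x. h (T x) \<partial>M) = (\<integral>x. h x \<partial>M :: real)"
  using integral_distr[OF T_meas, of h] by (simp add: T_inv)

definition birkhoff :: "('a \<Rightarrow> real) \<Rightarrow> nat \<Rightarrow> 'a \<Rightarrow> real" where
  "birkhoff h n x = (\<Sum>i<n. h ((T ^^ i) x))"

lemma birkhoff_Suc: "birkhoff h (Suc n) x = h x + birkhoff h n (T x)"
  unfolding birkhoff_def by (subst sum.lessThan_Suc_shift) (simp add: funpow_swap1)

lemma birkhoff_meas [measurable]: "h \<in> borel_measurable M \<Longrightarrow> birkhoff h n \<in> borel_measurable M"
  unfolding birkhoff_def by (intro borel_measurable_sum measurable_compose[OF funpow_meas])

text \<open>In this recursive form the identity for
  \<open>birkhoff_max h (Suc n) x - birkhoff_max h n (T x)\<close> holds by unfolding.\<close>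

primrec birkhoff_max :: "('a \<Rightarrow> real) \<Rightarrow> nat \<Rightarrow> 'a \<Rightarrow> real" where
  "birkhoff_max h 0 x = 0"
| "birkhoff_max h (Suc n) x = max 0 (h x + birkhoff_max h n (T x))"

lemma birkhoff_max_meas [measurable]:
  assumes [measurable]: "h \<in> borel_measurable M"
  shows "birkhoff_max h n \<in> borel_measurable M"
proof (induction n)
  case (Suc n)
  note [measurable] = Suc
  have "birkhoff_max h (Suc n) = (\<lambda>x. max 0 (h x + birkhoff_max h n (T x)))" by auto
  also have "\<dots> \<in> borel_measurable M" by measurable
  finally show ?case .
next
  case 0
  have "birkhoff_max h 0 = (\<lambda>x. 0)" by auto
  then show ?case by simp
qed

lemma birkhoff_max_nonneg: "birkhoff_max h n x \<ge> 0"
  by (cases n) auto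

lemma birkhoff_max_mono: "birkhoff_max h n x \<le> birkhoff_max h (Suc n) x"
proof (induction n arbitrary: x)
  case (Suc n)
  from Suc[of "T x"] show ?case by (simp del: birkhoff_max.simps(2) add: birkhoff_max.simps(2)[of h "Suc n"] birkhoff_max.simps(2)[of h n x])
qed simp

lemma birkhoff_le_max: "n \<le> N \<Longrightarrow> birkhoff h n x \<le> birkhoff_max h N x"
proof (induction N arbitrary: n x)
  case (Suc N)
  show ?case
  proof (cases n)
    case 0
    then show ?thesis by (simp add: birkhoff_def)
  next
    case (Suc k)
    then show ?thesis using Suc.IH[of k "T x"] Suc.prems by (simp add: birkhoff_Suc)
  qed
qed (simp add: birkhoff_def)

lemma birkhoff_max_le:
  assumes "\<And>x. x \<in> space M \<Longrightarrow> \<bar>h x\<bar> \<le> B" "x \<in> space M"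
  shows "birkhoff_max h n x \<le> real n * B"
  using assms(2)
proof (induction n arbitrary: x)
  case (Suc n)
  have "birkhoff_max h n (T x) \<le> real n * B" "h x \<le> B" "B \<ge> 0"
    using Suc.IH[OF T_space] Suc.prems assms(1)[of x] by auto
  then show ?case by (simp add: distrib_right)
qed simp

text \<open>If the Birkhoff sums were unbounded almost everywhere, then
  \<open>max (- M\<^sub>n \<circ> T) h = M\<^sub>n\<^sub>+\<^sub>1 - M\<^sub>n \<circ> T\<close>, with \<open>M\<^sub>n\<close> the maximum of the first \<open>n\<close> sums, would converge
  boundedly to \<open>h\<close>; but its integral is non-negative because \<open>M\<^sub>n\<close> increases with \<open>n\<close>.\<close>

lemma birkhoff_bdd_above:
  assumes h [measurable]: "h \<in> borel_measurable M" and B: "\<And>x. x \<in> space M \<Longrightarrow> \<bar>h x\<bar> \<le> B"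
    and neg: "(\<integral>x. h x \<partial>M) < 0"
  shows "AE x in M. bdd_above (range (\<lambda>n. birkhoff h n x))"
proof -
  define E where "E = {x \<in> space M. \<forall>k::nat. \<exists>n. birkhoff h n x > real k}"
  have bdd_iff: "bdd_above (range (\<lambda>n. birkhoff h n x)) \<longleftrightarrow> x \<notin> E" if "x \<in> space M" for x
  proof -
    have "bdd_above (range (\<lambda>n. birkhoff h n x)) \<longleftrightarrow> (\<exists>k::nat. \<forall>n. birkhoff h n x \<le> real k)"
      unfolding bdd_above_def by (auto, meson order_trans real_arch_simple)
    then show ?thesis using that by (auto simp: E_def not_less)
  qed
  have E_meas: "E \<in> sets M" unfolding E_def by measurable
  \<comment> \<open>Passing to \<open>T x\<close> changes the sums only by a shift of the index and
    the term \<open>h x\<close>; hence \<open>E\<close> equals its preimage exactly, as the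
    assumption \<open>ergodic\<close> demands.\<close>
  have shift: "bdd_above (range (\<lambda>n. birkhoff h n (T x))) \<longleftrightarrow> bdd_above (range (\<lambda>n. birkhoff h n x))" for x
  proof
    assume "bdd_above (range (\<lambda>n. birkhoff h n (T x)))"
    then obtain K where K: "\<And>n. birkhoff h n (T x) \<le> K" by (auto simp: bdd_above_def)
    have "birkhoff h n x \<le> max 0 (h x + K)" for n
      using K[of "n - 1"] by (cases n) (auto simp: birkhoff_Suc birkhoff_def[of _ 0])
    then show "bdd_above (range (\<lambda>n. birkhoff h n x))" by (auto simp: bdd_above_def)
  next
    assume "bdd_above (range (\<lambda>n. birkhoff h n x))"
    then obtain K where K: "\<And>n. birkhoff h n x \<le> K" by (auto simp: bdd_above_def)
    have "birkhoff h n (T x) \<le> K - h x" for n using K[of "Suc n"] by (simp add: birkhoff_Suc)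
    then show "bdd_above (range (\<lambda>n. birkhoff h n (T x)))" by (auto simp: bdd_above_def)
  qed
  have E_space: "E \<subseteq> space M" by (auto simp: E_def)
  have TE: "T x \<in> E \<longleftrightarrow> x \<in> E" if "x \<in> space M" for x
    using bdd_iff[OF that] bdd_iff[OF T_space[OF that]] shift[of x] by argo
  have "T -` E \<inter> space M = E" using TE E_space by blast
  then consider "measure M E = 0" | "measure M E = 1" using ergodic[OF E_meas] by blast
  then show ?thesis
  proof cases
    case 1
    then have "E \<in> null_sets M" using E_meas by (auto simp: emeasure_eq_measure)
    then have "AE x in M. x \<notin> E" by (rule AE_not_in)
    then show ?thesis by (rule AE_mp) (use bdd_iff in \<open>auto intro!: AE_I2\<close>)
  next
    case 2
    then have AE_E: "AE x in M. x \<in> E" using E_meas prob_eq_1 by blast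
    let ?g = "\<lambda>n x. max (- birkhoff_max h n (T x)) (h x)"
    have g_eq: "?g n x = birkhoff_max h (Suc n) x - birkhoff_max h n (T x)" for n x by auto
    have int_max: "integrable M (birkhoff_max h n)" for n
      by (rule integrable_const_bound[of _ "real n * B"])
        (use birkhoff_max_le[OF B] birkhoff_max_nonneg in \<open>auto intro!: AE_I2\<close>)
    have int_maxT: "integrable M (\<lambda>x. birkhoff_max h n (T x))" for n
      by (rule integrable_const_bound[of _ "real n * B"])
        (use birkhoff_max_le[OF B] birkhoff_max_nonneg T_space in \<open>auto intro!: AE_I2\<close>)
    have nonneg: "(\<integral>x. ?g n x \<partial>M) \<ge> 0" for n
    proof -
      have 1: "(\<integral>x. ?g n x \<partial>M) = (\<integral>x. birkhoff_max h (Suc n) x \<partial>M) - (\<integral>x. birkhoff_max h n (T x) \<partial>M)"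
        unfolding g_eq by (rule Bochner_Integration.integral_diff[OF int_max int_maxT])
      have 2: "(\<integral>x. birkhoff_max h n (T x) \<partial>M) = (\<integral>x. birkhoff_max h n x \<partial>M)" by (rule integral_T) simp
      have 3: "(\<integral>x. birkhoff_max h n x \<partial>M) \<le> (\<integral>x. birkhoff_max h (Suc n) x \<partial>M)"
        by (intro integral_mono int_max birkhoff_max_mono)
      from 1 2 3 show ?thesis by linarith
    qed
    have "(\<lambda>n. \<integral>x. ?g n x \<partial>M) \<longlonglongrightarrow> (\<integral>x. h x \<partial>M)"
    proof (rule integral_dominated_convergence[where w = "\<lambda>_. B"])
      show "AE x in M. (\<lambda>n. ?g n x) \<longlonglongrightarrow> h x"
        using AE_E
      proof (rule AE_mp, intro AE_I2 impI)
        fix x assume x: "x \<in> space M" "x \<in> E"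
        then have "T x \<in> E" using TE by blast
        obtain k :: nat where k: "- h x \<le> real k" using real_arch_simple by blast
        obtain m where m: "birkhoff h m (T x) > real k" using \<open>T x \<in> E\<close> by (auto simp: E_def)
        have "?g n x = h x" if "n \<ge> m" for n
        proof -
          have "- birkhoff_max h n (T x) \<le> h x" using birkhoff_le_max[OF that, of h "T x"] m k by linarith
          then show ?thesis by (rule max_absorb2)
        qed
        then show "(\<lambda>n. ?g n x) \<longlonglongrightarrow> h x"
          by (intro tendsto_eventually eventually_sequentiallyI)
      qed
      \<comment> \<open>As the maximal function is non-negative, the expression lies between
        \<open>h x\<close> and \<open>max 0 (h x)\<close>.\<close>
      show "AE x in M. norm (?g n x) \<le> B" for n
      proof (rule AE_I2)
        fix x assume "x \<in> space M"
        then show "norm (?g n x) \<le> B" using B[of x] birkhoff_max_nonneg[of h n "T x"] by auto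
      qed
    qed auto
    then have "(\<integral>x. h x \<partial>M) \<ge> 0" using nonneg by (intro LIMSEQ_le_const) auto
    then show ?thesis using neg by simp
  qed
qed

text \<open>Subtracting a number slightly above the mean leaves a function of negative mean, whose
  Birkhoff sums are bounded above.\<close>

lemma birkhoff_upper:
  assumes [measurable]: "h \<in> borel_measurable M" and B: "\<And>x. x \<in> space M \<Longrightarrow> \<bar>h x\<bar> \<le> B"
  shows "AE x in M. \<forall>k::nat. \<exists>K. \<forall>n. birkhoff h n x \<le> real n * ((\<integral>x. h x \<partial>M) + 1 / Suc k) + K"
  unfolding AE_all_countable
proof
  fix k :: nat
  define c where "c = (\<integral>x. h x \<partial>M) + 1 / Suc k"
  have int: "integrable M h" by (rule integrable_const_bound[of _ B]) (use B in \<open>auto intro!: AE_I2\<close>)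
  have sum: "birkhoff (\<lambda>x. h x - c) n x = birkhoff h n x - real n * c" for n x
    by (simp add: birkhoff_def sum_subtractf)
  have "(\<integral>x. h x - c \<partial>M) = (\<integral>x. h x \<partial>M) - c" using int by (simp add: prob_space)
  then have "(\<integral>x. h x - c \<partial>M) < 0" by (simp add: c_def)
  then have "AE x in M. bdd_above (range (\<lambda>n. birkhoff (\<lambda>x. h x - c) n x))"
    using B by (intro birkhoff_bdd_above[of _ "B + \<bar>c\<bar>"]) (fastforce intro: order_trans[OF abs_triangle_ineq4])+
  then show "AE x in M. \<exists>K. \<forall>n. birkhoff h n x \<le> real n * ((\<integral>x. h x \<partial>M) + 1 / Suc k) + K"
  proof (rule AE_mp, intro AE_I2 impI)
    fix x assume "bdd_above (range (\<lambda>n. birkhoff (\<lambda>x. h x - c) n x))"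
    then obtain K where "\<And>n. birkhoff h n x - real n * c \<le> K" by (auto simp: bdd_above_def sum)
    then show "\<exists>K. \<forall>n. birkhoff h n x \<le> real n * ((\<integral>x. h x \<partial>M) + 1 / Suc k) + K"
      by (intro exI[of _ K]) (simp add: c_def algebra_simps)
  qed
qed

text \<open>The one-sided bound is applied to \<open>h\<close> and to \<open>- h\<close>; division
  by \<open>n\<close> removes the additive constants.\<close>

lemma birkhoff_ergodic:
  assumes h [measurable]: "h \<in> borel_measurable M" and B: "\<And>x. x \<in> space M \<Longrightarrow> \<bar>h x\<bar> \<le> B"
  shows "AE x in M. (\<lambda>n. birkhoff h n x / real n) \<longlonglongrightarrow> (\<integral>x. h x \<partial>M)"
proof -
  define c where "c = (\<integral>x. h x \<partial>M)"
  have up: "AE x in M. \<forall>k::nat. \<exists>K. \<forall>n. birkhoff h n x \<le> real n * (c + 1 / Suc k) + K"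
    unfolding c_def by (rule birkhoff_upper[OF h B])
  have "AE x in M. \<forall>k::nat. \<exists>K. \<forall>n. birkhoff (\<lambda>x. - h x) n x \<le> real n * ((\<integral>x. - h x \<partial>M) + 1 / Suc k) + K"
    by (rule birkhoff_upper[of _ B]) (use B in auto)
  moreover have "birkhoff (\<lambda>x. - h x) n x = - birkhoff h n x" for n x
    by (simp add: birkhoff_def sum_negf)
  ultimately have low: "AE x in M. \<forall>k::nat. \<exists>K. \<forall>n. - birkhoff h n x \<le> real n * (- c + 1 / Suc k) + K"
    by (simp add: c_def)
  from up low show ?thesis
  proof eventually_elim
    case (elim x)
    have "\<exists>N. \<forall>n\<ge>N. norm (birkhoff h n x / real n - c) < r" if "r > 0" for r
    proof -
      obtain k :: nat where k: "1 / Suc k < r / 2"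
      proof (atomize_elim)
        show "\<exists>k. 1 / real (Suc k) < r / 2"
          using reals_Archimedean[OF half_gt_zero[OF \<open>r > 0\<close>]] by (simp only: inverse_eq_divide)
      qed
      obtain K1 where K1: "\<And>n. birkhoff h n x \<le> real n * (c + 1 / Suc k) + K1" using elim(1) by blast
      obtain K2 where K2: "\<And>n. - birkhoff h n x \<le> real n * (- c + 1 / Suc k) + K2" using elim(2) by blast
      define K where "K = max \<bar>K1\<bar> \<bar>K2\<bar>"
      obtain N :: nat where N: "2 * K / r < real N" using reals_Archimedean2 by blast
      show ?thesis
      proof (intro exI[of _ "Suc N"] allI impI)
        fix n assume n: "n \<ge> Suc N"
        then have pos: "real n > 0" by simp
        have "2 * K / r < real n" using N n by linarith
        then have Kn: "K < real n * (r / 2)" using that by (simp add: field_simps)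
        have "real n * (1 / Suc k) \<le> real n * (r / 2)" using k by (intro mult_left_mono) auto
        moreover have "birkhoff h n x \<le> real n * c + real n * (1 / Suc k) + K1"
          using K1[of n] by (simp only: distrib_left)
        moreover have "- birkhoff h n x \<le> - (real n * c) + real n * (1 / Suc k) + K2"
          using K2[of n] by (simp only: distrib_left mult_minus_right)
        moreover have "K1 \<le> K" "K2 \<le> K" by (auto simp: K_def)
        moreover have "real n * r = 2 * (real n * (r / 2))" by simp
        ultimately have "\<bar>birkhoff h n x - real n * c\<bar> < real n * r"
          using Kn unfolding abs_less_iff by linarith
        then have "\<bar>birkhoff h n x - real n * c\<bar> / real n < r" using pos by (simp add: field_simps)
        moreover have "birkhoff h n x / real n - c = (birkhoff h n x - real n * c) / real n"
          using pos by (simp add: field_simps)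
        ultimately show "norm (birkhoff h n x / real n - c) < r" using pos by simp
      qed
    qed
    then show ?case unfolding c_def[symmetric] by (rule LIMSEQ_I) 
  qed
qed

text \<open>If \<open>B\<close> has positive measure, almost every point visits it with positive
  frequency, which finitely many visits would contradict.\<close>

lemma recurrence:
  assumes B: "B \<in> sets M"
  shows "AE x in M. x \<in> B \<longrightarrow> (\<forall>N. \<exists>n\<ge>N. (T ^^ n) x \<in> B)"
proof (cases "measure M B = 0")
  case True
  then have "B \<in> null_sets M" using B by (auto simp: emeasure_eq_measure)
  then have "AE x in M. x \<notin> B" by (rule AE_not_in)
  then show ?thesis by eventually_elim simp
next
  case False
  have "AE x in M. (\<lambda>n. birkhoff (indicator B) n x / real n) \<longlonglongrightarrow> (\<integral>x. indicator B x \<partial>M)"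
    by (rule birkhoff_ergodic[of _ 1]) (use B in auto)
  moreover have "(\<integral>x. indicator B x \<partial>M) = measure M B"
    using B sets.sets_into_space[OF B] by (simp add: Int_absorb2)
  ultimately have "AE x in M. (\<lambda>n. birkhoff (indicator B) n x / real n) \<longlonglongrightarrow> measure M B" by simp
  then show ?thesis
  proof eventually_elim
    case (elim x)
    have "\<exists>n\<ge>N. (T ^^ n) x \<in> B" for N
    proof (rule ccontr)
      assume "\<not> ?thesis"
      then have no: "(T ^^ n) x \<notin> B" if "n \<ge> N" for n using that by blast
      have le: "birkhoff (indicator B) n x \<le> real N" for n
      proof -
        have "birkhoff (indicator B) n x \<le> (\<Sum>i<n. if i < N then 1 else 0)"
          unfolding birkhoff_def using no by (intro sum_mono) (auto simp: indicator_def not_less)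
        also have "\<dots> = real (card ({..<n} \<inter> {..<N}))" by (simp add: sum.If_cases lessThan_def)
        also have "\<dots> \<le> real N" using card_mono[of "{..<N}" "{..<n} \<inter> {..<N}"] by auto
        finally show ?thesis .
      qed
      have "(\<lambda>n. birkhoff (indicator B) n x / real n) \<longlonglongrightarrow> 0"
      proof (rule tendsto_sandwich)
        show "\<forall>\<^sub>F n in sequentially. 0 \<le> birkhoff (indicator B) n x / real n"
          by (auto simp: birkhoff_def intro!: always_eventually divide_nonneg_nonneg sum_nonneg)
        show "\<forall>\<^sub>F n in sequentially. birkhoff (indicator B) n x / real n \<le> real N / real n"
          using le by (auto intro!: always_eventually divide_right_mono)
        show "(\<lambda>n. real N / real n) \<longlonglongrightarrow> 0" by (rule lim_const_over_n)
      qed auto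
      then have "measure M B = 0" using elim LIMSEQ_unique by blast
      then show False using False by simp
    qed
    then show ?case by blast
  qed
qed

end

section \<open>Generic recurrent points of ergodic measures\<close>

lemma ergodic_measures_generic_point:
  fixes f :: "'a::{t2_space, second_countable_topology} \<Rightarrow> 'a"
  assumes \<mu>: "\<mu> \<in> ergodic_measures f X" and \<Phi>: "finite \<Phi>"
    and cont: "\<And>\<phi>. \<phi> \<in> \<Phi> \<Longrightarrow> continuous_on X \<phi> \<and> bounded (\<phi> ` X)"
  shows "\<exists>x\<in>X. (\<forall>\<phi>\<in>\<Phi>. (\<lambda>n. (\<Sum>i<n. \<phi> ((f ^^ i) x)) / real n) \<longlonglongrightarrow> (\<integral>x. \<phi> x \<partial>\<mu> :: real)) \<and>
    (\<forall>V. open V \<and> x \<in> V \<longrightarrow> (\<forall>N. \<exists>n\<ge>N. (f ^^ n) x \<in> V))"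
proof -
  have sets: "sets \<mu> = sets (restrict_space borel X)" and "prob_space \<mu>"
    using \<mu> by (auto simp: ergodic_measures_def borel_probs_on_def)
  interpret prob_space \<mu> by fact
  interpret ergodic_system \<mu> f
    using \<mu> by unfold_locales (auto simp: ergodic_measures_def)
  have space: "space \<mu> = X" using sets_eq_imp_space_eq[OF sets] by (simp add: space_restrict_space)
  obtain \<B> :: "'a set set" where \<B>: "countable \<B>" "topological_basis \<B>" using ex_countable_basis by blast
  have "AE x in \<mu>. \<forall>\<phi>\<in>\<Phi>. (\<lambda>n. birkhoff \<phi> n x / real n) \<longlonglongrightarrow> (\<integral>x. \<phi> x \<partial>\<mu>)"
  proof (rule AE_finite_allI[OF \<Phi>])
    fix \<phi> assume "\<phi> \<in> \<Phi>"
    from cont[OF this] obtain b where b: "continuous_on X \<phi>" "\<And>x. x \<in> X \<Longrightarrow> \<bar>\<phi> x\<bar> \<le> b"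
      by (auto simp: bounded_iff)
    have "\<phi> \<in> borel_measurable \<mu>"
      using borel_measurable_continuous_on_restrict[OF b(1)] measurable_cong_sets[OF sets refl] by auto
    then show "AE x in \<mu>. (\<lambda>n. birkhoff \<phi> n x / real n) \<longlonglongrightarrow> (\<integral>x. \<phi> x \<partial>\<mu>)"
      using b(2) by (intro birkhoff_ergodic) (auto simp: space)
  qed
  \<comment> \<open>Recurrence to the members of a countable basis yields recurrence to every
    neighbourhood of the point outside one null set.\<close>
  moreover have "AE x in \<mu>. \<forall>V\<in>\<B>. x \<in> V \<inter> X \<longrightarrow> (\<forall>N. \<exists>n\<ge>N. (f ^^ n) x \<in> V \<inter> X)"
  proof (subst AE_ball_countable[OF \<B>(1)], intro ballI recurrence)
    fix V assume "V \<in> \<B>"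
    then have "V \<in> sets borel" using topological_basis_open[OF \<B>(2)] by simp
    then show "V \<inter> X \<in> sets \<mu>" by (auto simp: sets sets_restrict_space Int_commute)
  qed
  ultimately have ae: "AE x in \<mu>. (\<forall>\<phi>\<in>\<Phi>. (\<lambda>n. birkhoff \<phi> n x / real n) \<longlonglongrightarrow> (\<integral>x. \<phi> x \<partial>\<mu>)) \<and>
      (\<forall>V\<in>\<B>. x \<in> V \<inter> X \<longrightarrow> (\<forall>N. \<exists>n\<ge>N. (f ^^ n) x \<in> V \<inter> X))" (is "AE x in \<mu>. ?P x")
    by eventually_elim blast
  have "\<exists>x\<in>space \<mu>. ?P x"
  proof (rule ccontr)
    assume no: "\<not> ?thesis"
    have "AE x in \<mu>. False" using ae by (rule AE_mp) (use no in \<open>auto intro!: AE_I2\<close>)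
    then show False by simp
  qed
  then obtain x where x: "x \<in> X" "?P x" by (auto simp: space)
  have "\<forall>N. \<exists>n\<ge>N. (f ^^ n) x \<in> V" if V: "open V" "x \<in> V" for V
  proof -
    obtain V' where "V' \<in> \<B>" "x \<in> V'" "V' \<subseteq> V" using topological_basisE[OF \<B>(2) V] by metis
    then show ?thesis using x by blast
  qed
  then show ?thesis using x by (auto simp: birkhoff_def)
qed

section \<open>Small balls of the Riemannian distance\<close>

context smooth_manifold
begin

text \<open>The straight segment in the chart is an admissible curve; convexity of the ball keeps it
  where \<open>M\<close> bounds the metric.\<close>

lemma riem_dist_le_in_chart_ball:
  assumes c: "c \<in> A" and ball: "ball z \<delta> \<subseteq> snd c ` fst c" and uw: "u \<in> ball z \<delta>" "w \<in> ball z \<delta>"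
    and M: "\<And>p v. p \<in> chart_inv c ` ball z \<delta> \<Longrightarrow> riem_norm g p (T c p v) \<le> M * norm v"
  shows "riem_dist A g (chart_inv c u) (chart_inv c w) \<le> ennreal (M * norm (w - u))"
proof -
  define l where "l t = u + t *\<^sub>R (w - u)" for t :: real
  define \<gamma> where "\<gamma> t = chart_inv c (l t)" for t
  have l: "l t \<in> ball z \<delta>" if "t \<in> {0..1}" for t
  proof -
    have "l t = (1 - t) *\<^sub>R u + t *\<^sub>R w" by (simp add: l_def algebra_simps)
    then show ?thesis using convexD_alt[OF convex_ball uw, of t] that by simp
  qed
  have l_deriv: "(l has_vector_derivative (w - u)) (at t)" for t
    unfolding l_def by (auto intro!: derivative_eq_intros)
  have l_cont: "continuous_on {0..1} l" unfolding l_def by (intro continuous_intros)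
  have \<gamma>_in: "\<gamma> t \<in> fst c" "snd c (\<gamma> t) = l t" "\<gamma> t \<in> chart_inv c ` ball z \<delta>" if "t \<in> {0..1}" for t
    using l[OF that] ball chart_inv_in[OF c] chart_chart_inv[OF c] by (auto simp: \<gamma>_def subset_iff)
  have \<gamma>_cont: "continuous_on {0..1} \<gamma>"
    unfolding \<gamma>_def using l ball by (intro continuous_on_compose2[OF chart_inv_cont[OF c] l_cont]) auto
  \<comment> \<open>\<open>l\<close> is defined on all of the reals and the chart image is open, so
    two-sided derivatives exist even at \<open>0\<close> and \<open>1\<close>.\<close>
  have deriv: "((snd d \<circ> \<gamma>) has_vector_derivative coord_deriv c d id (\<gamma> t) (w - u)) (at t)"
    if "d \<in> A" "t \<in> {0..1}" "\<gamma> t \<in> fst d" for d t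
  proof -
    have "((snd d \<circ> id \<circ> chart_inv c) has_derivative coord_deriv c d id (\<gamma> t)) (at (l t))"
      using C1_on_chartsD(2)[OF C1_on_charts_id c that(1) \<gamma>_in(1)[OF that(2)]] that \<gamma>_in(2)[OF that(2)] by simp
    from diff_chain_at[OF l_deriv[unfolded has_vector_derivative_def] this] bounded_linear.linear[OF has_derivative_bounded_linear[OF this]]
    have "((snd d \<circ> id \<circ> chart_inv c) \<circ> l has_vector_derivative coord_deriv c d id (\<gamma> t) (w - u)) (at t)"
      by (simp add: has_vector_derivative_def comp_def linear_cmul)
    moreover have "(snd d \<circ> id \<circ> chart_inv c) \<circ> l = snd d \<circ> \<gamma>" by (auto simp: \<gamma>_def)
    ultimately show ?thesis by simp
  qed
  have "C1_curve_on A 0 1 \<gamma>"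
    unfolding C1_curve_on_def
  proof (intro conjI ballI \<gamma>_cont)
    fix d assume d: "d \<in> A"
    show "\<exists>D. continuous_on ({0..1} \<inter> \<gamma> -` fst d) D \<and>
        (\<forall>t \<in> {0..1} \<inter> \<gamma> -` fst d. ((snd d \<circ> \<gamma>) has_vector_derivative D t) (at t within {0..1}))"
    proof (intro exI[of _ "\<lambda>t. coord_deriv c d id (\<gamma> t) (w - u)"] conjI ballI)
      have "continuous_on ({0..1} \<inter> \<gamma> -` fst d) (\<lambda>t. Blinfun (coord_deriv c d id (\<gamma> t)))"
        by (rule continuous_on_compose2[OF C1_on_chartsD(3)[OF C1_on_charts_id c d]])
          (use \<gamma>_in in \<open>auto intro: continuous_on_subset[OF \<gamma>_cont]\<close>)
      then have "continuous_on ({0..1} \<inter> \<gamma> -` fst d) (\<lambda>t. blinfun_apply (Blinfun (coord_deriv c d id (\<gamma> t))) (w - u))"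
        by (intro continuous_intros)
      then show "continuous_on ({0..1} \<inter> \<gamma> -` fst d) (\<lambda>t. coord_deriv c d id (\<gamma> t) (w - u))"
      proof (rule continuous_on_eq)
        fix t assume "t \<in> {0..1} \<inter> \<gamma> -` fst d"
        then have "bounded_linear (coord_deriv c d id (\<gamma> t))"
          using C1_on_chartsD(4)[OF C1_on_charts_id c d] \<gamma>_in(1) by simp
        then show "blinfun_apply (Blinfun (coord_deriv c d id (\<gamma> t))) (w - u) = coord_deriv c d id (\<gamma> t) (w - u)"
          by (simp add: bounded_linear_Blinfun_apply)
      qed
      show "((snd d \<circ> \<gamma>) has_vector_derivative coord_deriv c d id (\<gamma> t) (w - u)) (at t within {0..1})"
        if "t \<in> {0..1} \<inter> \<gamma> -` fst d" for t
        using deriv[OF d, of t] that by (auto intro: has_vector_derivative_at_within)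
    qed
  qed
  then have "piecewise_C1_curve A \<gamma>"
    unfolding piecewise_C1_curve_def by (intro exI[of _ 1] exI[of _ real]) auto
  moreover have "\<gamma> 0 = chart_inv c u" "\<gamma> 1 = chart_inv c w" by (auto simp: \<gamma>_def l_def)
  ultimately have "riem_dist A g (chart_inv c u) (chart_inv c w) \<le> curve_length A g \<gamma>"
    unfolding riem_dist_def by (intro INF_lower) auto
  also have "curve_length A g \<gamma> \<le> (\<integral>\<^sup>+ t\<in>{0..1::real}. ennreal (M * norm (w - u)) \<partial>lborel)"
    unfolding curve_length_def
  proof (intro nn_integral_mono)
    fix t :: real
    have "riem_norm g (\<gamma> t) (vector_derivative (snd (chart_at A (\<gamma> t)) \<circ> \<gamma>) (at t)) \<le> M * norm (w - u)" if "t \<in> {0..1}"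
    proof -
      have "vector_derivative (snd (chart_at A (\<gamma> t)) \<circ> \<gamma>) (at t) = T c (\<gamma> t) (w - u)"
        unfolding T_eq by (rule vector_derivative_at) (rule deriv[OF chart_at(1) that chart_at(2)])
      then show ?thesis using M[OF \<gamma>_in(3)[OF that]] by simp
    qed
    then show "ennreal (riem_norm g (\<gamma> t) (vector_derivative (snd (chart_at A (\<gamma> t)) \<circ> \<gamma>) (at t))) * indicator {0..1} t
        \<le> ennreal (M * norm (w - u)) * indicator {0..1} t"
      by (auto simp: indicator_def intro: ennreal_leI)
  qed
  also have "\<dots> = ennreal (M * norm (w - u))" by (simp add: nn_integral_cmult)
  finally show ?thesis .
qed

lemma riem_dist_small_neighbourhood:
  assumes g: "riemannian_metric A g" and "r > 0"
  shows "\<exists>G. open G \<and> q \<in> G \<and> (\<forall>a\<in>G. \<forall>b\<in>G. riem_dist A g a b \<le> ennreal r)"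
proof -
  obtain c where c: "c \<in> A" "q \<in> fst c" using chart_ex by blast
  obtain s where s: "s > 0" "cball (snd c q) s \<subseteq> snd c ` fst c"
    "compact (chart_inv c ` cball (snd c q) s)" "chart_inv c ` cball (snd c q) s \<subseteq> fst c"
    using compact_chart_neighbourhood[OF c] by metis
  obtain M where M: "M > 0" "\<And>p v. p \<in> chart_inv c ` cball (snd c q) s \<Longrightarrow> riem_norm g p (T c p v) \<le> M * norm v"
    using norm_equivalence[OF g c(1) s(3,4)] by blast
  \<comment> \<open>Two points of the ball are at Euclidean distance at most
    \<open>2 * \<delta>\<close>, and \<open>M\<close> times this is at most
    \<open>r\<close>.\<close>
  define \<delta> where "\<delta> = min s (r / (2 * M))"
  define B where "B = ball (snd c q) \<delta>"
  have \<delta>: "\<delta> > 0" "\<delta> \<le> s" "M * (2 * \<delta>) \<le> r"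
    using s M \<open>r > 0\<close> by (auto simp: \<delta>_def min_def field_simps)
  have Bs: "B \<subseteq> cball (snd c q) s" using \<delta> by (auto simp: B_def)
  have G: "fst c \<inter> snd c -` B = chart_inv c ` B"
  proof (intro set_eqI iffI)
    fix p assume "p \<in> fst c \<inter> snd c -` B"
    then have "p = chart_inv c (snd c p)" "snd c p \<in> B" using chart_inv_chart[OF c(1)] by auto
    then show "p \<in> chart_inv c ` B" by blast
  next
    fix p assume "p \<in> chart_inv c ` B"
    then obtain y where y: "y \<in> B" "p = chart_inv c y" by blast
    then have "y \<in> snd c ` fst c" using Bs s by blast
    then show "p \<in> fst c \<inter> snd c -` B"
      using y chart_inv_in[OF c(1)] chart_chart_inv[OF c(1)] by simp
  qed
  have "open (fst c \<inter> snd c -` B)"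
    using chart_cont[OF c(1)] chart_open[OF c(1)] by (rule continuous_open_preimage) (simp add: B_def)
  moreover have "q \<in> fst c \<inter> snd c -` B" using c \<delta> by (simp add: B_def)
  moreover have "riem_dist A g a b \<le> ennreal r" if ab: "a \<in> chart_inv c ` B" "b \<in> chart_inv c ` B" for a b
  proof -
    obtain u w where uw: "u \<in> B" "w \<in> B" "a = chart_inv c u" "b = chart_inv c w" using ab by blast
    have "riem_dist A g a b \<le> ennreal (M * norm (w - u))"
      unfolding uw
    proof (rule riem_dist_le_in_chart_ball[OF c(1)])
      show "ball (snd c q) \<delta> \<subseteq> snd c ` fst c" using Bs s by (auto simp: B_def)
      show "riem_norm g p (T c p v) \<le> M * norm v" if "p \<in> chart_inv c ` ball (snd c q) \<delta>" for p v
        using that Bs by (intro M(2)) (auto simp: B_def)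
    qed (use uw in \<open>simp_all add: B_def\<close>)
    also have "\<dots> \<le> ennreal r"
    proof (rule ennreal_leI)
      have "dist w u \<le> dist w (snd c q) + dist (snd c q) u" by (rule dist_triangle)
      also have "\<dots> \<le> 2 * \<delta>" using uw by (simp add: B_def dist_commute)
      finally have "M * norm (w - u) \<le> M * (2 * \<delta>)" using M by (simp add: dist_norm)
      then show "M * norm (w - u) \<le> r" using \<delta> by linarith
    qed
    finally show ?thesis .
  qed
  ultimately show ?thesis unfolding G by blast
qed

end

section \<open>Periodic measures and hitting times\<close>

text \<open>\<open>n\<close> may be any period, not only the least one: indices are counted rather
  than points.\<close>

definition orbit_measure :: "('a::topological_space \<Rightarrow> 'a) \<Rightarrow> 'a set \<Rightarrow> nat \<Rightarrow> 'a \<Rightarrow> 'a measure" where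
  "orbit_measure f X n p =
     distr (measure_pmf (pmf_of_set {..<n})) (restrict_space borel X) (\<lambda>i. (f ^^ i) p)"

context
  fixes f :: "'a::topological_space \<Rightarrow> 'a" and X :: "'a set" and n :: nat and p :: 'a
  assumes n: "n \<ge> 1" and per: "(f ^^ n) p = p" and fX: "f ` X \<subseteq> X" and p: "p \<in> X"
begin

lemma orbit_in: "(f ^^ i) p \<in> X"
  using fX p by (induction i) auto

lemma orbit_map_measurable:
  "(\<lambda>i. (f ^^ i) p) \<in> measurable (measure_pmf (pmf_of_set {..<n})) (restrict_space borel X)"
  using orbit_in by (simp add: space_restrict_space)

lemma orbit_measure_borel_prob: "orbit_measure f X n p \<in> borel_probs_on X"
  using measure_pmf.prob_space_distr[OF orbit_map_measurable]
  by (simp add: orbit_measure_def borel_probs_on_def)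

lemma integral_orbit_measure:
  assumes "continuous_on X \<phi>"
  shows "(\<integral>x. \<phi> x \<partial>orbit_measure f X n p) = (\<Sum>i<n. \<phi> ((f ^^ i) p)) / real n"
proof -
  have "(\<integral>x. \<phi> x \<partial>orbit_measure f X n p) = (\<integral>i. \<phi> ((f ^^ i) p) \<partial>measure_pmf (pmf_of_set {..<n}))"
    unfolding orbit_measure_def
    by (rule integral_distr[OF orbit_map_measurable borel_measurable_continuous_on_restrict[OF assms]])
  also have "\<dots> = (\<Sum>i<n. \<phi> ((f ^^ i) p)) / real n"
    using n by (subst integral_pmf_of_set) (auto simp: lessThan_empty_iff)
  finally show ?thesis .
qed

text \<open>Shifting the indices by one modulo \<open>n\<close> permutes them, which gives
  invariance; an invariant set contains all of the orbit or none of it, which gives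
  ergodicity.\<close>

lemma orbit_measure_ergodic:
  assumes cont: "continuous_on UNIV f"
  shows "orbit_measure f X n p \<in> ergodic_measures f X"
proof -
  let ?N = "restrict_space borel X" and ?M = "orbit_measure f X n p"
  have sets: "sets ?M = sets ?N" by (simp add: orbit_measure_def)
  have space: "space ?M = X" by (simp add: orbit_measure_def space_restrict_space)
  have "f \<in> measurable borel borel" using cont by (rule borel_measurable_continuous_onI)
  then have fN: "f \<in> measurable ?N ?N" by (rule measurable_restrict_space3) (use fX in auto)
  then have fM: "f \<in> measurable ?M ?M" using measurable_cong_sets[OF sets sets] by blast
  have "distr ?M ?M f = distr ?M ?N f" by (rule distr_cong) (auto simp: sets)
  also have "\<dots> = distr (measure_pmf (pmf_of_set {..<n})) ?N (f \<circ> (\<lambda>i. (f ^^ i) p))"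
    unfolding orbit_measure_def by (rule distr_distr[OF fN orbit_map_measurable])
  also have "f \<circ> (\<lambda>i. (f ^^ i) p) = (\<lambda>i. (f ^^ i) p) \<circ> (\<lambda>i. Suc i mod n)"
    by (auto simp: fun_eq_iff funpow_mod_eq[OF per])
  also have "distr (measure_pmf (pmf_of_set {..<n})) ?N ((\<lambda>i. (f ^^ i) p) \<circ> (\<lambda>i. Suc i mod n))
      = distr (distr (measure_pmf (pmf_of_set {..<n})) (count_space UNIV) (\<lambda>i. Suc i mod n)) ?N (\<lambda>i. (f ^^ i) p)"
    by (rule distr_distr[symmetric]) (use orbit_in in \<open>auto simp: space_restrict_space\<close>)
  also have "distr (measure_pmf (pmf_of_set {..<n})) (count_space UNIV) (\<lambda>i. Suc i mod n)
      = measure_pmf (map_pmf (\<lambda>i. Suc i mod n) (pmf_of_set {..<n}))"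
    by (rule map_pmf_rep_eq[symmetric])
  also have "map_pmf (\<lambda>i. Suc i mod n) (pmf_of_set {..<n}) = pmf_of_set {..<n}"
  proof (rule map_pmf_of_set_bij_betw)
    have inj: "inj_on (\<lambda>i. Suc i mod n) {..<n}"
    proof (rule inj_onI)
      fix i j assume ij: "i \<in> {..<n}" "j \<in> {..<n}" "Suc i mod n = Suc j mod n"
      then show "i = j" by (auto simp: mod_Suc split: if_splits)
    qed
    moreover have "(\<lambda>i. Suc i mod n) ` {..<n} = {..<n}"
      using n by (intro endo_inj_surj inj) auto
    ultimately show "bij_betw (\<lambda>i. Suc i mod n) {..<n} {..<n}" by (simp add: bij_betw_def)
  qed (use n in \<open>auto simp: lessThan_empty_iff\<close>)
  finally have inv: "distr ?M ?M f = ?M" by (simp add: orbit_measure_def)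
  have erg: "measure ?M B = 0 \<or> measure ?M B = 1" if B: "B \<in> sets ?M" "f -` B \<inter> space ?M = B" for B
  proof -
    have "(f ^^ i) p \<in> B \<longleftrightarrow> p \<in> B" for i
    proof (induction i)
      case (Suc i)
      have "f ((f ^^ i) p) \<in> B \<longleftrightarrow> (f ^^ i) p \<in> B" using B(2) orbit_in[of i] unfolding space by blast
      then show ?case using Suc by simp
    qed simp
    then have "measure ?M B = measure (measure_pmf (pmf_of_set {..<n})) {i. p \<in> B}"
      using B(1) unfolding orbit_measure_def
      by (subst measure_distr[OF orbit_map_measurable]) (auto simp: vimage_def)
    then show ?thesis by (cases "p \<in> B") auto
  qed
  show ?thesis
    using orbit_measure_borel_prob fM inv erg by (simp add: ergodic_measures_def)
qed

end

lemma periodic_nonwandering: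
  assumes "n \<ge> 1" "(f ^^ n) p = p"
  shows "p \<in> nonwandering_set f"
  unfolding nonwandering_set_def
proof (intro CollectI allI impI)
  fix U assume "open U \<and> p \<in> U"
  then have "p \<in> (f ^^ n) ` U \<inter> U" using assms(2) by (auto intro!: image_eqI[of p _ p])
  then show "\<exists>n\<ge>1. (f ^^ n) ` U \<inter> U \<noteq> {}" using assms(1) by blast
qed

lemma periodic_measures_dense:
  fixes A :: "('a::{t2_space, second_countable_topology}, 'b::euclidean_space) chart set"
  assumes mfd: "compact_riemannian_manifold A g" and axA: "axiom_A A g f"
    and sd: "spectral_decomposition f P" and X: "X \<in> P"
    and \<mu>: "\<mu> \<in> ergodic_measures f X" and \<Phi>: "finite \<Phi>"
    and cont: "\<And>\<phi>. \<phi> \<in> \<Phi> \<Longrightarrow> continuous_on X \<phi> \<and> bounded (\<phi> ` X)" and "\<epsilon> > 0"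
  shows "\<exists>n p. n \<ge> 1 \<and> (f ^^ n) p = p \<and> p \<in> X \<and>
    (\<forall>\<phi>\<in>\<Phi>. \<bar>(\<integral>x. \<phi> x \<partial>orbit_measure f X n p) - (\<integral>x. \<phi> x \<partial>\<mu>)\<bar> < (\<epsilon>::real))"
proof -
  have diffeo: "diffeomorphism A f" and hyp: "hyperbolic_set A g f (nonwandering_set f)"
    using axA by (auto simp: axiom_A_def)
  have fP: "finite P" and disj: "pairwise disjnt P" and UP: "\<Union>P = nonwandering_set f"
    and closed: "\<And>Y. Y \<in> P \<Longrightarrow> closed Y" and fX: "f ` X = X"
    using sd X by (auto simp: spectral_decomposition_def)
  define Y where "Y = \<Union>(P - {X})"
  have Y: "closed Y" unfolding Y_def using fP closed by (intro closed_Union) auto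
  have XY: "X \<inter> Y = {}" using disj X by (auto simp: Y_def pairwise_def disjnt_def)
  have "\<exists>G. open G \<and> (\<forall>a. (a, a) \<in> G) \<and> (\<forall>a\<in>X. \<forall>b\<in>X. (a, b) \<in> G \<longrightarrow> \<bar>\<phi> a - \<phi> b\<bar> < \<epsilon> / 2)"
    if "\<phi> \<in> \<Phi>" for \<phi>
  proof -
    have "continuous_on (X \<times> X) (\<lambda>z. \<bar>\<phi> (fst z) - \<phi> (snd z)\<bar>)"
    proof (intro continuous_on_rabs continuous_on_diff)
      have c: "continuous_on X \<phi>" using cont[OF that] by simp
      show "continuous_on (X \<times> X) (\<lambda>z. \<phi> (fst z))"
        by (rule continuous_on_compose2[OF c continuous_on_fst[OF continuous_on_id]]) auto
      show "continuous_on (X \<times> X) (\<lambda>z. \<phi> (snd z))"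
        by (rule continuous_on_compose2[OF c continuous_on_snd[OF continuous_on_id]]) auto
    qed
    moreover have "open {..<\<epsilon> / 2}" by simp
    ultimately obtain G where G: "open G"
      "G \<inter> (X \<times> X) = (\<lambda>z. \<bar>\<phi> (fst z) - \<phi> (snd z)\<bar>) -` {..<\<epsilon> / 2} \<inter> (X \<times> X)"
      unfolding continuous_on_open_invariant by blast
    \<comment> \<open>The test function is continuous on \<open>X\<close> only. Adding all pairs
      outside \<open>X \<times> X\<close>, open because \<open>X\<close> is closed, makes the set
      contain the whole diagonal.\<close>
    have "open (- (X \<times> X))" using closed[OF X] by (intro open_Compl closed_Times)
    moreover have "(a, a) \<in> G \<union> - (X \<times> X)" for a
      using G(2) \<open>\<epsilon> > 0\<close> by (cases "a \<in> X") auto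
    moreover have "\<bar>\<phi> a - \<phi> b\<bar> < \<epsilon> / 2" if "a \<in> X" "b \<in> X" "(a, b) \<in> G \<union> - (X \<times> X)" for a b
    proof -
      have "(a, b) \<in> G \<inter> (X \<times> X)" using that by auto
      then show ?thesis unfolding G(2) by simp
    qed
    ultimately show ?thesis using G(1) by (intro exI[of _ "G \<union> - (X \<times> X)"]) auto
  qed
  then obtain G where G0: "\<And>\<phi>. \<phi> \<in> \<Phi> \<Longrightarrow> open (G \<phi>) \<and> (\<forall>a. (a, a) \<in> G \<phi>) \<and>
      (\<forall>a\<in>X. \<forall>b\<in>X. (a, b) \<in> G \<phi> \<longrightarrow> \<bar>\<phi> a - \<phi> b\<bar> < \<epsilon> / 2)" by metis
  have G: "\<And>\<phi>. \<phi> \<in> \<Phi> \<Longrightarrow> open (G \<phi>)" "\<And>\<phi> a. \<phi> \<in> \<Phi> \<Longrightarrow> (a, a) \<in> G \<phi>"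
    "\<And>\<phi> a b. \<phi> \<in> \<Phi> \<Longrightarrow> a \<in> X \<Longrightarrow> b \<in> X \<Longrightarrow> (a, b) \<in> G \<phi> \<Longrightarrow> \<bar>\<phi> a - \<phi> b\<bar> < \<epsilon> / 2"
    using G0 by blast+
  \<comment> \<open>Removing \<open>Y \<times> X\<close> forces a periodic point that shadows
    \<open>x\<close> out of the other basic sets; it avoids the diagonal since \<open>X\<close> and
    \<open>Y\<close> are disjoint.\<close>
  define W where "W = - (Y \<times> X) \<inter> (\<Inter>\<phi>\<in>\<Phi>. G \<phi>)"
  have W: "open W" "\<And>a. (a, a) \<in> W"
    unfolding W_def using Y closed[OF X] \<Phi> G XY
    by (auto intro!: open_Int open_Compl closed_Times open_INT)
  obtain x where x: "x \<in> X"
    and conv: "\<forall>\<phi>\<in>\<Phi>. (\<lambda>n. (\<Sum>i<n. \<phi> ((f ^^ i) x)) / real n) \<longlonglongrightarrow> (\<integral>x. \<phi> x \<partial>\<mu>)"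
    and rec: "\<forall>V. open V \<and> x \<in> V \<longrightarrow> (\<forall>N. \<exists>n\<ge>N. (f ^^ n) x \<in> V)"
    using ergodic_measures_generic_point[OF \<mu> \<Phi> cont] by blast
  have "x \<in> nonwandering_set f" using x X UP by blast
  from closing_lemma[OF mfd diffeo hyp this W] obtain V n0 where V: "open V" "x \<in> V"
    "\<And>n. n \<ge> n0 \<Longrightarrow> (f ^^ n) x \<in> V \<Longrightarrow> \<exists>p. (f ^^ n) p = p \<and> (\<forall>i<n. ((f ^^ i) p, (f ^^ i) x) \<in> W)"
    by blast
  have "\<forall>\<^sub>F n in sequentially. \<forall>\<phi>\<in>\<Phi>. \<bar>(\<Sum>i<n. \<phi> ((f ^^ i) x)) / real n - (\<integral>x. \<phi> x \<partial>\<mu>)\<bar> < \<epsilon> / 2"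
  proof (rule eventually_ball_finite[OF \<Phi>], rule ballI)
    fix \<phi> assume "\<phi> \<in> \<Phi>"
    from tendstoD[OF bspec[OF conv this], of "\<epsilon> / 2"] \<open>\<epsilon> > 0\<close>
    show "\<forall>\<^sub>F n in sequentially. \<bar>(\<Sum>i<n. \<phi> ((f ^^ i) x)) / real n - (\<integral>x. \<phi> x \<partial>\<mu>)\<bar> < \<epsilon> / 2"
      by (simp add: dist_real_def)
  qed
  then obtain n1 where n1: "\<And>n \<phi>. n \<ge> n1 \<Longrightarrow> \<phi> \<in> \<Phi> \<Longrightarrow>
      \<bar>(\<Sum>i<n. \<phi> ((f ^^ i) x)) / real n - (\<integral>x. \<phi> x \<partial>\<mu>)\<bar> < \<epsilon> / 2"
    by (auto simp: eventually_sequentially)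
  obtain n where n: "n \<ge> max (max n0 n1) 1" "(f ^^ n) x \<in> V" using rec V(1,2) by blast
  then obtain p where p: "(f ^^ n) p = p" "\<And>i. i < n \<Longrightarrow> ((f ^^ i) p, (f ^^ i) x) \<in> W"
    using V(3)[of n] by auto
  have n_pos: "n \<ge> 1" using n by simp
  have "p \<in> \<Union>P" using periodic_nonwandering[OF n_pos p(1)] UP by simp
  moreover have "p \<notin> Y" using p(2)[of 0] n_pos x by (auto simp: W_def)
  ultimately have pX: "p \<in> X" by (auto simp: Y_def)
  have orb: "(f ^^ i) q \<in> X" if "q \<in> X" for i q using that fX by (induction i) auto
  have "\<bar>(\<integral>x. \<phi> x \<partial>orbit_measure f X n p) - (\<integral>x. \<phi> x \<partial>\<mu>)\<bar> < \<epsilon>" if \<phi>: "\<phi> \<in> \<Phi>" for \<phi>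
  proof -
    have int: "(\<integral>x. \<phi> x \<partial>orbit_measure f X n p) = (\<Sum>i<n. \<phi> ((f ^^ i) p)) / real n"
      using cont[OF \<phi>] fX by (intro integral_orbit_measure n_pos p(1) pX) auto
    have "\<bar>(\<Sum>i<n. \<phi> ((f ^^ i) p)) - (\<Sum>i<n. \<phi> ((f ^^ i) x))\<bar> \<le> (\<Sum>i<n. \<bar>\<phi> ((f ^^ i) p) - \<phi> ((f ^^ i) x)\<bar>)"
      unfolding sum_subtractf[symmetric] by (rule sum_abs)
    also have "\<dots> \<le> (\<Sum>i<n. \<epsilon> / 2)"
      using G(3)[OF \<phi> orb[OF pX] orb[OF x]] p(2) \<phi> by (intro sum_mono) (auto simp: W_def intro: less_imp_le)
    finally have "\<bar>(\<Sum>i<n. \<phi> ((f ^^ i) p)) - (\<Sum>i<n. \<phi> ((f ^^ i) x))\<bar> \<le> real n * (\<epsilon> / 2)" by simp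
    then have "\<bar>(\<Sum>i<n. \<phi> ((f ^^ i) p)) - (\<Sum>i<n. \<phi> ((f ^^ i) x))\<bar> / real n \<le> \<epsilon> / 2"
      using n_pos by (simp add: pos_divide_le_eq mult.commute)
    then have "\<bar>(\<Sum>i<n. \<phi> ((f ^^ i) p)) / real n - (\<Sum>i<n. \<phi> ((f ^^ i) x)) / real n\<bar> \<le> \<epsilon> / 2"
      by (simp add: diff_divide_distrib[symmetric])
    then show ?thesis using n1[of n \<phi>] n \<phi> unfolding int by linarith
  qed
  then show ?thesis using n_pos p(1) pX by blast
qed

section \<open>Basic neighbourhoods in the weak topology\<close>

lemma weak_topology_basic:
  assumes "openin (weak_topology X) W" "\<mu> \<in> W"
  shows "\<exists>\<Phi> \<epsilon>. finite \<Phi> \<and> \<epsilon> > 0 \<and> (\<forall>\<phi>\<in>\<Phi>. continuous_on X \<phi> \<and> bounded (\<phi> ` X)) \<and>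
    (\<forall>\<nu>\<in>borel_probs_on X. (\<forall>\<phi>\<in>\<Phi>. \<bar>(\<integral>x. \<phi> x \<partial>\<nu>) - (\<integral>x. \<phi> x \<partial>\<mu>)\<bar> < (\<epsilon>::real)) \<longrightarrow> \<nu> \<in> W)"
proof -
  define nb where "nb \<Phi> \<epsilon> O' \<longleftrightarrow>
    finite \<Phi> \<and> \<epsilon> > 0 \<and> (\<forall>\<phi>\<in>\<Phi>. continuous_on X \<phi> \<and> bounded (\<phi> ` X)) \<and>
    (\<forall>\<nu>\<in>borel_probs_on X. (\<forall>\<phi>\<in>\<Phi>. \<bar>(\<integral>x. \<phi> x \<partial>\<nu>) - (\<integral>x. \<phi> x \<partial>\<mu>)\<bar> < (\<epsilon>::real)) \<longrightarrow> \<nu> \<in> O')"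
    for \<Phi> \<epsilon> O'
  have "generate_topology_on {{\<mu> \<in> borel_probs_on X. (\<integral>x. \<phi> x \<partial>\<mu>) \<in> W} | (\<phi> :: 'a \<Rightarrow> real) W.
        continuous_on X \<phi> \<and> bounded (\<phi> ` X) \<and> open W} W"
    using assms(1) by (simp add: weak_topology_def openin_topology_generated_by_iff)
  then have "\<exists>\<Phi> \<epsilon>. nb \<Phi> \<epsilon> W" using assms(2)
  proof (induction rule: generate_topology_on.induct)
    case Empty
    then show ?case by simp
  next
    case (Int a b)
    have ab: "\<mu> \<in> a" "\<mu> \<in> b" using Int.prems by auto
    obtain \<Phi>1 \<epsilon>1 where 1: "nb \<Phi>1 \<epsilon>1 a" using Int.IH(1)[OF ab(1)] by blast
    obtain \<Phi>2 \<epsilon>2 where 2: "nb \<Phi>2 \<epsilon>2 b" using Int.IH(2)[OF ab(2)] by blast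
    have "nb (\<Phi>1 \<union> \<Phi>2) (min \<epsilon>1 \<epsilon>2) (a \<inter> b)" using 1 2 by (auto simp: nb_def)
    then show ?case by blast
  next
    case (UN K)
    then obtain k where k: "k \<in> K" "\<mu> \<in> k" by blast
    obtain \<Phi> \<epsilon> where "nb \<Phi> \<epsilon> k" using UN.IH[OF k] by blast
    then have "nb \<Phi> \<epsilon> (\<Union>K)" using k(1) by (auto simp: nb_def)
    then show ?case by blast
  next
    case (Basis s)
    then obtain \<phi> :: "'a \<Rightarrow> real" and O' where s: "s = {\<mu> \<in> borel_probs_on X. (\<integral>x. \<phi> x \<partial>\<mu>) \<in> O'}"
      "continuous_on X \<phi>" "bounded (\<phi> ` X)" "open O'" by blast
    have "(\<integral>x. \<phi> x \<partial>\<mu>) \<in> O'" using Basis.prems by (simp add: s(1))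
    then obtain e where e: "e > 0" "ball (\<integral>x. \<phi> x \<partial>\<mu>) e \<subseteq> O'"
      using s(4) by (auto simp: open_contains_ball)
    have "nb {\<phi>} e s"
      using e s by (auto simp: nb_def dist_real_def abs_minus_commute subset_iff)
    then show ?case by blast
  qed
  then show ?thesis by (simp only: nb_def)
qed

text \<open>Witnesses one scale \<open>r \<le> 1 / Suc k\<close> at which the quotient in
  \<open>lower_R\<close> is at most \<open>1 / Suc k\<close>. The bound \<open>n\<close> is kept
  separate from the hitting time \<open>j\<close> so that the period can serve for all pairs of
  points.\<close>

definition fast_hitting :: "('a \<Rightarrow> 'a \<Rightarrow> ennreal) \<Rightarrow> ('a \<Rightarrow> 'a) \<Rightarrow> nat \<Rightarrow> 'a \<Rightarrow> 'a \<Rightarrow> bool" where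
  "fast_hitting d f k x y \<longleftrightarrow> (\<exists>r n. 0 < r \<and> r < 1 \<and> r \<le> 1 / Suc k \<and> n \<ge> 1 \<and>
     ln (real n) \<le> - ln r / Suc k \<and> (\<exists>j. 1 \<le> j \<and> j \<le> n \<and> d y ((f ^^ j) x) \<le> ennreal r))"

text \<open>A limit inferior only needs some radii tending to \<open>0\<close>, so infinitely many
  good \<open>k\<close> suffice; the quotient is non-negative for \<open>r < 1\<close> because
  hitting times are at least \<open>1\<close>.\<close>

lemma lower_R_eq_0:
  assumes "\<And>K. \<exists>k\<ge>K. fast_hitting d f k x y"
  shows "lower_R d f x y = 0"
proof -
  define v where "v r = ln_enat (hitting_time d f r x y) / ereal (- ln r)" for r
  have pos: "hitting_time d f r x y \<ge> 1" for r
    unfolding hitting_time_def by (rule INF_greatest) (auto simp: one_enat_def)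
  have "0 \<le> v r" if "0 < r" "r < 1" for r
  proof -
    have "0 \<le> ln_enat (hitting_time d f r x y)"
      using pos[of r] by (cases "hitting_time d f r x y") (auto simp: ln_enat_def one_enat_def)
    then show ?thesis unfolding v_def using that by (intro zero_le_divide_ereal) auto
  qed
  then have "\<forall>\<^sub>F r in at_right 0. 0 \<le> v r"
    unfolding eventually_at_right_field by (intro exI[of _ 1]) auto
  then have low: "0 \<le> Liminf (at_right 0) v" by (rule Liminf_bounded)
  have "\<not> 0 < Liminf (at_right 0) v"
  proof
    assume "0 < Liminf (at_right 0) v"
    then obtain e where e: "0 < ereal e" "ereal e < Liminf (at_right 0) v" using ereal_dense2 by blast
    from less_LiminfD[OF e(2)] obtain b where b: "b > 0" "\<And>r. 0 < r \<Longrightarrow> r < b \<Longrightarrow> ereal e < v r"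
      unfolding eventually_at_right_field by blast
    have "min e b > 0" using e b by simp
    then obtain K where K: "inverse (real (Suc K)) < min e b" using reals_Archimedean by blast
    obtain k where k: "k \<ge> K" "fast_hitting d f k x y" using assms by blast
    have "1 / real (Suc k) \<le> 1 / real (Suc K)" using k(1) by (intro divide_left_mono) auto
    then have ke: "1 / real (Suc k) < e" "1 / real (Suc k) < b" using K by (auto simp: inverse_eq_divide)
    obtain r n j where r: "0 < r" "r < 1" "r \<le> 1 / Suc k" "n \<ge> 1" "ln (real n) \<le> - ln r / Suc k"
      "1 \<le> j" "j \<le> n" "d y ((f ^^ j) x) \<le> ennreal r" using k(2) unfolding fast_hitting_def by blast
    have "hitting_time d f r x y \<le> enat j"
      unfolding hitting_time_def using r by (intro INF_lower) auto
    then obtain m where m: "hitting_time d f r x y = enat m" "m \<le> n" "m \<ge> 1"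
      using r(7) pos[of r] by (cases "hitting_time d f r x y") (auto simp: one_enat_def)
    have L: "- ln r > 0" using r by simp
    have "ln (real m) \<le> - ln r / Suc k" using m r by (intro order_trans[OF _ r(5)]) simp
    then have "ln (real m) / (- ln r) \<le> 1 / Suc k" using L by (simp add: field_simps)
    moreover have "v r = ereal (ln (real m) / (- ln r))" using L by (simp add: v_def m ln_enat_def)
    ultimately have "v r < ereal e" using ke by simp
    moreover have "ereal e < v r" using b(2)[of r] r ke by simp
    ultimately show False by simp
  qed
  then show ?thesis using low unfolding lower_R_def v_def[symmetric] by (simp add: order_antisym not_less)
qed

lemma periodic_orbit_fast_hitting:
  fixes f :: "'a::topological_space \<Rightarrow> 'a"
  assumes small: "\<And>r q. r > 0 \<Longrightarrow> \<exists>G. open G \<and> q \<in> G \<and> (\<forall>a\<in>G. \<forall>b\<in>G. d a b \<le> ennreal r)"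
    and cont: "\<And>k. continuous_on UNIV (f ^^ k)" and n: "n \<ge> 1" and per: "(f ^^ n) p = p"
  shows "\<exists>V. open V \<and> (\<forall>i. (f ^^ i) p \<in> V) \<and> (\<forall>x\<in>V. \<forall>y\<in>V. fast_hitting d f k x y)"
proof -
  \<comment> \<open>Chosen so that \<open>- ln r / Suc k = ln (real n) + 1\<close>. The summand
    \<open>1\<close> gives \<open>r < 1\<close> and \<open>r \<le> 1 / Suc k\<close> even for a
    fixed point.\<close>
  define L where "L = real (Suc k) * (ln (real n) + 1)"
  define r where "r = exp (- L)"
  have ln: "ln (real n) \<ge> 0" using n by simp
  have L: "L \<ge> real (Suc k)" unfolding L_def using ln by (simp add: mult_le_cancel_left1)
  have "exp L \<ge> real (Suc k)" using L exp_ge_add_one_self[of L] by linarith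
  then have r: "0 < r" "r < 1" "r \<le> 1 / Suc k"
    using L by (auto simp: r_def exp_minus field_simps)
  have lnr: "ln (real n) \<le> - ln r / Suc k" by (simp add: r_def L_def)
  obtain G where G: "\<And>q. open (G q)" "\<And>q. q \<in> G q" "\<And>q a b. a \<in> G q \<Longrightarrow> b \<in> G q \<Longrightarrow> d a b \<le> ennreal r"
    using small[OF r(1)] by metis
  \<comment> \<open>The points that follow the periodic orbit from some phase \<open>i\<close>
    through time \<open>n\<close>; this lets any phase be reached within \<open>n\<close>
    steps.\<close>
  define V where "V = (\<Union>i<n. \<Inter>j\<in>{..n}. (f ^^ j) -` G ((f ^^ (i + j)) p))"
  have "open V" unfolding V_def
    by (intro open_UN open_INT ballI finite_atMost open_vimage G(1) cont)
  moreover have "(f ^^ i) p \<in> V" for i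
  proof -
    have "(f ^^ j) ((f ^^ (i mod n)) p) = (f ^^ (i mod n + j)) p" for j
      by (simp add: funpow_add add.commute[of "i mod n" j])
    then have "(f ^^ (i mod n)) p \<in> V"
      unfolding V_def using n G(2) by (intro UN_I[of "i mod n"]) auto
    then show ?thesis by (simp add: funpow_mod_eq[OF per])
  qed
  moreover have "fast_hitting d f k x y" if xy: "x \<in> V" "y \<in> V" for x y
  proof -
    obtain i where i: "i < n" "\<And>j. j \<le> n \<Longrightarrow> (f ^^ j) x \<in> G ((f ^^ (i + j)) p)" using xy(1) by (auto simp: V_def)
    obtain i' where i': "i' < n" "\<And>j. j \<le> n \<Longrightarrow> (f ^^ j) y \<in> G ((f ^^ (i' + j)) p)" using xy(2) by (auto simp: V_def)
    \<comment> \<open>Hitting times start at \<open>1\<close>, so two points with the same phase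
      have to wait a full period.\<close>
    define j where "j = (if i < i' then i' - i else n + i' - i)"
    have j: "1 \<le> j" "j \<le> n" "(i + j) mod n = i'" using i i' by (auto simp: j_def)
    have "(f ^^ (i + j)) p = (f ^^ i') p" using funpow_mod_eq[OF per, of "i + j"] j(3) by simp
    then have "(f ^^ j) x \<in> G ((f ^^ i') p)" using i(2)[OF j(2)] by simp
    moreover have "y \<in> G ((f ^^ i') p)" using i'(2)[of 0] by simp
    ultimately have "d y ((f ^^ j) x) \<le> ennreal r" using G(3) by blast
    then show ?thesis unfolding fast_hitting_def using r lnr n j(1,2) by blast
  qed
  ultimately show ?thesis by blast
qed

section \<open>Cutoff functions and almost sure statements\<close>

lemma urysohn_cutoff:
  fixes S V :: "'a::t2_space set"
  assumes "compact (UNIV :: 'a set)" "closed S" "open V" "S \<subseteq> V"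
  obtains \<phi> :: "'a \<Rightarrow> real" where "continuous_on UNIV \<phi>" "\<And>x. \<phi> x \<in> {0..1}"
    "\<And>x. x \<in> S \<Longrightarrow> \<phi> x = 1" "\<And>x. x \<notin> V \<Longrightarrow> \<phi> x = 0"
proof -
  have "compact_space (euclidean :: 'a topology)" using assms(1) by (simp add: compact_space_def)
  moreover have "Hausdorff_space (euclidean :: 'a topology)"
    unfolding Hausdorff_space_def disjnt_def using hausdorff by auto
  ultimately have "normal_space (euclidean :: 'a topology)"
    by (intro compact_Hausdorff_or_regular_imp_normal_space) auto
  from Urysohn_lemma[OF this, of "- V" S 0 1] assms obtain \<phi> where
    "continuous_map euclidean (top_of_set {0..1::real}) \<phi>" "\<phi> ` (- V) \<subseteq> {0}" "\<phi> ` S \<subseteq> {1}"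
    by (auto simp: disjnt_def)
  then show thesis
    by (intro that[of \<phi>]) (auto simp: continuous_map_in_subtopology image_subset_iff)
qed

text \<open>The argument uses a null set covering the exceptions, so \<open>{x. P x}\<close> itself
  may be non-measurable.\<close>

lemma AE_pair_both:
  assumes "prob_space M" "AE x in M. P x"
  shows "AE (x, y) in M \<Otimes>\<^sub>M M. P x \<and> P y"
proof -
  interpret prob_space M by fact
  obtain N where N: "N \<in> null_sets M" "{x \<in> space M. \<not> P x} \<subseteq> N"
    using assms(2) by (auto simp: eventually_ae_filter)
  have "N \<times> space M \<union> space M \<times> N \<in> null_sets (M \<Otimes>\<^sub>M M)"
    using null_setsD1[OF N(1)] null_setsD2[OF N(1)]
    by (intro null_sets.Un null_setsI) (auto simp: emeasure_pair_measure_Times)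
  moreover have "{z \<in> space (M \<Otimes>\<^sub>M M). \<not> (case z of (x, y) \<Rightarrow> P x \<and> P y)} \<subseteq> N \<times> space M \<union> space M \<times> N"
    using N(2) by (auto simp: space_pair_measure)
  ultimately show ?thesis unfolding eventually_ae_filter by blast
qed

text \<open>Each cutoff lies below the indicator of \<open>V k\<close>, so the complements have
  summable measure and Borel-Cantelli applies.\<close>

lemma AE_eventually_in:
  assumes \<nu>: "\<nu> \<in> borel_probs_on X" and V: "\<And>k. open (V k)"
    and \<phi>: "\<And>k. continuous_on X (\<phi> k)" "\<And>k x. \<phi> k x \<in> {0..1}" "\<And>k x. x \<notin> V k \<Longrightarrow> \<phi> k x = (0::real)"
    and int: "\<And>k. (\<integral>x. \<phi> k x \<partial>\<nu>) > 1 - (1 / 2) ^ k"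
  shows "AE x in \<nu>. \<forall>\<^sub>F k in sequentially. x \<in> V k"
proof -
  have sets: "sets \<nu> = sets (restrict_space borel X)" and "prob_space \<nu>"
    using \<nu> by (auto simp: borel_probs_on_def)
  interpret prob_space \<nu> by fact
  have space: "space \<nu> = X" using sets_eq_imp_space_eq[OF sets] by (simp add: space_restrict_space)
  have VX: "V k \<inter> X \<in> sets \<nu>" for k using V[of k] by (auto simp: sets sets_restrict_space Int_commute)
  define B where "B k = X - V k" for k
  have B_meas: "B k \<in> sets \<nu>" for k
  proof -
    have "B k = space \<nu> - (V k \<inter> X)" by (auto simp: B_def space)
    then show ?thesis using VX by auto
  qed
  have small: "measure \<nu> (B k) \<le> (1 / 2) ^ k" for k
  proof -
    have "\<phi> k \<in> borel_measurable \<nu>"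
      using borel_measurable_continuous_on_restrict[OF \<phi>(1)[of k]] measurable_cong_sets[OF sets refl] by auto
    then have "integrable \<nu> (\<phi> k)" using \<phi>(2)[of k]
      by (intro integrable_const_bound[of _ 1]) (auto intro!: AE_I2)
    moreover have "integrable \<nu> (indicator (V k \<inter> X) :: _ \<Rightarrow> real)" using VX by (intro integrable_real_indicator) (auto simp: emeasure_eq_measure)
    ultimately have "(\<integral>x. \<phi> k x \<partial>\<nu>) \<le> (\<integral>x. indicator (V k \<inter> X) x \<partial>\<nu>)"
    proof (rule integral_mono)
      fix x assume "x \<in> space \<nu>"
      then show "\<phi> k x \<le> indicator (V k \<inter> X) x"
        using \<phi>(2)[of k x] \<phi>(3)[of x k] by (auto simp: indicator_def space)
    qed
    also have "\<dots> = measure \<nu> (V k \<inter> X)" using VX space by simp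
    also have "\<dots> = 1 - measure \<nu> (B k)"
      using prob_compl[OF VX, of k] by (simp add: B_def space Diff_Int)
    finally show ?thesis using int[of k] by simp
  qed
  have "summable (\<lambda>k. measure \<nu> (B k))"
    by (rule summable_comparison_test[of _ "\<lambda>k. (1 / 2) ^ k"]) (use small in \<open>auto simp: summable_geometric\<close>)
  from borel_cantelli_AE1[OF B_meas _ this]
  have "AE x in \<nu>. \<forall>\<^sub>F k in sequentially. x \<in> space \<nu> - B k" by (simp add: emeasure_eq_measure)
  then show ?thesis
  proof eventually_elim
    case (elim x)
    then show ?case by eventually_elim (simp add: B_def space)
  qed
qed

theorem theorem1p2:
  fixes A :: "('a::{t2_space, second_countable_topology}, 'b::euclidean_space) chart set"
    and g :: "'a \<Rightarrow> 'b \<Rightarrow> 'b \<Rightarrow> real"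
    and f :: "'a \<Rightarrow> 'a"
    and P :: "'a set set"
    and X :: "'a set"
  assumes "compact_riemannian_manifold A g"
    and "axiom_A A g f"
    and "spectral_decomposition f P"
    and "X \<in> P"
    and "topologically_transitive_on f X"
  shows "residual_in (subtopology (weak_topology X) (ergodic_measures f X))
    {\<mu> \<in> ergodic_measures f X.
       AE (x, y) in \<mu> \<Otimes>\<^sub>M \<mu>. lower_R (riem_dist A g) f x y = 0}"
proof -
  interpret smooth_manifold A
    using assms(1) by unfold_locales (simp add: compact_riemannian_manifold_def)
  have cpt: "compact (UNIV :: 'a set)" and g: "riemannian_metric A g"
    using assms(1) by (auto simp: compact_riemannian_manifold_def)
  have f: "C1_on_charts A f"
    using assms(2) C1_map_imp_C1_on_charts by (auto simp: axiom_A_def diffeomorphism_def)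
  have contf: "continuous_on UNIV (f ^^ k)" for k
    using C1_on_chartsD(1)[OF C1_on_charts_funpow[OF f] chart_at(1) chart_at(1)] .
  have fX: "f ` X = X" using assms(3,4) by (auto simp: spectral_decomposition_def)
  define E where "E = ergodic_measures f X"
  define d where "d = riem_dist A g"
  define S where "S = subtopology (weak_topology X) E"
  have EB: "E \<subseteq> borel_probs_on X" by (auto simp: E_def ergodic_measures_def)
  have weak_basic: "openin (weak_topology X) {\<mu> \<in> borel_probs_on X. (\<integral>x. \<phi> x \<partial>\<mu>) \<in> W}"
    if "continuous_on X \<phi>" "bounded (\<phi> ` X)" "open W" for \<phi> :: "'a \<Rightarrow> real" and W
    unfolding weak_topology_def by (rule topology_generated_by_Basis) (use that in blast)
  \<comment> \<open>The zero function with the unrestricted condition \<open>UNIV\<close> shows that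
    the generated topology lives on all of \<open>borel_probs_on X\<close>.\<close>
  have "{\<mu> \<in> borel_probs_on X. (\<integral>x. (0::real) \<partial>\<mu>) \<in> UNIV} \<subseteq> topspace (weak_topology X)"
    by (rule openin_subset, rule weak_basic) (auto simp: bounded_iff)
  then have topS: "topspace S = E" using EB by (auto simp: S_def)
  define cutoff where "cutoff k V \<phi> \<longleftrightarrow> open V \<and> (\<forall>x\<in>V. \<forall>y\<in>V. fast_hitting d f k x y) \<and>
      continuous_on X \<phi> \<and> (\<forall>x. \<phi> x \<in> {0..1::real}) \<and> (\<forall>x. x \<notin> V \<longrightarrow> \<phi> x = 0)" for k V \<phi>
  \<comment> \<open>\<open>V\<close> and \<open>\<phi>\<close> may vary with the measure: openness
    needs one witness at a time, and density supplies a witness adapted to each periodic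
    orbit.\<close>
  define U where "U k = {\<nu> \<in> E. \<exists>V \<phi>. cutoff k V \<phi> \<and> (\<integral>x. \<phi> x \<partial>\<nu>) > 1 - (1 / 2) ^ k}" for k
  have openU: "openin S (U k)" for k
  proof (subst openin_subopen, intro ballI)
    fix \<nu> assume "\<nu> \<in> U k"
    then obtain V \<phi> where *: "\<nu> \<in> E" "cutoff k V \<phi>" "(\<integral>x. \<phi> x \<partial>\<nu>) > 1 - (1 / 2) ^ k"
      unfolding U_def by blast
    let ?O = "{\<mu> \<in> borel_probs_on X. (\<integral>x. \<phi> x \<partial>\<mu>) \<in> {1 - (1 / 2) ^ k<..}}"
    have "bounded (\<phi> ` X)" using *(2) by (auto simp: cutoff_def bounded_iff intro!: exI[of _ 1])
    then have "openin (weak_topology X) ?O" using *(2) by (intro weak_basic) (auto simp: cutoff_def)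
    then have "openin S (E \<inter> ?O)" unfolding S_def by (rule openin_subtopology_Int2)
    moreover have "\<nu> \<in> E \<inter> ?O" using * EB by auto
    moreover have "E \<inter> ?O \<subseteq> U k" using *(2) unfolding U_def by auto
    ultimately show "\<exists>T. openin S T \<and> \<nu> \<in> T \<and> T \<subseteq> U k" by blast
  qed
  have denseU: "S closure_of (U k) = topspace S" for k
    unfolding dense_intersects_open
  proof (intro allI impI, elim conjE)
    fix T assume T: "openin S T" "T \<noteq> {}"
    then obtain W where W: "openin (weak_topology X) W" "T = W \<inter> E" by (auto simp: S_def openin_subtopology)
    obtain \<mu> where \<mu>: "\<mu> \<in> W" "\<mu> \<in> E" using T W by blast
    from weak_topology_basic[OF W(1) \<mu>(1)] obtain \<Phi> \<epsilon> where \<Phi>: "finite \<Phi>" "\<epsilon> > 0"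
      "\<And>\<phi>. \<phi> \<in> \<Phi> \<Longrightarrow> continuous_on X \<phi> \<and> bounded (\<phi> ` X)"
      "\<And>\<nu>. \<nu> \<in> borel_probs_on X \<Longrightarrow> (\<forall>\<phi>\<in>\<Phi>. \<bar>(\<integral>x. \<phi> x \<partial>\<nu>) - (\<integral>x. \<phi> x \<partial>\<mu>)\<bar> < (\<epsilon>::real)) \<Longrightarrow> \<nu> \<in> W"
      by blast
    obtain n p where p: "n \<ge> 1" "(f ^^ n) p = p" "p \<in> X"
      "\<forall>\<phi>\<in>\<Phi>. \<bar>(\<integral>x. \<phi> x \<partial>orbit_measure f X n p) - (\<integral>x. \<phi> x \<partial>\<mu>)\<bar> < \<epsilon>"
      using periodic_measures_dense[OF assms(1-4) \<mu>(2)[unfolded E_def] \<Phi>(1,3,2)] by blast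
    let ?\<nu> = "orbit_measure f X n p"
    have fX': "f ` X \<subseteq> X" using fX by simp
    have \<nu>E: "?\<nu> \<in> E"
      unfolding E_def by (rule orbit_measure_ergodic[OF p(1,2) fX' p(3)]) (use contf[of 1] in simp)
    have \<nu>W: "?\<nu> \<in> W" using \<Phi>(4) p(4) \<nu>E EB by blast
    have "\<exists>V. open V \<and> (\<forall>i. (f ^^ i) p \<in> V) \<and> (\<forall>x\<in>V. \<forall>y\<in>V. fast_hitting d f k x y)"
      unfolding d_def
      by (rule periodic_orbit_fast_hitting[OF riem_dist_small_neighbourhood[OF g] contf p(1,2)])
    then obtain V where V: "open V" "\<And>i. (f ^^ i) p \<in> V" "\<forall>x\<in>V. \<forall>y\<in>V. fast_hitting d f k x y" by blast
    obtain \<phi> :: "'a \<Rightarrow> real" where \<phi>: "continuous_on UNIV \<phi>" "\<And>x. \<phi> x \<in> {0..1}"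
      "\<And>x. x \<in> (\<lambda>i. (f ^^ i) p) ` {..<n} \<Longrightarrow> \<phi> x = 1" "\<And>x. x \<notin> V \<Longrightarrow> \<phi> x = 0"
      by (rule urysohn_cutoff[OF cpt _ V(1), of "(\<lambda>i. (f ^^ i) p) ` {..<n}"])
        (use V(2) in \<open>auto intro: finite_imp_closed\<close>)
    have \<phi>X: "continuous_on X \<phi>" using \<phi>(1) continuous_on_subset by blast
    have "cutoff k V \<phi>" using V \<phi> \<phi>X by (simp add: cutoff_def)
    \<comment> \<open>The cutoff is \<open>1\<close> on the whole orbit, so the integral exceeds the
      threshold for every \<open>k\<close>, including \<open>k = 0\<close>.\<close>
    moreover have "(\<integral>x. \<phi> x \<partial>?\<nu>) = 1"
      using integral_orbit_measure[OF p(1,2) fX' p(3) \<phi>X] \<phi>(3) p(1) by simp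
    ultimately have "?\<nu> \<in> U k"
      unfolding U_def using \<nu>E by (intro CollectI conjI exI[of _ V] exI[of _ \<phi>]) simp_all
    then show "U k \<inter> T \<noteq> {}" using \<nu>E \<nu>W W(2) by blast
  qed
  have "AE (x, y) in \<nu> \<Otimes>\<^sub>M \<nu>. lower_R d f x y = 0" if \<nu>: "\<nu> \<in> E" "\<And>k. \<nu> \<in> U k" for \<nu>
  proof -
    have \<nu>B: "\<nu> \<in> borel_probs_on X" using \<nu>(1) EB by blast
    then have prob: "prob_space \<nu>" by (simp add: borel_probs_on_def)
    have "\<exists>V \<phi>. cutoff k V \<phi> \<and> (\<integral>x. \<phi> x \<partial>\<nu>) > 1 - (1 / 2) ^ k" for k
      using \<nu>(2)[of k] unfolding U_def by blast
    then obtain V \<phi> where V\<phi>: "\<And>k. cutoff k (V k) (\<phi> k)" and int: "\<And>k. (\<integral>x. \<phi> k x \<partial>\<nu>) > 1 - (1 / 2) ^ k"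
      by metis
    have V: "\<And>k. open (V k)" "\<And>k x y. x \<in> V k \<Longrightarrow> y \<in> V k \<Longrightarrow> fast_hitting d f k x y"
      and \<phi>: "\<And>k. continuous_on X (\<phi> k)" "\<And>k x. \<phi> k x \<in> {0..1::real}" "\<And>k x. x \<notin> V k \<Longrightarrow> \<phi> k x = 0"
      using V\<phi> unfolding cutoff_def by blast+
    have "AE x in \<nu>. \<forall>\<^sub>F k in sequentially. x \<in> V k"
      by (rule AE_eventually_in[OF \<nu>B V(1) \<phi> int])
    from AE_pair_both[OF prob this] show ?thesis
    proof (rule AE_mp, intro AE_I2 impI)
      fix z :: "'a \<times> 'a"
      assume "case z of (x, y) \<Rightarrow> (\<forall>\<^sub>F k in sequentially. x \<in> V k) \<and> (\<forall>\<^sub>F k in sequentially. y \<in> V k)"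
      then have "\<forall>\<^sub>F k in sequentially. fst z \<in> V k \<and> snd z \<in> V k"
        by (auto simp: split_beta intro: eventually_conj)
      then obtain K0 where "\<And>k. k \<ge> K0 \<Longrightarrow> fst z \<in> V k \<and> snd z \<in> V k"
        by (auto simp: eventually_sequentially)
      \<comment> \<open>From some index on, both coordinates lie in the same \<open>V k\<close>,
        which is all that \<open>lower_R_eq_0\<close> asks for.\<close>
      then have "\<exists>k\<ge>K. fast_hitting d f k (fst z) (snd z)" for K
        using V(2) by (intro exI[of _ "max K K0"]) auto
      then have "lower_R d f (fst z) (snd z) = 0" by (rule lower_R_eq_0)
      then show "case z of (x, y) \<Rightarrow> lower_R d f x y = 0" by (simp add: split_beta)
    qed
  qed
  then have "topspace S \<inter> \<Inter>(range U) \<subseteq> {\<mu> \<in> E. AE (x, y) in \<mu> \<Otimes>\<^sub>M \<mu>. lower_R d f x y = 0}"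
    using topS by auto
  then have "residual_in S {\<mu> \<in> E. AE (x, y) in \<mu> \<Otimes>\<^sub>M \<mu>. lower_R d f x y = 0}"
    unfolding residual_in_def using openU denseU topS by (intro conjI exI[of _ "range U"]) auto
  then show ?thesis by (simp only: S_def E_def d_def)
qed

end
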